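(* Let $G$ be one of the random networks $ER(\lambda)$, $UFS(\lambda)$, $DD(p)$ or $DD(p,p)$, where $p=\mathrm{Poisson}(\lambda)$, and let $|M_G(G)|$ be the size of the matching produced by the Greedy algorithm on its bipartite representation (on $n$ vertices). If $\lambda=0$ (respectively $\lambda=\infty$) then $\lim_{n\to\infty}|M_G(G)|/n=0$ (respectively $1$). If $\lambda\in(0,\infty)$ then $$\lim_{n\to\infty}\frac{|M_G(G)|}{n}=1-\frac{\log(2-e^{-\lambda})}{\lambda}.$$
   Context: A directed network on $V=\{1,\dots,n\}$ is identified with the bipartite network $G=(L,R,E)$, $L=R=V$, $(l,r)\in E$ iff $l\to r$; an undirected edge $\{i,j\}$ counts as $i\to j$ and $j\to i$. A matching is a set of edges no two sharing a vertex of $L$ or of $R$. Greedy algorithm: start with $M=\emptyset$; while $E\ne\emptyset$: pick an arbitrary $v\in R$; if $\deg(v)=0$ remove $v$; otherwise pick an arbitrary $u\in L$ with $(u,v)\in E$, remove $u,v$ and incident edges, add $(u,v)$ to $M$; output $M_G(G)=M$. Models: $ER(\lambda)$ — each possible edge present independently with probability $p_n$, where $np_n\to\lambda\in[0,\infty]$; $UFS(\lambda)$ — a uniformly random network on $V$ with a prescribed number $k_n$ of edges, with average degree tending to $\lambda$; $DD(p)$ — i.i.d. degrees $D_i\sim p$, vertex $i$ gets $D_i$ half-edges, half-edges paired uniformly at random into undirected edges; $DD(p_{in},p_{out})$ — independent in-degrees $\sim p_{in}$ and out-degrees $\sim p_{out}$, in- and out-half-edges paired uniformly at random into directed edges, excess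 half-edges discarded; $DD(p,p)$ is the case $p_{in}=p_{out}=p$. In all these models the asymptotic empirical degree distribution is $\mathrm{Poisson}(\lambda)$. Limits of random quantities are understood almost surely as $n\to\infty$.
   Formalization: The "arbitrary" choices of v and u are made by a rule (fixed or random) that is independent of the network and sees only the current R, resp. v and its current neighbours; network-dependent choices could give a larger matching. For DD, λ=∞ means Poisson rates tending to infinity. *)

theory Defs
  imports "HOL-Probability.Probability" "HOL-Library.While_Combinator"
begin

section \<open>Networks\<close>

text \<open>
  A directed network on \<open>V n\<close> is its set of arcs; read as a bipartite network with
  \<open>L = R = V n\<close>, the pair \<open>(l, r)\<close> is the edge between \<open>l \<in> L\<close> and \<open>r \<in> R\<close>.
  An undirected edge is the set of its end points (a singleton in case of a loop).
\<close>

type_synonym network = "(nat \<times> nat) set"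

definition V :: "nat \<Rightarrow> nat set" where
  "V n = {1..n}"

definition arcs_of :: "nat set set \<Rightarrow> network" where
  "arcs_of F = {(i, j). {i, j} \<in> F}"

definition possible_arcs :: "nat \<Rightarrow> (nat \<times> nat) set" where
  "possible_arcs n = {(i, j). i \<in> V n \<and> j \<in> V n \<and> i \<noteq> j}"

definition possible_edges :: "nat \<Rightarrow> nat set set" where
  "possible_edges n = {e. e \<subseteq> V n \<and> card e = 2}"


section \<open>The Greedy algorithm\<close>

text \<open>
  A rule resolves the arbitrary choices: the first component picks a vertex of the current set
  \<open>R\<close>, the second one picks, for the vertex \<open>v\<close> under consideration, one of
  its current neighbours. A rule has no other access to the edges of the network.
\<close>

type_synonym rule = "(nat set \<Rightarrow> nat) \<times> (nat \<Rightarrow> nat set \<Rightarrow> nat)"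

definition valid_rule :: "rule \<Rightarrow> bool" where
  "valid_rule S \<longleftrightarrow>
     (\<forall>A. finite A \<and> A \<noteq> {} \<longrightarrow> fst S A \<in> A) \<and>
     (\<forall>v N. finite N \<and> N \<noteq> {} \<longrightarrow> snd S v N \<in> N)"

type_synonym greedy_state = "nat set \<times> nat set \<times> network \<times> network"

definition greedy_step :: "rule \<Rightarrow> greedy_state \<Rightarrow> greedy_state" where
  "greedy_step S = (\<lambda>(L, R, E, M).
     let v = fst S R; N = {u \<in> L. (u, v) \<in> E} in
     if N = {} then (L, R - {v}, E, M)
     else let u = snd S v N in
       (L - {u}, R - {v}, {(a, b) \<in> E. a \<noteq> u \<and> b \<noteq> v}, insert (u, v) M))"

definition greedy_matching :: "rule \<Rightarrow> nat \<Rightarrow> network \<Rightarrow> network" where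
  "greedy_matching S n G =
     (case while (\<lambda>(L, R, E, M). E \<noteq> {}) (greedy_step S) (V n, V n, G, {}) of
        (L, R, E, M) \<Rightarrow> M)"


section \<open>Random network models\<close>

definition random_subset :: "'a set \<Rightarrow> real \<Rightarrow> 'a set pmf" where
  "random_subset A p = map_pmf (\<lambda>f. {x \<in> A. f x}) (Pi_pmf A False (\<lambda>_. bernoulli_pmf p))"

definition ER_directed :: "ennreal \<Rightarrow> (nat \<Rightarrow> network pmf) \<Rightarrow> bool" where
  "ER_directed lam law \<longleftrightarrow>
     (\<exists>p. (\<forall>n. 0 \<le> p n \<and> p n \<le> 1) \<and>
          ((\<lambda>n. ennreal (real n * p n)) \<longlonglongrightarrow> lam) \<and>
          (\<forall>n. law n = random_subset (possible_arcs n) (p n)))"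

definition ER_undirected :: "ennreal \<Rightarrow> (nat \<Rightarrow> network pmf) \<Rightarrow> bool" where
  "ER_undirected lam law \<longleftrightarrow>
     (\<exists>p. (\<forall>n. 0 \<le> p n \<and> p n \<le> 1) \<and>
          ((\<lambda>n. ennreal (real n * p n)) \<longlonglongrightarrow> lam) \<and>
          (\<forall>n. law n = map_pmf arcs_of (random_subset (possible_edges n) (p n))))"

definition UFS_directed :: "ennreal \<Rightarrow> (nat \<Rightarrow> network pmf) \<Rightarrow> bool" where
  "UFS_directed lam law \<longleftrightarrow>
     (\<exists>k. (\<forall>n. k n \<le> card (possible_arcs n)) \<and>
          ((\<lambda>n. ennreal (real (k n) / real n)) \<longlonglongrightarrow> lam) \<and>
          (\<forall>n. law n = pmf_of_set {G. G \<subseteq> possible_arcs n \<and> card G = k n}))"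

definition UFS_undirected :: "ennreal \<Rightarrow> (nat \<Rightarrow> network pmf) \<Rightarrow> bool" where
  "UFS_undirected lam law \<longleftrightarrow>
     (\<exists>k. (\<forall>n. k n \<le> card (possible_edges n)) \<and>
          ((\<lambda>n. ennreal (2 * real (k n) / real n)) \<longlonglongrightarrow> lam) \<and>
          (\<forall>n. law n =
             map_pmf arcs_of (pmf_of_set {F. F \<subseteq> possible_edges n \<and> card F = k n})))"

text \<open>The half-edges at vertex \<open>i\<close> are \<open>(i, 0), \<dots>, (i, D i - 1)\<close>.\<close>

definition half_edges :: "nat \<Rightarrow> (nat \<Rightarrow> nat) \<Rightarrow> (nat \<times> nat) set" where
  "half_edges n D = (SIGMA i:V n. {..<D i})"

text \<open>If the number of half-edges is odd, one of them stays unpaired.\<close>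

definition pairings :: "'a set \<Rightarrow> 'a set set set" where
  "pairings H =
     {P. (\<forall>e\<in>P. e \<subseteq> H \<and> card e = 2) \<and> pairwise disjnt P \<and> card P = card H div 2}"

definition directed_pairings :: "'a set \<Rightarrow> 'b set \<Rightarrow> ('a \<times> 'b) set set" where
  "directed_pairings Hout Hin =
     {P. P \<subseteq> Hout \<times> Hin \<and> inj_on fst P \<and> inj_on snd P \<and>
         card P = min (card Hout) (card Hin)}"

definition DD_undirected :: "nat pmf \<Rightarrow> nat \<Rightarrow> network pmf" where
  "DD_undirected p n =
     bind_pmf (Pi_pmf (V n) 0 (\<lambda>_. p)) (\<lambda>D.
     map_pmf (\<lambda>P. arcs_of ((\<lambda>e. fst ` e) ` P)) (pmf_of_set (pairings (half_edges n D))))"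

definition DD_directed :: "nat pmf \<Rightarrow> nat pmf \<Rightarrow> nat \<Rightarrow> network pmf" where
  "DD_directed p_in p_out n =
     bind_pmf (Pi_pmf (V n) 0 (\<lambda>_. p_in)) (\<lambda>Din.
     bind_pmf (Pi_pmf (V n) 0 (\<lambda>_. p_out)) (\<lambda>Dout.
     map_pmf (\<lambda>P. (\<lambda>(h, h'). (fst h, fst h')) ` P)
       (pmf_of_set (directed_pairings (half_edges n Dout) (half_edges n Din)))))"

text \<open>The library's Poisson distribution is specified for positive rates only.\<close>

definition Poisson :: "real \<Rightarrow> nat pmf" where
  "Poisson r = (if r = 0 then return_pmf 0 else poisson_pmf r)"

text \<open>
  For finite \<open>lam\<close> the degree distribution is the fixed distribution \<open>Poisson(lam)\<close>. There is no
  distribution \<open>Poisson(\<infinity>)\<close> on the natural numbers; as in the other models, \<open>lam = \<infinity>\<close>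
  stands for finite rates that tend to infinity with \<open>n\<close>.
\<close>

definition Poisson_rates :: "ennreal \<Rightarrow> (nat \<Rightarrow> real) \<Rightarrow> bool" where
  "Poisson_rates lam r \<longleftrightarrow>
     (if lam = \<infinity> then (\<forall>n. 0 \<le> r n) \<and> filterlim r at_top sequentially
      else (\<forall>n. r n = enn2real lam))"

definition DD_Poisson_undirected :: "ennreal \<Rightarrow> (nat \<Rightarrow> network pmf) \<Rightarrow> bool" where
  "DD_Poisson_undirected lam law \<longleftrightarrow>
     (\<exists>r. Poisson_rates lam r \<and> (\<forall>n. law n = DD_undirected (Poisson (r n)) n))"

definition DD_Poisson_directed :: "ennreal \<Rightarrow> (nat \<Rightarrow> network pmf) \<Rightarrow> bool" where
  "DD_Poisson_directed lam law \<longleftrightarrow>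
     (\<exists>r. Poisson_rates lam r \<and>
          (\<forall>n. law n = DD_directed (Poisson (r n)) (Poisson (r n)) n))"


section \<open>Well-definedness\<close>

lemma finite_half_edges: "finite (half_edges n D)"
  by (auto simp: half_edges_def V_def)

lemma finite_pairings:
  assumes "finite H" shows "finite (pairings H)"
  by (rule finite_subset[of _ "Pow (Pow H)"]) (use assms in \<open>auto simp: pairings_def\<close>)

lemma pairings_nonempty:
  assumes "finite H" shows "pairings H \<noteq> {}"
  using assms
proof (induction "card H" arbitrary: H rule: less_induct)
  case less
  show ?case
  proof (cases "card H < 2")
    case True
    then have "{} \<in> pairings H" by (auto simp: pairings_def)
    then show ?thesis by blast
  next
    case False
    then obtain e where e: "e \<subseteq> H" "card e = 2"
      by (meson not_less obtain_subset_with_card_n)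
    have fe: "finite e" using e less.prems finite_subset by blast
    have c: "card (H - e) = card H - 2" using e fe by (simp add: card_Diff_subset)
    then have "card (H - e) < card H" using False by simp
    then obtain P where P: "P \<in> pairings (H - e)" using less by blast
    have "finite P"
      by (rule finite_subset[of _ "Pow H"]) (use P less.prems in \<open>auto simp: pairings_def\<close>)
    moreover have "e \<notin> P"
    proof
      assume "e \<in> P"
      then have "e \<subseteq> H - e" using P by (auto simp: pairings_def)
      then have "e = {}" by blast
      then show False using e by simp
    qed
    moreover have "\<forall>a\<in>P. disjnt a e" using P by (auto simp: pairings_def disjnt_def)
    ultimately have "insert e P \<in> pairings H"
      using P e c False by (auto simp: pairings_def pairwise_insert disjnt_sym)
    then show ?thesis by blast
  qed
qed

lemma finite_directed_pairings:
  assumes "finite H" "finite K" shows "finite (directed_pairings H K)"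
  by (rule finite_subset[of _ "Pow (H \<times> K)"]) (use assms in \<open>auto simp: directed_pairings_def\<close>)

lemma directed_pairings_nonempty:
  assumes "finite H" "finite K" shows "directed_pairings H K \<noteq> {}"
proof -
  obtain A B where A: "A \<subseteq> H" "card A = min (card H) (card K)"
    and B: "B \<subseteq> K" "card B = min (card H) (card K)"
    by (meson min.cobounded1 min.cobounded2 obtain_subset_with_card_n)
  have "finite A" "finite B" using A B assms finite_subset by auto
  then obtain f where f: "bij_betw f A B"
    using A B by (metis finite_same_card_bij)
  have "(\<lambda>x. (x, f x)) ` A \<in> directed_pairings H K"
    using A B f
    by (auto simp: directed_pairings_def inj_on_def bij_betw_def card_image)
  then show ?thesis by blast
qed

lemma greedy_while_terminates:
  assumes "valid_rule S" "finite R" "finite L" "E \<subseteq> L \<times> R"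
  shows "\<exists>t. while_option (\<lambda>(L, R, E, M). E \<noteq> {}) (greedy_step S) (L, R, E, M) = Some t"
proof -
  let ?I = "\<lambda>(L, R, E, M). finite L \<and> finite R \<and> E \<subseteq> L \<times> R"
  show ?thesis
  proof (rule measure_while_option_Some[where P = ?I and f = "\<lambda>(L, R, E, M). card R"])
    show "?I (L, R, E, M)" using assms by auto
  next
    fix s :: greedy_state
    assume I: "?I s" and b: "(\<lambda>(L, R, E, M). E \<noteq> {}) s"
    obtain L R E M where s: "s = (L, R, E, M)" by (cases s)
    have R: "finite R" "R \<noteq> {}" "finite L" "E \<subseteq> L \<times> R" using I b by (auto simp: s)
    have "fst S R \<in> R" using assms(1) R by (auto simp: valid_rule_def)
    then have "card (R - {fst S R}) < card R" using R by (intro card_Diff1_less) auto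
    then show "?I (greedy_step S s) \<and>
        (\<lambda>(L, R, E, M). card R) (greedy_step S s) < (\<lambda>(L, R, E, M). card R) s"
      using R by (auto simp: greedy_step_def Let_def s)
  qed
qed

end

theory Submission
  imports Defs
begin

text \<open>
  Since a rule sees the current set \<open>R\<close> only, it processes \<open>R\<close> in a fixed order \<open>v 0, v 1, \<dots>\<close>;
  let \<open>l\<close> be the number of free left vertices at time \<open>t\<close>. If the arcs into \<open>v t\<close> were fresh,
  \<open>v t\<close> would stay unmatched with probability about \<open>exp (- lam l / n)\<close>, so that \<open>z = exp (lam l / n)\<close>
  satisfies \<open>z' = - lam (z - 1)\<close> and ends at \<open>2 - exp (- lam)\<close>.

  In the undirected models an edge is inspected from both of its ends, and arcs are not fresh. Whether
  a left vertex is free depends only on paths along which time decreases; long ones are rare by a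
  factor \<open>1 / k!\<close>, and with high probability short ones close no cycle. Hence deleting the edges of
  \<open>v t\<close> hardly changes the past, which gives the drift of the mean. The same locality, after
  truncation of large degrees, makes the number of unmatched vertices a Lipschitz function of
  independent bits up to a small error, so that it concentrates exponentially fast for every fixed rule.

  Conditioning on the number of edges costs a polynomial factor only. This transfers the bounds to a
  fixed number of edges and, as Poisson degrees with uniform pairing amount to independent uniform end
  points, to the models with prescribed degrees. For infinite \<open>lam\<close> the matching is maximal and a
  union bound over pairs of vertex sets without edges suffices.
\<close>

section \<open>The Greedy algorithm as a sequential process\<close>

text \<open>Networks of different sizes may be coupled in any way and a rule may be random, so
  convergence in probability does not suffice. What is needed are deviation bounds for fixed rules,
  summable in \<open>n\<close>, uniform in the rule, and small enough to survive polynomial factors.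
  An undirected edge is a single random bit behind two arcs. Both kinds of network are treated
  together by a map from ordered pairs to bits under which at most the two orientations of a pair
  coincide. Loops have their own probability \<open>q\<close>: it is 0 where loops are excluded, and
  smaller than \<open>p\<close> when undirected edges arise from paired half-edges, where a loop is
  hit half as often. No uniform Lipschitz constant is at hand for the number of unmatched vertices,
  since a change may spread through vertices of large degree or along long chains. Its distance from
  a Lipschitz function is measured by the number of chains of length \<open>k\<close> and the total
  surplus of degrees over \<open>D\<close>, and these two can in turn be controlled by Lipschitz
  functions. The constants are chosen in the order \<open>k\<close>, \<open>D\<close>,
  \<open>n\<close>.\<close>

locale run =
  fixes n :: nat and v :: "nat \<Rightarrow> nat" and ch :: "nat \<Rightarrow> nat set \<Rightarrow> nat"
  assumes v_bij: "bij_betw v {..<n} (V n)"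
    and ch_in: "\<And>r N. finite N \<Longrightarrow> N \<noteq> {} \<Longrightarrow> ch r N \<in> N"
begin

primrec avail :: "network \<Rightarrow> nat \<Rightarrow> nat set" where
  "avail G 0 = V n"
| "avail G (Suc t) =
     (let N = {u \<in> avail G t. (u, v t) \<in> G} in if N = {} then avail G t else avail G t - {ch (v t) N})"

definition unm :: "network \<Rightarrow> nat \<Rightarrow> bool" where
  "unm G t \<longleftrightarrow> (\<forall>u\<in>avail G t. (u, v t) \<notin> G)"

definition U :: "network \<Rightarrow> nat \<Rightarrow> nat" where
  "U G T = card {t. t < T \<and> unm G t}"

lemma finite_V [simp]: "finite (V n)" and card_V [simp]: "card (V n) = n"
  by (auto simp: V_def)

lemma v_in: "t < n \<Longrightarrow> v t \<in> V n"
  using v_bij by (auto simp: bij_betw_def)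

lemma v_eq_iff: "s < n \<Longrightarrow> t < n \<Longrightarrow> v s = v t \<longleftrightarrow> s = t"
  using v_bij by (auto simp: bij_betw_def inj_on_def)

lemma avail_subset: "avail G t \<subseteq> V n"
  by (induction t) (auto simp: Let_def)

lemma finite_avail [simp]: "finite (avail G t)"
  using avail_subset finite_V finite_subset by blast

lemma U_0 [simp]: "U G 0 = 0"
  by (simp add: U_def)

lemma U_Suc: "U G (Suc T) = U G T + (if unm G T then 1 else 0)"
proof -
  have "{t. t < Suc T \<and> unm G t} = {t. t < T \<and> unm G t} \<union> (if unm G T then {T} else {})"
    by (auto simp: less_Suc_eq)
  then show ?thesis by (simp add: U_def)
qed

lemma U_le: "U G T \<le> T"
  by (induction T) (auto simp: U_Suc)

text \<open>Each step either uses up one left vertex or leaves \<open>v t\<close> unmatched. The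
  number of free left vertices, which drives the process, is therefore known once \<open>U\<close>
  is.\<close>

lemma card_avail: "card (avail G t) + t = n + U G t"
proof (induction t)
  case (Suc t)
  show ?case
  proof (cases "unm G t")
    case True
    then have "{u \<in> avail G t. (u, v t) \<in> G} = {}" by (auto simp: unm_def)
    then show ?thesis using Suc True by (simp add: U_Suc Let_def)
  next
    case False
    let ?N = "{u \<in> avail G t. (u, v t) \<in> G}"
    have N: "?N \<noteq> {}" using False by (auto simp: unm_def)
    have "ch (v t) ?N \<in> ?N" by (rule ch_in[OF _ N]) simp
    then have "card (avail G t - {ch (v t) ?N}) + 1 = card (avail G t)"
      by (metis (no_types, lifting) One_nat_def Suc_eq_plus1 card_Suc_Diff1 finite_avail mem_Collect_eq)
    then show ?thesis using Suc False N by (simp add: U_Suc Let_def)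
  qed
qed simp

text \<open>
  Whether \<open>u\<close> has been taken before time \<open>t\<close> does not involve the availability of \<open>u\<close> itself:
  the first vertex that would take \<open>u\<close> if it were available does take it.
\<close>
lemma avail_iff:
  "u \<in> avail G t \<longleftrightarrow> u \<in> V n \<and> (\<forall>s<t. (u, v s) \<in> G \<longrightarrow>
     ch (v s) (insert u {w. (w, v s) \<in> G \<and> w \<noteq> u \<and> w \<in> avail G s}) \<noteq> u)"
proof (induction t)
  case (Suc t)
  let ?N = "{u \<in> avail G t. (u, v t) \<in> G}"
  show ?case
  proof (cases "u \<in> avail G t \<and> (u, v t) \<in> G")
    case True
    then have "?N = insert u {w. (w, v t) \<in> G \<and> w \<noteq> u \<and> w \<in> avail G t}" by auto
    then show ?thesis using True Suc by (auto simp: Let_def less_Suc_eq)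
  next
    case False
    have "?N \<noteq> {} \<Longrightarrow> ch (v t) ?N \<in> ?N" by (rule ch_in) simp_all
    then have "u \<in> avail G (Suc t) \<longleftrightarrow> u \<in> avail G t" using False by (auto simp: Let_def)
    then show ?thesis using False Suc by (auto simp: less_Suc_eq)
  qed
qed simp

end

section \<open>From the while loop to the process\<close>

primrec remaining :: "rule \<Rightarrow> nat \<Rightarrow> nat \<Rightarrow> nat set" where
  "remaining S n 0 = V n"
| "remaining S n (Suc t) = remaining S n t - {fst S (remaining S n t)}"

definition vert :: "rule \<Rightarrow> nat \<Rightarrow> nat \<Rightarrow> nat" where
  "vert S n t = fst S (remaining S n t)"

lemma finite_remaining: "finite (remaining S n t)"
  by (induction t) (auto simp: V_def)

lemma card_remaining:
  assumes "valid_rule S" "t \<le> n"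
  shows "card (remaining S n t) = n - t"
  using assms(2)
proof (induction t)
  case (Suc t)
  then have c: "card (remaining S n t) = n - t" by simp
  then have "remaining S n t \<noteq> {}" using Suc.prems by auto
  then have "fst S (remaining S n t) \<in> remaining S n t"
    using assms(1) finite_remaining by (auto simp: valid_rule_def)
  then show ?case using c by simp
qed (simp add: V_def)

lemma vert_in_remaining:
  assumes "valid_rule S" "t < n"
  shows "vert S n t \<in> remaining S n t"
proof -
  have "remaining S n t \<noteq> {}" using card_remaining[OF assms(1), of t n] assms(2) by auto
  then show ?thesis using assms(1) finite_remaining by (auto simp: valid_rule_def vert_def)
qed

lemma remaining_antimono: "s \<le> t \<Longrightarrow> remaining S n t \<subseteq> remaining S n s"
  by (induction t rule: dec_induct) auto

lemma vert_notin_remaining: "s < t \<Longrightarrow> vert S n s \<notin> remaining S n t"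
  using remaining_antimono[of "Suc s" t S n] by (auto simp: vert_def)

lemma vert_bij:
  assumes "valid_rule S"
  shows "bij_betw (vert S n) {..<n} (V n)"
proof -
  have "inj_on (vert S n) {..<n}"
  proof (rule linorder_inj_onI)
    fix s t assume "s < t" "s \<in> {..<n}" "t \<in> {..<n}"
    then show "vert S n s \<noteq> vert S n t"
      using vert_notin_remaining[of s t S n] vert_in_remaining[OF assms, of t n] by auto
  qed auto
  moreover have "vert S n ` {..<n} \<subseteq> V n"
    using vert_in_remaining[OF assms] remaining_antimono[of 0 _ S n] by fastforce
  ultimately show ?thesis
    by (metis bij_betw_def card_image card_lessThan card_subset_eq finite_atLeastAtMost V_def
        card_atLeastAtMost diff_Suc_1)
qed

lemma run_rule:
  assumes "valid_rule S"
  shows "run n (vert S n) (snd S)"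
  using assms vert_bij[OF assms] by unfold_locales (auto simp: valid_rule_def)

text \<open>The loop stops as soon as no arc is left, whereas the process always runs for
  \<open>n\<close> steps; the steps after the stop only meet unmatched vertices and are added to
  \<open>U\<close> at the end.\<close>

lemma card_greedy_matching:
  assumes S: "valid_rule S" and G: "G \<subseteq> V n \<times> V n"
  shows "card (greedy_matching S n G) + run.U n (vert S n) (snd S) G n = n"
proof -
  interpret run n "vert S n" "snd S" by (rule run_rule[OF S])
  \<comment> \<open>The loop does not touch \<open>E\<close> when it discards an isolated vertex,
    which is consistent with the restricted network because no arc into that vertex is left. The
    condition on \<open>snd\<close> guarantees that every inserted arc is new, so that
    \<open>card M\<close> grows by one.\<close>
  define I :: "greedy_state \<Rightarrow> bool" where "I = (\<lambda>(L, R, E, M). \<exists>t\<le>n. L = avail G t \<and> R = remaining S n t \<and>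
      E = G \<inter> (avail G t \<times> remaining S n t) \<and> finite M \<and> snd ` M \<inter> remaining S n t = {} \<and>
      card M + U G t = t)"
  let ?P = "\<lambda>s::greedy_state. (\<lambda>(L, R, E, M). E \<noteq> {}) s"
  have step: "I (greedy_step S s) \<and> (\<lambda>(L, R, E, M). card R) (greedy_step S s) < (\<lambda>(L, R, E, M). card R) s"
    if "I s" "?P s" for s :: greedy_state
  proof -
    obtain t M where t: "t \<le> n" and s: "s = (avail G t, remaining S n t,
        G \<inter> (avail G t \<times> remaining S n t), M)" and M: "finite M"
      "snd ` M \<inter> remaining S n t = {}" "card M + U G t = t"
      using \<open>I s\<close> by (auto simp: I_def split: prod.splits)
    have "remaining S n t \<noteq> {}" using \<open>?P s\<close> by (auto simp: s)
    then have tn: "t < n" using t card_remaining[OF S t] finite_remaining[of S n t] by force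
    let ?v = "vert S n t"
    have vR: "?v \<in> remaining S n t" by (rule vert_in_remaining[OF S tn])
    have v: "fst S (remaining S n t) = ?v" by (simp add: vert_def)
    let ?N = "{u \<in> avail G t. (u, ?v) \<in> G}"
    have N': "{u \<in> avail G t. (u, ?v) \<in> G \<inter> (avail G t \<times> remaining S n t)} = ?N"
      using vR by auto
    have dec: "card (remaining S n (Suc t)) < card (remaining S n t)"
      using card_remaining[OF S, of "Suc t" n] card_remaining[OF S, of t n] tn by simp
    show ?thesis
    proof (cases "?N = {}")
      case True
      then have "unm G t" by (auto simp: unm_def)
      then have "card M + U G (Suc t) = Suc t" using M by (simp add: U_Suc)
      moreover have a: "avail G (Suc t) = avail G t" using True by (simp add: Let_def)
      moreover have "G \<inter> (avail G t \<times> remaining S n t) = G \<inter> (avail G t \<times> remaining S n (Suc t))"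
        using True by (auto simp: v)
      moreover have "greedy_step S s = (avail G t, remaining S n (Suc t),
          G \<inter> (avail G t \<times> remaining S n t), M)"
        unfolding greedy_step_def s prod.case Let_def v N' using True by (simp add: v)
      ultimately show ?thesis using M tn dec
        by (auto simp: I_def s simp del: avail.simps intro!: exI[of _ "Suc t"])
    next
      case False
      let ?u = "snd S ?v ?N"
      have u: "?u \<in> ?N" by (rule ch_in[OF _ False]) simp
      have "\<not> unm G t" using u by (auto simp: unm_def)
      moreover have "(?u, ?v) \<notin> M" using M(2) vR by force
      ultimately have "card (insert (?u, ?v) M) + U G (Suc t) = Suc t" using M by (simp add: U_Suc)
      moreover have a: "avail G (Suc t) = avail G t - {?u}" using False by (simp only: avail.simps Let_def if_False)
      moreover have "{(a, b) \<in> G \<inter> (avail G t \<times> remaining S n t). a \<noteq> ?u \<and> b \<noteq> ?v} =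
          G \<inter> ((avail G t - {?u}) \<times> remaining S n (Suc t))"
        by (auto simp: v)
      moreover have "greedy_step S s = (avail G t - {?u}, remaining S n (Suc t),
          {(a, b) \<in> G \<inter> (avail G t \<times> remaining S n t). a \<noteq> ?u \<and> b \<noteq> ?v}, insert (?u, ?v) M)"
        unfolding greedy_step_def s prod.case Let_def v N' using False
        by (simp only: if_False remaining.simps v)
      ultimately show ?thesis using M tn dec v
        by (auto simp: I_def s simp del: avail.simps intro!: exI[of _ "Suc t"])
    qed
  qed
  have "case while ?P (greedy_step S) (V n, V n, G, {}) of (L, R, E, M) \<Rightarrow> card M + U G n = n"
  proof (rule while_rule[where P = I and r = "Wellfounded.measure (\<lambda>(L, R, E, M). card R)"])
    show "I (V n, V n, G, {})" using G by (auto simp: I_def intro!: exI[of _ 0])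
    show "I (greedy_step S s)" if "I s" "?P s" for s using step[OF that] by simp
    show "(greedy_step S s, s) \<in> Wellfounded.measure (\<lambda>(L, R, E, M). card R)" if "I s" "?P s" for s
      using step[OF that] by simp
    show "case s of (L, R, E, M) \<Rightarrow> card M + U G n = n" if "I s" and P: "\<not> ?P s" for s
    proof -
      obtain t M where t: "t \<le> n" and s: "s = (avail G t, remaining S n t,
          G \<inter> (avail G t \<times> remaining S n t), M)" and M: "card M + U G t = t"
        using \<open>I s\<close> by (auto simp: I_def split: prod.splits)
      have E: "G \<inter> (avail G t \<times> remaining S n t) = {}" using P by (simp add: s)
      \<comment> \<open>No arc joins a free left vertex to a remaining right vertex, so from here on
        every step leaves its vertex unmatched.\<close>
      have "avail G t' = avail G t \<and> U G t' = U G t + (t' - t)" if "t \<le> t'" "t' \<le> n" for t'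
        using that
      proof (induction t' rule: dec_induct)
        case (step m)
        have "vert S n m \<in> remaining S n t"
          using vert_in_remaining[OF S, of m n] remaining_antimono[of t m S n] step by auto
        then have N: "{u \<in> avail G m. (u, vert S n m) \<in> G} = {}" using E step by auto
        then have "unm G m" by (auto simp: unm_def)
        then show ?case using N step by (auto simp: U_Suc Let_def)
      qed simp
      from this[OF t order_refl] show ?thesis using M t by (simp add: s)
    qed
  qed auto
  then show ?thesis by (auto simp: greedy_matching_def split: prod.splits)
qed

section \<open>Local approximation\<close>

definition nbrs :: "network \<Rightarrow> nat \<Rightarrow> nat set" where
  "nbrs H a = {b. (a, b) \<in> H \<or> (b, a) \<in> H}"

primrec nball :: "network \<Rightarrow> nat \<Rightarrow> nat set \<Rightarrow> nat set" where
  "nball H 0 A = A"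
| "nball H (Suc k) A = nball H k A \<union> (\<Union>a\<in>nball H k A. nbrs H a)"

lemma ball_mono_radius: "k \<le> l \<Longrightarrow> nball H k A \<subseteq> nball H l A"
  by (induction l rule: dec_induct) auto

lemma notin_ball_nbr: "b \<notin> nball H (Suc k) A \<Longrightarrow> (a, b) \<in> H \<or> (b, a) \<in> H \<Longrightarrow> a \<notin> nball H k A"
  by (auto simp: nbrs_def)

text \<open>Vertices outside \<open>W\<close> multiply the ball by at most \<open>D + 1\<close> in
  each round, and those of \<open>W\<close> add their total degree. The factor \<open>D + 2\<close>
  absorbs that additive term, so that the bound is linear in the degrees of \<open>W\<close>; this
  linearity is what later produces a bound linear in \<open>excess\<close>.\<close>

lemma card_ball_le:
  assumes W: "finite W" and fin: "\<And>a. finite (nbrs H a)"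
    and D: "\<And>a. a \<notin> W \<Longrightarrow> card (nbrs H a) \<le> D" and A: "finite A"
  shows "finite (nball H k A) \<and> card (nball H k A) \<le> (D + 2) ^ k * (card A + (\<Sum>w\<in>W. card (nbrs H w)))"
proof (induction k)
  case 0
  then show ?case using A by simp
next
  case (Suc k)
  let ?B = "nball H k A" and ?q = "\<Sum>w\<in>W. card (nbrs H w)"
  have fB: "finite ?B" using Suc by simp
  have "(\<Sum>a\<in>?B. card (nbrs H a)) \<le> (\<Sum>a\<in>(?B - W) \<union> W. card (nbrs H a))"
    using fB W by (intro sum_mono2) auto
  also have "\<dots> = (\<Sum>a\<in>?B - W. card (nbrs H a)) + ?q"
    using fB W by (intro sum.union_disjoint) auto
  also have "(\<Sum>a\<in>?B - W. card (nbrs H a)) \<le> card (?B - W) * D"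
    using sum_bounded_above[of "?B - W" "\<lambda>a. card (nbrs H a)" D] D by simp
  also have "card (?B - W) * D \<le> card ?B * D"
    using fB by (simp add: card_mono)
  finally have s: "(\<Sum>a\<in>?B. card (nbrs H a)) \<le> card ?B * D + ?q" by simp
  have "card (nball H (Suc k) A) \<le> card ?B + card (\<Union>a\<in>?B. nbrs H a)"
    by (simp add: card_Un_le)
  also have "card (\<Union>a\<in>?B. nbrs H a) \<le> (\<Sum>a\<in>?B. card (nbrs H a))"
    by (rule card_UN_le[OF fB])
  finally have "card (nball H (Suc k) A) \<le> (D + 1) * card ?B + ?q"
    using s by (simp add: algebra_simps)
  also have "\<dots> \<le> (D + 1) * ((D + 2) ^ k * (card A + ?q)) + (D + 2) ^ k * (card A + ?q)"
  proof (intro add_mono mult_left_mono)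
    have "?q \<le> 1 * (card A + ?q)" by simp
    also have "\<dots> \<le> (D + 2) ^ k * (card A + ?q)" by (intro mult_right_mono) auto
    finally show "?q \<le> (D + 2) ^ k * (card A + ?q)" .
  qed (use Suc in auto)
  also have "\<dots> = (D + 2) ^ Suc k * (card A + ?q)" by (simp add: algebra_simps)
  finally show ?case using fB fin by simp
qed

definition differ_at :: "network \<Rightarrow> network \<Rightarrow> nat set \<Rightarrow> bool" where
  "differ_at G G' A \<longleftrightarrow> (\<forall>a b. ((a, b) \<in> G) \<noteq> ((a, b) \<in> G') \<longrightarrow> a \<in> A \<or> b \<in> A)"

text \<open>An arc in which the networks differ touches \<open>A\<close>, so both of its ends lie in
  the ball of radius 1.\<close>

lemma differ_at_ball:
  assumes "differ_at G G' A" "a \<notin> nball (G \<union> G') (Suc k) A \<or> b \<notin> nball (G \<union> G') (Suc k) A"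
  shows "(a, b) \<in> G \<longleftrightarrow> (a, b) \<in> G'"
proof (rule ccontr)
  assume ne: "\<not> ?thesis"
  then have "a \<in> A \<or> b \<in> A" using assms(1) by (simp add: differ_at_def)
  moreover have "b \<in> nbrs (G \<union> G') a" "a \<in> nbrs (G \<union> G') b" using ne by (auto simp: nbrs_def)
  ultimately have "a \<in> nball (G \<union> G') (Suc 0) A" "b \<in> nball (G \<union> G') (Suc 0) A" by auto
  moreover have "nball (G \<union> G') (Suc 0) A \<subseteq> nball (G \<union> G') (Suc k) A" by (rule ball_mono_radius) simp
  ultimately show False using assms(2) by blast
qed

section \<open>The recursion for availability, stopped at depth k\<close>

context run
begin

text \<open>The recursion of \<open>avail_iff\<close>, cut off after \<open>k\<close> rounds, where
  every left vertex counts as free.\<close>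

primrec av :: "network \<Rightarrow> nat \<Rightarrow> nat \<Rightarrow> nat \<Rightarrow> bool" where
  "av G 0 u t \<longleftrightarrow> u \<in> V n"
| "av G (Suc k) u t \<longleftrightarrow> u \<in> V n \<and> (\<forall>s<t. (u, v s) \<in> G \<longrightarrow>
     ch (v s) (insert u {w. (w, v s) \<in> G \<and> w \<noteq> u \<and> av G k w s}) \<noteq> u)"

text \<open>A path of \<open>2 * k\<close> arcs that alternates between left and right vertices,
  with decreasing times at the right ones. The condition on \<open>w\<close> only forbids turning
  straight back; left vertices may repeat.\<close>

primrec chain :: "network \<Rightarrow> nat \<Rightarrow> nat \<Rightarrow> nat \<Rightarrow> bool" where
  "chain G 0 u t \<longleftrightarrow> True"
| "chain G (Suc k) u t \<longleftrightarrow> (\<exists>s<t. (u, v s) \<in> G \<and> (\<exists>w. w \<noteq> u \<and> (w, v s) \<in> G \<and> chain G k w s))"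

definition av_unm :: "network \<Rightarrow> nat \<Rightarrow> nat \<Rightarrow> bool" where
  "av_unm G k t \<longleftrightarrow> (\<forall>u. (u, v t) \<in> G \<longrightarrow> \<not> av G k u t)"

definition chain_from :: "network \<Rightarrow> nat \<Rightarrow> nat \<Rightarrow> bool" where
  "chain_from G k t \<longleftrightarrow> (\<exists>u. (u, v t) \<in> G \<and> chain G k u t)"

text \<open>A wrong answer at depth \<open>Suc k\<close> must come from a competitor
  \<open>w\<close> of \<open>u\<close> at an earlier time whose status is wrong at depth
  \<open>k\<close>. Tracing the error back yields the chain.\<close>

lemma av_avail: "av G k u t \<noteq> (u \<in> avail G t) \<Longrightarrow> chain G k u t"
proof (induction k arbitrary: u t)
  case (Suc k)
  have "\<exists>s<t. (u, v s) \<in> G \<and> (\<exists>w. w \<noteq> u \<and> (w, v s) \<in> G \<and> av G k w s \<noteq> (w \<in> avail G s))"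
  proof (rule ccontr)
    assume "\<not> ?thesis"
    then have "{w. (w, v s) \<in> G \<and> w \<noteq> u \<and> av G k w s} = {w. (w, v s) \<in> G \<and> w \<noteq> u \<and> w \<in> avail G s}"
      if "s < t" "(u, v s) \<in> G" for s using that by blast
    then have "av G (Suc k) u t \<longleftrightarrow> u \<in> avail G t"
      by (subst avail_iff) simp
    then show False using Suc.prems by simp
  qed
  then show ?case using Suc.IH by fastforce
qed simp

lemma av_unm_unm: "av_unm G k t \<noteq> unm G t \<Longrightarrow> chain_from G k t"
  using av_avail unfolding av_unm_def unm_def chain_from_def by metis

text \<open>Each round of the recursion walks two arcs, from \<open>u\<close> to \<open>v s\<close>
  and on to \<open>w\<close>, and so uses up two units of the radius.\<close>

lemma av_local:
  assumes "differ_at G G' A"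
  shows "u \<notin> nball (G \<union> G') (2 * k + 1) A \<Longrightarrow> av G k u t = av G' k u t"
proof (induction k arbitrary: u t)
  case (Suc k)
  let ?H = "G \<union> G'"
  have u: "u \<notin> nball ?H (Suc (Suc (2 * k + 1))) A" using Suc.prems by simp
  have G: "(u, v s) \<in> G \<longleftrightarrow> (u, v s) \<in> G'" for s by (rule differ_at_ball[OF assms disjI1[OF u]])
  have "{w. (w, v s) \<in> G \<and> w \<noteq> u \<and> av G k w s} = {w. (w, v s) \<in> G' \<and> w \<noteq> u \<and> av G' k w s}"
    if "(u, v s) \<in> G" for s
  proof -
    have s: "v s \<notin> nball ?H (Suc (2 * k + 1)) A" using notin_ball_nbr[OF u] that by auto
    have "(w, v s) \<in> G \<longleftrightarrow> (w, v s) \<in> G'" for w by (rule differ_at_ball[OF assms disjI2[OF s]])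
    moreover have "av G k w s = av G' k w s" if "(w, v s) \<in> G" for w
      by (rule Suc.IH, rule notin_ball_nbr[OF s]) (use that in auto)
    ultimately show ?thesis by blast
  qed
  then show ?case using G by simp
qed simp

lemma chain_local:
  assumes "differ_at G G' A"
  shows "u \<notin> nball (G \<union> G') (2 * k + 1) A \<Longrightarrow> chain G k u t = chain G' k u t"
proof (induction k arbitrary: u t)
  case (Suc k)
  let ?H = "G \<union> G'"
  have u: "u \<notin> nball ?H (Suc (Suc (2 * k + 1))) A" using Suc.prems by simp
  have G: "(u, v s) \<in> G \<longleftrightarrow> (u, v s) \<in> G'" for s by (rule differ_at_ball[OF assms disjI1[OF u]])
  have "(w, v s) \<in> G \<and> chain G k w s \<longleftrightarrow> (w, v s) \<in> G' \<and> chain G' k w s" if "(u, v s) \<in> G" for w s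
  proof -
    have s: "v s \<notin> nball ?H (Suc (2 * k + 1)) A" using notin_ball_nbr[OF u] that by auto
    have "(w, v s) \<in> G \<longleftrightarrow> (w, v s) \<in> G'" by (rule differ_at_ball[OF assms disjI2[OF s]])
    moreover have "chain G k w s = chain G' k w s" if "(w, v s) \<in> G"
      by (rule Suc.IH, rule notin_ball_nbr[OF s]) (use that in auto)
    ultimately show ?thesis by blast
  qed
  then show ?case using G by auto
qed simp

lemma local_at_time:
  assumes "differ_at G G' A" "v t \<notin> nball (G \<union> G') (2 * k + 2) A"
  shows "av_unm G k t = av_unm G' k t" "chain_from G k t = chain_from G' k t"
proof -
  let ?H = "G \<union> G'"
  have t: "v t \<notin> nball ?H (Suc (2 * k + 1)) A" using assms(2) by simp
  have G: "(u, v t) \<in> G \<longleftrightarrow> (u, v t) \<in> G'" for u by (rule differ_at_ball[OF assms(1) disjI2[OF t]])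
  have u: "u \<notin> nball ?H (2 * k + 1) A" if "(u, v t) \<in> G" for u
    using notin_ball_nbr[OF t] that by blast
  show "av_unm G k t = av_unm G' k t"
    using G u av_local[OF assms(1)] unfolding av_unm_def by blast
  show "chain_from G k t = chain_from G' k t"
    using G u chain_local[OF assms(1)] unfolding chain_from_def by blast
qed

definition tally :: "(nat \<Rightarrow> bool) \<Rightarrow> nat \<Rightarrow> real" where
  "tally P T = (\<Sum>t<T. of_bool (P t))"

lemma tally_eq_card: "tally P T = real (card {t. t < T \<and> P t})"
proof -
  have "{..<T} \<inter> Collect P = {t. t < T \<and> P t}" by auto
  then show ?thesis by (simp add: tally_def of_bool_def sum.If_cases)
qed

lemma U_eq_tally: "real (U G T) = tally (unm G) T"
  by (simp add: tally_eq_card U_def)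

text \<open>Two sources of disagreement are separated: times with \<open>R\<close>, which will be
  times where a chain starts, and times whose vertex lies in \<open>B\<close>, a ball. Since
  \<open>v\<close> is injective, the latter are at most \<open>card B\<close> many.\<close>

lemma tally_diff_le:
  assumes "T \<le> n" "finite B" "\<And>t. t < T \<Longrightarrow> P t \<noteq> Q t \<Longrightarrow> R t \<or> v t \<in> B"
  shows "\<bar>tally P T - tally Q T\<bar> \<le> tally R T + real (card B)"
proof -
  have "\<bar>tally P T - tally Q T\<bar> \<le> (\<Sum>t<T. \<bar>of_bool (P t) - of_bool (Q t)\<bar>)"
    unfolding tally_def sum_subtractf[symmetric] by (rule sum_abs)
  also have "\<dots> \<le> (\<Sum>t<T. of_bool (R t) + of_bool (v t \<in> B))"
    using assms(3) by (intro sum_mono) (auto simp: of_bool_def)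
  also have "\<dots> = tally R T + real (card {t. t < T \<and> v t \<in> B})"
    by (simp add: sum.distrib tally_eq_card flip: tally_def)
  also have "card {t. t < T \<and> v t \<in> B} \<le> card B"
    by (rule card_inj_on_le[of v]) (use assms v_eq_iff in \<open>auto simp: inj_on_def\<close>)
  finally show ?thesis by simp
qed

lemma tally_mono: "(\<And>t. t < T \<Longrightarrow> P t \<Longrightarrow> Q t) \<Longrightarrow> tally P T \<le> tally Q T"
  unfolding tally_def by (intro sum_mono) auto

lemma chain_mono: "G \<subseteq> G' \<Longrightarrow> chain G k u t \<Longrightarrow> chain G' k u t"
  by (induction k arbitrary: u t) (auto, blast)

lemma chain_from_mono: "G \<subseteq> G' \<Longrightarrow> chain_from G k t \<Longrightarrow> chain_from G' k t"
  using chain_mono by (auto simp: chain_from_def)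

end

section \<open>Networks given by bits and truncation of large degrees\<close>

text \<open>The bound of \<open>card_ball_le\<close> for radius \<open>2 * k + 2\<close> around two
  vertices, in a union of two networks of degree at most \<open>D\<close> each.\<close>

definition flip_const :: "nat \<Rightarrow> nat \<Rightarrow> real" where
  "flip_const D k = 2 * (2 * real D + 2) ^ (2 * k + 2)"

text \<open>The growth factor of a ball of radius \<open>2 * k + 2\<close>, with one more factor
  \<open>D + 2\<close> that turns the degrees of its centres into surpluses over
  \<open>D\<close>.\<close>

definition ball_const :: "nat \<Rightarrow> nat \<Rightarrow> real" where
  "ball_const D k = (real D + 2) ^ (2 * k + 3)"

text \<open>The assumption leaves open whether \<open>bit (i, j)\<close> and
  \<open>bit (j, i)\<close> coincide: they do for undirected edges and do not for directed ones. All
  other pairs have different bits.\<close>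

locale bits = run n v ch for n v ch +
  fixes bit :: "nat \<times> nat \<Rightarrow> 'e"
  assumes bit_inj: "\<And>i j k l. {i, j, k, l} \<subseteq> V n \<Longrightarrow> bit (i, j) = bit (k, l) \<Longrightarrow> {i, j} = {k, l}"
begin

definition EE :: "'e set" where
  "EE = bit ` (V n \<times> V n)"

definition net :: "('e \<Rightarrow> bool) \<Rightarrow> network" where
  "net x = {(i, j). i \<in> V n \<and> j \<in> V n \<and> x (bit (i, j))}"

definition inc :: "nat \<Rightarrow> 'e \<Rightarrow> bool" where
  "inc w e \<longleftrightarrow> (\<exists>a\<in>V n. e = bit (a, w) \<or> e = bit (w, a))"

definition deg :: "('e \<Rightarrow> bool) \<Rightarrow> nat \<Rightarrow> nat" where
  "deg x w = card {e \<in> EE. x e \<and> inc w e}"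

text \<open>All arcs at a vertex of large degree are deleted, not just the surplus ones. This
  requires no choice, and the result reacts to a change of one bit only at arcs that touch one of
  its two ends.\<close>

definition trunc :: "nat \<Rightarrow> ('e \<Rightarrow> bool) \<Rightarrow> network" where
  "trunc D x = {(i, j) \<in> net x. deg x i \<le> D \<and> deg x j \<le> D}"

definition excess :: "nat \<Rightarrow> ('e \<Rightarrow> bool) \<Rightarrow> real" where
  "excess D x = (\<Sum>w\<in>V n. real (deg x w - D))"

lemma finite_EE [simp]: "finite EE"
  by (simp add: EE_def)

lemma card_EE: "card EE \<le> n\<^sup>2"
proof -
  have "card EE \<le> card (V n \<times> V n)" unfolding EE_def by (rule card_image_le) simp
  then show ?thesis by (simp add: card_cartesian_product power2_eq_square)
qed

lemma bit_in_EE: "i \<in> V n \<Longrightarrow> j \<in> V n \<Longrightarrow> bit (i, j) \<in> EE"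
  by (auto simp: EE_def)

lemma net_subset: "net x \<subseteq> V n \<times> V n"
  by (auto simp: net_def)

lemma trunc_subset: "trunc D x \<subseteq> net x"
  by (auto simp: trunc_def)

lemma inc_bit: "{i, j, w} \<subseteq> V n \<Longrightarrow> inc w (bit (i, j)) \<longleftrightarrow> w = i \<or> w = j"
proof
  assume V: "{i, j, w} \<subseteq> V n" and "inc w (bit (i, j))"
  then obtain a where "a \<in> V n" "bit (i, j) = bit (a, w) \<or> bit (i, j) = bit (w, a)"
    by (auto simp: inc_def)
  then have "{i, j} = {a, w}"
    using bit_inj[of i j a w] bit_inj[of i j w a] V by (auto simp: insert_commute)
  then show "w = i \<or> w = j" by auto
next
  assume "{i, j, w} \<subseteq> V n" "w = i \<or> w = j"
  then show "inc w (bit (i, j))" by (auto simp: inc_def)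
qed

lemma nbrs_net_subset: "nbrs (net x) w \<subseteq> V n"
  by (auto simp: nbrs_def net_def)

lemma finite_nbrs: "H \<subseteq> V n \<times> V n \<Longrightarrow> finite (nbrs H w)"
  by (rule finite_subset[of _ "V n"]) (auto simp: nbrs_def)

text \<open>\<open>deg\<close> counts bits, so a neighbour joined in both directions by different
  bits counts twice.\<close>

lemma card_nbrs_net: "card (nbrs (net x) w) \<le> deg x w"
proof (cases "w \<in> V n")
  case False
  then have "nbrs (net x) w = {}" by (auto simp: nbrs_def net_def)
  then show ?thesis by simp
next
  case True
  define f where "f = (\<lambda>b. if (w, b) \<in> net x then bit (w, b) else bit (b, w))"
  show ?thesis unfolding deg_def
  proof (rule card_inj_on_le[of f])
    show "inj_on f (nbrs (net x) w)"
    proof (rule inj_onI)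
      fix b c assume b: "b \<in> nbrs (net x) w" and c: "c \<in> nbrs (net x) w" and "f b = f c"
      have V: "b \<in> V n" "c \<in> V n" using b c nbrs_net_subset by auto
      have "{w, b} = {w, c}"
        using bit_inj[of w b w c] bit_inj[of w b c w] bit_inj[of b w w c] bit_inj[of b w c w] V True
          \<open>f b = f c\<close> by (auto simp: f_def insert_commute split: if_splits)
      then show "b = c" by (auto simp: doubleton_eq_iff)
    qed
    show "f ` nbrs (net x) w \<subseteq> {e \<in> EE. x e \<and> inc w e}"
      using True by (auto simp: f_def nbrs_def net_def bit_in_EE inc_def)
  qed simp
qed

lemma card_nbrs_trunc: "card (nbrs (trunc D x) w) \<le> D"
proof (cases "deg x w \<le> D")
  case True
  have "card (nbrs (trunc D x) w) \<le> card (nbrs (net x) w)"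
    by (rule card_mono[OF finite_nbrs[OF net_subset]]) (auto simp: nbrs_def trunc_def)
  then show ?thesis using card_nbrs_net[of x w] True by simp
next
  case False
  then have "nbrs (trunc D x) w = {}" by (auto simp: nbrs_def trunc_def)
  then show ?thesis by simp
qed

lemma deg_upd:
  assumes "\<not> inc w e"
  shows "deg (x(e := b)) w = deg x w"
proof -
  have "{e' \<in> EE. (x(e := b)) e' \<and> inc w e'} = {e \<in> EE. x e \<and> inc w e}" using assms by auto
  then show ?thesis by (simp add: deg_def)
qed

text \<open>Flipping a bit changes the degrees of its two ends only. The truncated networks thus
  differ at those ends, and by locality only the vertices in a ball around them can notice. The
  bound is deterministic, as the concentration inequality requires.\<close>

lemma trunc_flip:
  assumes T: "T \<le> n" and e: "e \<in> EE"
  shows "\<bar>tally (av_unm (trunc D (x(e := True))) k) T - tally (av_unm (trunc D (x(e := False))) k) T\<bar>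
           \<le> flip_const D k"
    and "\<bar>tally (chain_from (trunc D (x(e := True))) k) T - tally (chain_from (trunc D (x(e := False))) k) T\<bar>
           \<le> flip_const D k"
proof -
  obtain a b where ab: "a \<in> V n" "b \<in> V n" "e = bit (a, b)" using e by (auto simp: EE_def)
  let ?G = "trunc D (x(e := True))" and ?G' = "trunc D (x(e := False))" and ?A = "{a, b}"
  let ?H = "?G \<union> ?G'"
  have d: "differ_at ?G ?G' ?A"
    unfolding differ_at_def
  proof (intro allI impI, rule ccontr)
    fix i j assume ij: "((i, j) \<in> ?G) \<noteq> ((i, j) \<in> ?G')" and n: "\<not> (i \<in> ?A \<or> j \<in> ?A)"
    then have V: "i \<in> V n" "j \<in> V n" by (auto simp: trunc_def net_def)
    have i: "\<not> inc i e" and j: "\<not> inc j e" using n V ab by (auto simp: inc_bit)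
    have "bit (i, j) \<noteq> e" using i V by (auto simp: inc_def)
    then show False using ij by (simp add: trunc_def net_def deg_upd[OF i] deg_upd[OF j])
  qed
  have H: "?H \<subseteq> V n \<times> V n" using trunc_subset net_subset by blast
  have D: "card (nbrs ?H w) \<le> 2 * D" for w
  proof -
    have "nbrs ?H w = nbrs ?G w \<union> nbrs ?G' w" by (auto simp: nbrs_def)
    then have "card (nbrs ?H w) \<le> card (nbrs ?G w) + card (nbrs ?G' w)" by (simp add: card_Un_le)
    then show ?thesis using card_nbrs_trunc[of D "x(e := True)" w] card_nbrs_trunc[of D "x(e := False)" w]
      by linarith
  qed
  let ?B = "nball ?H (2 * k + 2) ?A"
  have "finite ?B \<and> card ?B \<le> (2 * D + 2) ^ (2 * k + 2) * (card ?A + (\<Sum>w\<in>{}. card (nbrs ?H w)))"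
    by (rule card_ball_le) (use D H finite_nbrs in auto)
  moreover have "card ?A \<le> 2" by (simp add: card_insert_if)
  then have "(2 * D + 2) ^ (2 * k + 2) * card ?A \<le> (2 * D + 2) ^ (2 * k + 2) * 2"
    by (rule mult_left_mono) simp
  ultimately have B: "finite ?B" "card ?B \<le> (2 * D + 2) ^ (2 * k + 2) * 2" by auto
  have "real (card ?B) \<le> real ((2 * D + 2) ^ (2 * k + 2) * 2)" using B(2) by (rule of_nat_mono)
  then have B': "real (card ?B) \<le> flip_const D k" by (simp add: flip_const_def algebra_simps)
  have 0: "tally (\<lambda>_. False) T = 0" by (simp add: tally_def)
  have "\<bar>tally (av_unm ?G k) T - tally (av_unm ?G' k) T\<bar> \<le> tally (\<lambda>_. False) T + real (card ?B)"
    by (rule tally_diff_le[OF T B(1)]) (use local_at_time(1)[OF d] in blast)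
  then show "\<bar>tally (av_unm ?G k) T - tally (av_unm ?G' k) T\<bar> \<le> flip_const D k" using B' 0 by linarith
  have "\<bar>tally (chain_from ?G k) T - tally (chain_from ?G' k) T\<bar> \<le> tally (\<lambda>_. False) T + real (card ?B)"
    by (rule tally_diff_le[OF T B(1)]) (use local_at_time(2)[OF d] in blast)
  then show "\<bar>tally (chain_from ?G k) T - tally (chain_from ?G' k) T\<bar> \<le> flip_const D k" using B' 0 by linarith
qed

lemma excess_flip:
  assumes e: "e \<in> EE"
  shows "\<bar>excess D (x(e := True)) - excess D (x(e := False))\<bar> \<le> 2"
proof -
  obtain a b where ab: "a \<in> V n" "b \<in> V n" "e = bit (a, b)" using e by (auto simp: EE_def)
  have one: "\<bar>real (deg (x(e := True)) w - D) - real (deg (x(e := False)) w - D)\<bar> \<le> of_bool (w \<in> {a, b})"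
    if "w \<in> V n" for w
  proof (cases "w \<in> {a, b}")
    case False
    then have "\<not> inc w e" using ab that by (auto simp: inc_bit)
    then show ?thesis using False by (simp add: deg_upd)
  next
    case True
    have "{e' \<in> EE. (x(e := False)) e' \<and> inc w e'} \<subseteq> {e' \<in> EE. (x(e := True)) e' \<and> inc w e'}"
      "{e' \<in> EE. (x(e := True)) e' \<and> inc w e'} \<subseteq> insert e {e' \<in> EE. (x(e := False)) e' \<and> inc w e'}"
      by auto
    from card_mono[OF _ this(1)] card_mono[OF _ this(2)]
    have "deg (x(e := False)) w \<le> deg (x(e := True)) w" "deg (x(e := True)) w \<le> deg (x(e := False)) w + 1"
      by (auto simp: deg_def card_insert_if split: if_splits)
    then show ?thesis using True by (simp add: of_bool_def)
  qed
  have "\<bar>excess D (x(e := True)) - excess D (x(e := False))\<bar>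
      \<le> (\<Sum>w\<in>V n. \<bar>real (deg (x(e := True)) w - D) - real (deg (x(e := False)) w - D)\<bar>)"
    by (simp add: excess_def sum_subtractf[symmetric])
  also have "\<dots> \<le> (\<Sum>w\<in>V n. of_bool (w \<in> {a, b}))" by (intro sum_mono one)
  also have "\<dots> = real (card (V n \<inter> {a, b}))"
    by (simp add: of_bool_def sum.If_cases Int_def)
  also have "\<dots> \<le> real (card {a, b})" by (intro of_nat_mono card_mono) auto
  also have "\<dots> \<le> 2" by (simp add: card_insert_if)
  finally show ?thesis .
qed

text \<open>Full and truncated network differ only at the vertices of degree above \<open>D\<close>.
  The ball around these vertices is bounded through their degrees.\<close>

lemma trunc_error:
  assumes T: "T \<le> n"
  shows "\<bar>tally (av_unm (net x) k) T - tally (av_unm (trunc D x) k) T\<bar> \<le> ball_const D k * excess D x"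
    and "\<bar>tally (chain_from (net x) k) T - tally (chain_from (trunc D x) k) T\<bar> \<le> ball_const D k * excess D x"
proof -
  define W where "W = {w \<in> V n. D < deg x w}"
  have fW: "finite W" by (simp add: W_def)
  have un: "net x \<union> trunc D x = net x" using trunc_subset by blast
  have d: "differ_at (net x) (trunc D x) W"
    by (auto simp: differ_at_def trunc_def W_def net_def)
  let ?B = "nball (net x) (2 * k + 2) W"
  have B: "finite ?B \<and> card ?B \<le> (D + 2) ^ (2 * k + 2) * (card W + (\<Sum>w\<in>W. card (nbrs (net x) w)))"
  proof (rule card_ball_le[OF fW finite_nbrs[OF net_subset] _ fW])
    fix a assume "a \<notin> W"
    then have "deg x a \<le> D \<or> a \<notin> V n" by (auto simp: W_def)
    moreover have "a \<notin> V n \<Longrightarrow> nbrs (net x) a = {}" by (auto simp: nbrs_def net_def)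
    ultimately show "card (nbrs (net x) a) \<le> D" using card_nbrs_net[of x a] by force
  qed
  have "card W + (\<Sum>w\<in>W. card (nbrs (net x) w)) = (\<Sum>w\<in>W. 1 + card (nbrs (net x) w))"
    by (simp only: sum.distrib card_eq_sum)
  \<comment> \<open>For a degree \<open>D + 1 + j\<close> this reads \<open>D + 2 + j\<close> \<le>
    \<open>(D + 2) * (j + 1)\<close>.\<close>
  also have "\<dots> \<le> (\<Sum>w\<in>W. (D + 2) * (deg x w - D))"
  proof (rule sum_mono)
    fix w assume "w \<in> W"
    then obtain j where j: "deg x w = D + Suc j" by (auto simp: W_def less_iff_Suc_add)
    show "1 + card (nbrs (net x) w) \<le> (D + 2) * (deg x w - D)"
      using card_nbrs_net[of x w] j by (simp add: algebra_simps)
  qed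
  also have "\<dots> \<le> (\<Sum>w\<in>V n. (D + 2) * (deg x w - D))"
    by (rule sum_mono2) (auto simp: W_def)
  finally have "(D + 2) ^ (2 * k + 2) * (card W + (\<Sum>w\<in>W. card (nbrs (net x) w)))
      \<le> (D + 2) ^ (2 * k + 2) * (\<Sum>w\<in>V n. (D + 2) * (deg x w - D))" by (rule mult_left_mono) simp
  also have "\<dots> = (D + 2) ^ (2 * k + 3) * (\<Sum>w\<in>V n. deg x w - D)"
  proof -
    have e: "2 * k + 3 = Suc (2 * k + 2)" by simp
    show ?thesis unfolding e power_Suc2 sum_distrib_left[symmetric] by (simp only: mult.assoc)
  qed
  finally have "card ?B \<le> (D + 2) ^ (2 * k + 3) * (\<Sum>w\<in>V n. deg x w - D)" using B by simp
  then have "real (card ?B) \<le> real ((D + 2) ^ (2 * k + 3) * (\<Sum>w\<in>V n. deg x w - D))"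
    by (rule of_nat_mono)
  then have B': "real (card ?B) \<le> ball_const D k * excess D x"
    by (simp add: ball_const_def excess_def add.commute)
  have 0: "tally (\<lambda>_. False) T = 0" by (simp add: tally_def)
  have "\<bar>tally (av_unm (net x) k) T - tally (av_unm (trunc D x) k) T\<bar> \<le> tally (\<lambda>_. False) T + real (card ?B)"
    by (rule tally_diff_le[OF T conjunct1[OF B]]) (use local_at_time(1)[OF d, unfolded un] in blast)
  then show "\<bar>tally (av_unm (net x) k) T - tally (av_unm (trunc D x) k) T\<bar> \<le> ball_const D k * excess D x"
    using B' 0 by linarith
  have "\<bar>tally (chain_from (net x) k) T - tally (chain_from (trunc D x) k) T\<bar> \<le> tally (\<lambda>_. False) T + real (card ?B)"
    by (rule tally_diff_le[OF T conjunct1[OF B]]) (use local_at_time(2)[OF d, unfolded un] in blast)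
  then show "\<bar>tally (chain_from (net x) k) T - tally (chain_from (trunc D x) k) T\<bar> \<le> ball_const D k * excess D x"
    using B' 0 by linarith
qed

text \<open>Bounds the combined error of stopping the recursion at depth \<open>k\<close> and of
  truncating degrees at \<open>D\<close>. Chains are counted in the full network, which makes the
  bound increasing in \<open>x\<close>.\<close>

definition err :: "nat \<Rightarrow> nat \<Rightarrow> ('e \<Rightarrow> bool) \<Rightarrow> real" where
  "err D k x = tally (chain_from (net x) k) n + ball_const D k * excess D x"

lemma U_approx:
  assumes T: "T \<le> n"
  shows "\<bar>real (U (net x) T) - tally (av_unm (trunc D x) k) T\<bar> \<le> err D k x"
proof -
  have "\<bar>tally (unm (net x)) T - tally (av_unm (net x) k) T\<bar> \<le> tally (chain_from (net x) k) T + real (card ({} :: nat set))"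
    by (rule tally_diff_le[OF T]) (use av_unm_unm in auto)
  moreover have "tally (chain_from (net x) k) T \<le> tally (chain_from (net x) k) n"
    unfolding tally_def by (rule sum_mono2) (use T in auto)
  ultimately show ?thesis using trunc_error(1)[OF T, of x k D] by (simp add: err_def U_eq_tally)
qed

text \<open>The number of chains in the full network has no good Lipschitz constant. It is replaced
  by the number in the truncated network, at the price of doubling the second term.\<close>

lemma err_le:
  "err D k x \<le> tally (chain_from (trunc D x) k) n + 2 * ball_const D k * excess D x"
  using trunc_error(2)[OF order_refl, of x k D] by (simp add: err_def)

text \<open>Additional bits create chains and raise degrees. Hence the error after deleting bits is
  bounded by the error before, so deletions need no estimate of their own.\<close>

lemma err_mono:
  assumes "\<And>e. x e \<Longrightarrow> y e"
  shows "err D k x \<le> err D k y"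
proof -
  have "net x \<subseteq> net y" using assms by (auto simp: net_def)
  then have "tally (chain_from (net x) k) n \<le> tally (chain_from (net y) k) n"
    by - (rule tally_mono, rule chain_from_mono)
  moreover have "deg x w \<le> deg y w" for w unfolding deg_def by (rule card_mono) (use assms in auto)
  then have "excess D x \<le> excess D y" unfolding excess_def
    by (intro sum_mono of_nat_mono diff_le_mono)
  moreover have "0 \<le> ball_const D k" by (simp add: ball_const_def)
  ultimately show ?thesis unfolding err_def by (intro add_mono mult_left_mono)
qed

end

section \<open>Products of Bernoulli distributions\<close>

definition bprod :: "'e set \<Rightarrow> ('e \<Rightarrow> real) \<Rightarrow> ('e \<Rightarrow> bool) pmf" where
  "bprod E pr = Pi_pmf E False (\<lambda>e. bernoulli_pmf (pr e))"

lemma finite_set_bprod: "finite E \<Longrightarrow> finite (set_pmf (bprod E pr))"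
  unfolding bprod_def by (rule finite_subset[OF set_Pi_pmf_subset']) auto

lemma integrable_bprod [simp, intro]:
  "finite E \<Longrightarrow> integrable (measure_pmf (bprod E pr)) (f :: _ \<Rightarrow> real)"
  by (intro integrable_measure_pmf_finite finite_set_bprod)

lemma prob_eq_expectation:
  "measure_pmf.prob M {x. Q x} = measure_pmf.expectation M (\<lambda>x. of_bool (Q x))"
proof -
  have "(\<lambda>x. of_bool (Q x)) = (indicator {x. Q x} :: _ \<Rightarrow> real)"
    by (auto simp: indicator_def)
  then show ?thesis by simp
qed

text \<open>Redrawing one coordinate keeps the index set, so several bits can be conditioned on in
  turn within the same measure.\<close>

lemma Pi_pmf_resample:
  assumes "finite I" "a \<in> I"
  shows "Pi_pmf I d p = bind_pmf (p a) (\<lambda>y. map_pmf (\<lambda>h. h(a := y)) (Pi_pmf I d p))"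
proof -
  have I: "insert a (I - {a}) = I" using assms by auto
  have *: "Pi_pmf I d p = bind_pmf (p a) (\<lambda>y. map_pmf (\<lambda>h. h(a := y)) (Pi_pmf (I - {a}) d p))"
    by (subst I[symmetric], subst Pi_pmf_insert') (use assms in \<open>auto simp: map_pmf_def\<close>)
  show ?thesis
    by (subst (2) *) (simp add: map_bind_pmf pmf.map_comp o_def bind_return_pmf *)
qed

lemma bprod_resample:
  assumes "finite E" "e \<in> E"
  shows "bprod E pr = bind_pmf (bernoulli_pmf (pr e)) (\<lambda>b. map_pmf (\<lambda>x. x(e := b)) (bprod E pr))"
  unfolding bprod_def by (rule Pi_pmf_resample[OF assms])

lemma expectation_bit_split:
  fixes f :: "('e \<Rightarrow> bool) \<Rightarrow> real"
  assumes "finite E" "e \<in> E" "0 \<le> pr e" "pr e \<le> 1"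
  shows "measure_pmf.expectation (bprod E pr) f =
    pr e * measure_pmf.expectation (bprod E pr) (\<lambda>x. f (x(e := True))) +
    (1 - pr e) * measure_pmf.expectation (bprod E pr) (\<lambda>x. f (x(e := False)))"
proof -
  have "measure_pmf.expectation (bprod E pr) f =
      (\<Sum>b\<in>UNIV. pmf (bernoulli_pmf (pr e)) b *\<^sub>R
        measure_pmf.expectation (map_pmf (\<lambda>x. x(e := b)) (bprod E pr)) f)"
    by (subst bprod_resample[OF assms(1,2)], rule pmf_expectation_bind)
       (use assms finite_set_bprod in auto)
  then show ?thesis using assms by (simp add: UNIV_bool)
qed

text \<open>Independence of \<open>Q\<close> from the bit is expressed as invariance under changing
  it, which is the form in which explorations deliver it.\<close>

lemma prob_bit_on:
  assumes "finite E" "e \<in> E" "0 \<le> pr e" "pr e \<le> 1" "\<And>x b. Q (x(e := b)) = Q x"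
  shows "measure_pmf.prob (bprod E pr) {x. x e \<and> Q x} = pr e * measure_pmf.prob (bprod E pr) {x. Q x}"
  unfolding prob_eq_expectation by (subst expectation_bit_split[of E e pr, OF assms(1-4)]) (simp add: assms(5))

lemma prob_bit_off:
  assumes "finite E" "e \<in> E" "0 \<le> pr e" "pr e \<le> 1" "\<And>x b. Q (x(e := b)) = Q x"
  shows "measure_pmf.prob (bprod E pr) {x. \<not> x e \<and> Q x} = (1 - pr e) * measure_pmf.prob (bprod E pr) {x. Q x}"
  unfolding prob_eq_expectation by (subst expectation_bit_split[of E e pr, OF assms(1-4)]) (simp add: assms(5))

lemma prob_bits_off:
  assumes "finite E" "B \<subseteq> E" "\<And>e. e \<in> E \<Longrightarrow> 0 \<le> pr e \<and> pr e \<le> 1"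
    "\<And>x b e. e \<in> B \<Longrightarrow> Q (x(e := b)) = Q x"
  shows "measure_pmf.prob (bprod E pr) {x. (\<forall>e\<in>B. \<not> x e) \<and> Q x} =
    (\<Prod>e\<in>B. 1 - pr e) * measure_pmf.prob (bprod E pr) {x. Q x}"
proof -
  have "finite B" using assms finite_subset by blast
  then show ?thesis using assms(2,4)
  proof (induction B)
    case (insert e B)
    have "{x. (\<forall>e'\<in>insert e B. \<not> x e') \<and> Q x} = {x. \<not> x e \<and> ((\<forall>e'\<in>B. \<not> x e') \<and> Q x)}" by auto
    also have "measure_pmf.prob (bprod E pr) \<dots> =
        (1 - pr e) * measure_pmf.prob (bprod E pr) {x. (\<forall>e'\<in>B. \<not> x e') \<and> Q x}"
    proof (rule prob_bit_off)
      fix x b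
      have "Q (x(e := b)) = Q x" by (rule insert.prems) simp
      then show "((\<forall>e'\<in>B. \<not> (x(e := b)) e') \<and> Q (x(e := b))) = ((\<forall>e'\<in>B. \<not> x e') \<and> Q x)"
        using insert.hyps by auto
    qed (use insert.prems assms in auto)
    finally show ?case using insert by simp
  qed simp
qed

lemma prob_bit:
  assumes "finite E" "e \<in> E" "0 \<le> pr e" "pr e \<le> 1"
  shows "measure_pmf.prob (bprod E pr) {x. x e} = pr e"
  using prob_bit_on[of E e pr "\<lambda>_. True", OF assms] by simp

section \<open>Concentration of Lipschitz functions of independent bits\<close>

lemma exp_le_quadratic:
  fixes y :: real
  assumes "\<bar>y\<bar> \<le> 1"
  shows "exp y \<le> 1 + y + y\<^sup>2"
proof (cases "0 \<le> y")
  case True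
  then show ?thesis using exp_bound assms by auto
next
  case False
  define t where "t = - y"
  have t: "0 < t" using False t_def by simp
  \<comment> \<open>The product equals \<open>1 + t ^ 3\<close>.\<close>
  have "1 \<le> (1 - t + t\<^sup>2) * (1 + t)"
    using t by (simp add: algebra_simps power2_eq_square)
  also have "\<dots> \<le> (1 - t + t\<^sup>2) * exp t"
  proof (rule mult_left_mono)
    have "0 \<le> (1 - t / 2)\<^sup>2 + 3 / 4 * t\<^sup>2" by simp
    also have "\<dots> = 1 - t + t\<^sup>2" by (simp add: power2_eq_square algebra_simps)
    finally show "0 \<le> 1 - t + t\<^sup>2" .
  qed (simp add: add.commute)
  finally have "exp (- t) \<le> 1 - t + t\<^sup>2" by (simp add: exp_minus field_simps)
  then show ?thesis by (simp add: t_def)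
qed

text \<open>\<open>a\<close> and \<open>b\<close> are the two values of a centred Bernoulli variable
  scaled by \<open>d\<close>. The exponent keeps the factor \<open>p\<close>, as the variance
  does.\<close>

lemma two_point_mgf:
  fixes p d a b :: real
  assumes p: "0 \<le> p" "p \<le> 1" and d: "\<bar>d\<bar> \<le> 1" and a: "a = (1 - p) * d" and b: "b = - (p * d)"
  shows "p * exp a + (1 - p) * exp b \<le> exp (p * d\<^sup>2)"
proof -
  have "\<bar>a\<bar> \<le> 1 * 1" unfolding a abs_mult by (rule mult_mono) (use p d in auto)
  moreover have "\<bar>b\<bar> \<le> 1 * 1" unfolding b abs_minus_cancel abs_mult by (rule mult_mono) (use p d in auto)
  ultimately have "p * exp a + (1 - p) * exp b \<le> p * (1 + a + a\<^sup>2) + (1 - p) * (1 + b + b\<^sup>2)"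
    using p by (intro add_mono mult_left_mono exp_le_quadratic) auto
  also have "\<dots> = 1 + p * d\<^sup>2 * (1 - p)" unfolding a b by algebra
  also have "\<dots> \<le> 1 + p * d\<^sup>2"
    using p mult_left_mono[of "1 - p" 1 "p * d\<^sup>2"] by simp
  also have "\<dots> \<le> exp (p * d\<^sup>2)" by simp
  finally show ?thesis .
qed

text \<open>A bounded differences inequality weighted by the variances of the bits. There may be
  about \<open>n ^ 2\<close> bits, so an exponent proportional to their number would be useless,
  whereas the sum of their probabilities is of order \<open>n\<close>. The proof conditions on one
  bit at a time; the two conditional means differ by at most \<open>c\<close>.\<close>

lemma bprod_mgf:
  fixes f :: "('e \<Rightarrow> bool) \<Rightarrow> real"
  assumes "finite E" "\<And>e. e \<in> E \<Longrightarrow> 0 \<le> pr e \<and> pr e \<le> 1" "\<bar>\<theta>\<bar> * c \<le> 1" "0 \<le> c"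
    "\<And>x e. e \<in> E \<Longrightarrow> \<bar>f (x(e := True)) - f (x(e := False))\<bar> \<le> c"
  shows "measure_pmf.expectation (bprod E pr)
      (\<lambda>x. exp (\<theta> * (f x - measure_pmf.expectation (bprod E pr) f))) \<le> exp (\<theta>\<^sup>2 * c\<^sup>2 * (\<Sum>e\<in>E. pr e))"
  using assms(1,2,5)
proof (induction E arbitrary: f)
  case empty
  then show ?case by (simp add: bprod_def)
next
  case (insert e E)
  let ?M = "bprod (insert e E) pr" and ?M' = "bprod E pr" and ?s = "\<Sum>e\<in>E. pr e"
  have pe: "0 \<le> pr e" "pr e \<le> 1" using insert.prems by auto
  have M: "?M = bind_pmf (bernoulli_pmf (pr e)) (\<lambda>b. map_pmf (\<lambda>x. x(e := b)) ?M')"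
    unfolding bprod_def using insert.hyps by (subst Pi_pmf_insert') (auto simp: map_pmf_def)
  have split: "measure_pmf.expectation ?M g = pr e * measure_pmf.expectation ?M' (\<lambda>x. g (x(e := True))) +
      (1 - pr e) * measure_pmf.expectation ?M' (\<lambda>x. g (x(e := False)))" for g :: "_ \<Rightarrow> real"
  proof -
    have "measure_pmf.expectation ?M g = (\<Sum>b\<in>UNIV. pmf (bernoulli_pmf (pr e)) b *\<^sub>R
        measure_pmf.expectation (map_pmf (\<lambda>x. x(e := b)) ?M') g)"
      by (subst M, rule pmf_expectation_bind) (simp_all add: finite_set_bprod insert.hyps)
    then show ?thesis using pe by (simp add: UNIV_bool)
  qed
  define f1 where "f1 = (\<lambda>x. f (x(e := True)))"
  define f0 where "f0 = (\<lambda>x. f (x(e := False)))"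
  define m1 where "m1 = measure_pmf.expectation ?M' f1"
  define m0 where "m0 = measure_pmf.expectation ?M' f0"
  define m where "m = measure_pmf.expectation ?M f"
  define d where "d = m1 - m0"
  have m: "m = pr e * m1 + (1 - pr e) * m0" unfolding m_def m1_def m0_def f1_def f0_def by (rule split)
  have "d = measure_pmf.expectation ?M' (\<lambda>x. f1 x - f0 x)"
    unfolding d_def m1_def m0_def using insert.hyps by (subst Bochner_Integration.integral_diff) auto
  also have "\<bar>\<dots>\<bar> \<le> measure_pmf.expectation ?M' (\<lambda>x. \<bar>f1 x - f0 x\<bar>)"
    by (rule integral_abs_bound)
  also have "\<dots> \<le> measure_pmf.expectation ?M' (\<lambda>x. c)"
    unfolding f1_def f0_def by (intro integral_mono insert.prems(2)) (use insert.hyps in auto)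
  finally have d: "\<bar>d\<bar> \<le> c" by simp
  have IH1: "measure_pmf.expectation ?M' (\<lambda>x. exp (\<theta> * (f1 x - m1))) \<le> exp (\<theta>\<^sup>2 * c\<^sup>2 * ?s)"
    unfolding m1_def
  proof (rule insert.IH)
    fix x e' assume "e' \<in> E"
    then have ne: "e' \<noteq> e" and e': "e' \<in> insert e E" using insert.hyps by auto
    show "\<bar>f1 (x(e' := True)) - f1 (x(e' := False))\<bar> \<le> c"
      unfolding f1_def fun_upd_twist[OF ne] by (rule insert.prems(2)[OF e'])
  qed (use insert.prems in auto)
  have IH0: "measure_pmf.expectation ?M' (\<lambda>x. exp (\<theta> * (f0 x - m0))) \<le> exp (\<theta>\<^sup>2 * c\<^sup>2 * ?s)"
    unfolding m0_def
  proof (rule insert.IH)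
    fix x e' assume "e' \<in> E"
    then have ne: "e' \<noteq> e" and e': "e' \<in> insert e E" using insert.hyps by auto
    show "\<bar>f0 (x(e' := True)) - f0 (x(e' := False))\<bar> \<le> c"
      unfolding f0_def fun_upd_twist[OF ne] by (rule insert.prems(2)[OF e'])
  qed (use insert.prems in auto)
  have s1: "exp (\<theta> * (f1 x - m)) = exp ((1 - pr e) * (\<theta> * d)) * exp (\<theta> * (f1 x - m1))" for x
    unfolding m d_def exp_add[symmetric] by (rule arg_cong[where f = exp]) algebra
  have s0: "exp (\<theta> * (f0 x - m)) = exp (- (pr e * (\<theta> * d))) * exp (\<theta> * (f0 x - m0))" for x
    unfolding m d_def exp_add[symmetric] by (rule arg_cong[where f = exp]) algebra
  have "measure_pmf.expectation ?M (\<lambda>x. exp (\<theta> * (f x - m))) =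
      pr e * measure_pmf.expectation ?M' (\<lambda>x. exp (\<theta> * (f1 x - m))) +
      (1 - pr e) * measure_pmf.expectation ?M' (\<lambda>x. exp (\<theta> * (f0 x - m)))"
    unfolding f1_def f0_def by (rule split)
  also have "\<dots> = pr e * exp ((1 - pr e) * (\<theta> * d)) * measure_pmf.expectation ?M' (\<lambda>x. exp (\<theta> * (f1 x - m1))) +
      (1 - pr e) * exp (- (pr e * (\<theta> * d))) * measure_pmf.expectation ?M' (\<lambda>x. exp (\<theta> * (f0 x - m0)))"
    unfolding s1 s0 by simp
  also have "\<dots> \<le> pr e * exp ((1 - pr e) * (\<theta> * d)) * exp (\<theta>\<^sup>2 * c\<^sup>2 * ?s) +
      (1 - pr e) * exp (- (pr e * (\<theta> * d))) * exp (\<theta>\<^sup>2 * c\<^sup>2 * ?s)"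
    using pe by (intro add_mono mult_left_mono IH1 IH0) auto
  also have "\<dots> = (pr e * exp ((1 - pr e) * (\<theta> * d)) + (1 - pr e) * exp (- (pr e * (\<theta> * d)))) *
      exp (\<theta>\<^sup>2 * c\<^sup>2 * ?s)" by (simp add: algebra_simps)
  also have "\<dots> \<le> exp (pr e * (\<theta> * d)\<^sup>2) * exp (\<theta>\<^sup>2 * c\<^sup>2 * ?s)"
  proof (rule mult_right_mono[OF two_point_mgf[OF pe _ refl refl]])
    have "\<bar>\<theta> * d\<bar> \<le> \<bar>\<theta>\<bar> * c" using d by (simp add: abs_mult mult_left_mono)
    then show "\<bar>\<theta> * d\<bar> \<le> 1" using assms(3) by simp
  qed simp
  also have "\<dots> \<le> exp (pr e * (\<theta>\<^sup>2 * c\<^sup>2)) * exp (\<theta>\<^sup>2 * c\<^sup>2 * ?s)"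
  proof (rule mult_right_mono)
    have "d\<^sup>2 \<le> c\<^sup>2" using d assms(4) by (metis abs_le_square_iff abs_of_nonneg)
    then show "exp (pr e * (\<theta> * d)\<^sup>2) \<le> exp (pr e * (\<theta>\<^sup>2 * c\<^sup>2))"
      using pe by (simp add: power_mult_distrib mult_left_mono)
  qed simp
  also have "\<dots> = exp (\<theta>\<^sup>2 * c\<^sup>2 * (\<Sum>e\<in>insert e E. pr e))"
    using insert.hyps by (simp add: exp_add[symmetric] algebra_simps)
  finally show ?case by (simp add: m_def)
qed

locale lipschitz_bits =
  fixes E :: "'e set" and pr :: "'e \<Rightarrow> real" and f :: "('e \<Rightarrow> bool) \<Rightarrow> real" and c s :: real
  assumes fin: "finite E" and pr: "\<And>e. e \<in> E \<Longrightarrow> 0 \<le> pr e \<and> pr e \<le> 1"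
    and c: "0 \<le> c" and s: "(\<Sum>e\<in>E. pr e) \<le> s"
    and lip: "\<And>x e. e \<in> E \<Longrightarrow> \<bar>f (x(e := True)) - f (x(e := False))\<bar> \<le> c"
begin

abbreviation "M \<equiv> bprod E pr"
abbreviation "m \<equiv> measure_pmf.expectation (bprod E pr) f"

lemma mgf:
  assumes "\<bar>\<theta>\<bar> * c \<le> 1"
  shows "measure_pmf.expectation M (\<lambda>x. exp (\<theta> * (f x - m))) \<le> exp (\<theta>\<^sup>2 * c\<^sup>2 * s)"
proof -
  have "measure_pmf.expectation M (\<lambda>x. exp (\<theta> * (f x - m))) \<le> exp (\<theta>\<^sup>2 * c\<^sup>2 * (\<Sum>e\<in>E. pr e))"
    by (rule bprod_mgf) (use fin pr c lip assms in auto)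
  also have "\<dots> \<le> exp (\<theta>\<^sup>2 * c\<^sup>2 * s)" using s by (simp add: mult_left_mono)
  finally show ?thesis .
qed

lemma upper_tail:
  assumes "0 < \<theta>" "\<theta> * c \<le> 1"
  shows "measure_pmf.prob M {x. f x - m \<ge> a} \<le> exp (\<theta>\<^sup>2 * c\<^sup>2 * s - \<theta> * a)"
proof -
  have "measure_pmf.prob M {x. f x - m \<ge> a} \<le>
      measure_pmf.expectation M (\<lambda>x. exp (- \<theta> * a) * exp (\<theta> * (f x - m)))"
    unfolding prob_eq_expectation
    using fin assms by (intro integral_mono) (auto simp: of_bool_def mult_exp_exp)
  also have "\<dots> \<le> exp (- \<theta> * a) * exp (\<theta>\<^sup>2 * c\<^sup>2 * s)"
    using mgf[of \<theta>] assms by simp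
  finally show ?thesis by (simp add: mult_exp_exp add.commute)
qed

text \<open>The absolute value is dominated by the exponentials of both signs. With
  \<open>\<theta>\<close> of order \<open>1 / (c * sqrt s)\<close> this gives the order of a
  standard deviation.\<close>

lemma abs_dev:
  assumes "0 < \<theta>" "\<theta> * c \<le> 1"
  shows "measure_pmf.expectation M (\<lambda>x. \<bar>f x - m\<bar>) \<le> 2 / \<theta> * exp (\<theta>\<^sup>2 * c\<^sup>2 * s)"
proof -
  have pt: "\<bar>y\<bar> \<le> (exp (\<theta> * y) + exp (- \<theta> * y)) / \<theta>" for y
  proof -
    have "\<theta> * \<bar>y\<bar> \<le> exp (\<theta> * \<bar>y\<bar>)" using exp_ge_add_one_self[of "\<theta> * \<bar>y\<bar>"] by linarith
    also have "\<dots> \<le> exp (\<theta> * y) + exp (- \<theta> * y)" by (cases "0 \<le> y") auto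
    finally show ?thesis using assms by (simp add: field_simps)
  qed
  have "measure_pmf.expectation M (\<lambda>x. \<bar>f x - m\<bar>) \<le>
      measure_pmf.expectation M (\<lambda>x. (exp (\<theta> * (f x - m)) + exp (- \<theta> * (f x - m))) / \<theta>)"
    using fin by (intro integral_mono pt) auto
  also have "\<dots> = (measure_pmf.expectation M (\<lambda>x. exp (\<theta> * (f x - m))) +
      measure_pmf.expectation M (\<lambda>x. exp (- \<theta> * (f x - m)))) / \<theta>"
    using fin by simp
  also have "\<dots> \<le> (exp (\<theta>\<^sup>2 * c\<^sup>2 * s) + exp ((- \<theta>)\<^sup>2 * c\<^sup>2 * s)) / \<theta>"
    using assms by (intro divide_right_mono add_mono mgf) auto
  finally show ?thesis by simp
qed

end

lemma (in lipschitz_bits) abs_tail: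
  assumes "0 < \<theta>" "\<theta> * c \<le> 1"
  shows "measure_pmf.prob M {x. \<bar>f x - m\<bar> \<ge> a} \<le> 2 * exp (\<theta>\<^sup>2 * c\<^sup>2 * s - \<theta> * a)"
proof -
  interpret neg: lipschitz_bits E pr "\<lambda>x. - f x" c s
    using fin pr c s lip by unfold_locales (auto simp: abs_minus_commute)
  have "{x. \<bar>f x - m\<bar> \<ge> a} = {x. f x - m \<ge> a} \<union> {x. - f x - neg.m \<ge> a}" by auto
  then have "measure_pmf.prob M {x. \<bar>f x - m\<bar> \<ge> a} \<le>
      measure_pmf.prob M {x. f x - m \<ge> a} + measure_pmf.prob M {x. - f x - neg.m \<ge> a}"
    by (simp add: measure_Un_le)
  then show ?thesis using upper_tail[OF assms, of a] neg.upper_tail[OF assms, of a] by simp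
qed

section \<open>Exploration and cavity estimates\<close>

lemma prob_bex_le:
  assumes "finite I"
  shows "measure_pmf.prob M {x. \<exists>i\<in>I. Q i x} \<le> (\<Sum>i\<in>I. measure_pmf.prob M {x. Q i x})"
proof -
  have "{x. \<exists>i\<in>I. Q i x} = (\<Union>i\<in>I. {x. Q i x})" by auto
  then show ?thesis using assms by (simp add: measure_pmf.finite_measure_subadditive_finite)
qed

lemma prob_disj_le:
  "measure_pmf.prob M {x. Q x \<or> R x} \<le> measure_pmf.prob M {x. Q x} + measure_pmf.prob M {x. R x}"
proof -
  have "{x. Q x \<or> R x} = {x. Q x} \<union> {x. R x}" by auto
  then show ?thesis by (simp add: measure_Un_le)
qed

lemma prob_imp_le:
  assumes "\<And>x. Q x \<Longrightarrow> R x"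
  shows "measure_pmf.prob M {x. Q x} \<le> measure_pmf.prob M {x. R x}"
  using assms by (intro measure_pmf.finite_measure_mono) auto

text \<open>The discrete form of integrating a power. Iterated along decreasing times it produces
  the factor \<open>1 / fact k\<close>.\<close>

lemma sum_power_le: "(\<Sum>s<t. real s ^ k) \<le> real t ^ Suc k / real (Suc k)"
proof (induction t)
  case (Suc t)
  have ge: "real t ^ Suc k + real (Suc k) * real t ^ k \<le> (real t + 1) ^ Suc k"
  proof (induction k)
    case (Suc k)
    have "real t ^ Suc (Suc k) + real (Suc (Suc k)) * real t ^ Suc k \<le>
        (real t ^ Suc k + real (Suc k) * real t ^ k) * (real t + 1)"
      by (simp add: algebra_simps)
    also have "\<dots> \<le> (real t + 1) ^ Suc k * (real t + 1)" by (intro mult_right_mono Suc) simp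
    finally show ?case by (simp add: algebra_simps)
  qed simp
  have "(\<Sum>s<Suc t. real s ^ k) \<le> real t ^ Suc k / real (Suc k) + real t ^ k" using Suc by simp
  also have "\<dots> = (real t ^ Suc k + real (Suc k) * real t ^ k) / real (Suc k)"
    by (simp add: field_simps)
  also have "\<dots> \<le> (real t + 1) ^ Suc k / real (Suc k)" by (intro divide_right_mono ge) simp
  finally show ?case by (simp add: add.commute)
qed simp

text \<open>
  \<open>ech k x u t Z\<close>: exploring backwards in time from the left vertex \<open>u\<close>, reached through the right
  vertex \<open>v t\<close>, one either meets the set \<open>Z\<close> of explored vertices again or finds \<open>k\<close> further steps
  among new vertices. Every bit inspected joins a new pair of vertices, so it is independent of
  what has been seen before.
\<close>
context bits
begin

primrec ech :: "nat \<Rightarrow> ('e \<Rightarrow> bool) \<Rightarrow> nat \<Rightarrow> nat \<Rightarrow> nat set \<Rightarrow> bool" where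
  "ech 0 x u t Z \<longleftrightarrow> True"
| "ech (Suc k) x u t Z \<longleftrightarrow> (\<exists>z\<in>Z. z \<noteq> v t \<and> x (bit (u, z))) \<or>
     (\<exists>s\<in>{s. s < t \<and> v s \<notin> Z}.
       (\<exists>w\<in>insert (v s) Z - {u}. x (bit (u, v s)) \<and> x (bit (w, v s))) \<or>
       (\<exists>w\<in>V n - insert (v s) Z. x (bit (u, v s)) \<and> x (bit (w, v s)) \<and>
          ech k x w s (insert w (insert (v s) Z))))"

text \<open>Inside \<open>Z\<close> the exploration only looks at bits between \<open>u\<close> and
  vertices other than \<open>v t\<close>; every other bit it inspects has an end outside
  \<open>Z\<close>. The exempted bit \<open>{u, v t}\<close> is the one through which
  \<open>u\<close> was reached.\<close>

lemma ech_upd: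
  assumes "t < n" "Z \<subseteq> V n" "u \<in> Z" "v t \<in> Z" "a \<in> Z" "b \<in> Z" "u \<notin> {a, b} \<or> {a, b} = {u, v t}"
  shows "ech k (x(bit (a, b) := c)) u t Z = ech k x u t Z"
  using assms
proof (induction k arbitrary: u t Z)
  case (Suc k)
  let ?x = "x(bit (a, b) := c)"
  have bit_ne: "bit (i, j) \<noteq> bit (a, b)" if "i \<in> V n" "j \<in> V n" "{i, j} \<noteq> {a, b}" for i j
    using bit_inj[of i j a b] that Suc.prems by auto
  have 1: "?x (bit (u, z)) = x (bit (u, z))" if "z \<in> Z" "z \<noteq> v t" for z
  proof -
    have "{u, z} \<noteq> {a, b}" using that Suc.prems(7) by (auto simp: doubleton_eq_iff)
    then show ?thesis using bit_ne[of u z] that Suc.prems by auto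
  qed
  have 2: "?x (bit (w, v s)) = x (bit (w, v s))" if "w \<in> V n" "s < t" "v s \<notin> Z" for w s
  proof -
    have "{w, v s} \<noteq> {a, b}" using that Suc.prems by (auto simp: doubleton_eq_iff)
    then show ?thesis using bit_ne[of w "v s"] that Suc.prems v_in[of s] by auto
  qed
  have 3: "ech k ?x w s (insert w (insert (v s) Z)) = ech k x w s (insert w (insert (v s) Z))"
    if "s < t" "v s \<notin> Z" "w \<in> V n - insert (v s) Z" for w s
    by (rule Suc.IH) (use that Suc.prems v_in[of s] in auto)
  have uV: "u \<in> V n" and ZV: "Z \<subseteq> V n" using Suc.prems by auto
  have vs: "v s \<in> V n" if "s < t" for s using that Suc.prems v_in by auto
  show ?case unfolding ech.simps
    by (intro arg_cong2[where f = "(\<or>)"] bex_cong refl)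
       (use 1 2 3 uV ZV vs in \<open>auto simp del: fun_upd_apply\<close>)
qed simp

text \<open>Follow the chain until it first returns to an explored vertex. Its times decrease, so it
  never comes back to \<open>v t\<close> as a right vertex.\<close>

lemma chain_ech:
  assumes "t < n" "u \<in> Z" "v t \<in> Z" "chain (net x) k u t"
  shows "ech k x u t Z"
  using assms
proof (induction k arbitrary: u t Z)
  case (Suc k)
  then obtain s w where s: "s < t" "(u, v s) \<in> net x" "w \<noteq> u" "(w, v s) \<in> net x" "chain (net x) k w s"
    by auto
  have x: "x (bit (u, v s))" "x (bit (w, v s))" "w \<in> V n" using s by (auto simp: net_def)
  have ne: "v s \<noteq> v t" using s Suc.prems v_eq_iff[of s t] by auto
  show ?case
  proof (cases "v s \<in> Z")
    case True
    then show ?thesis using x ne by auto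
  next
    case False
    show ?thesis
    proof (cases "w \<in> insert (v s) Z")
      case True
      then show ?thesis using x s False by auto
    next
      case w: False
      have "ech k x w s (insert w (insert (v s) Z))" by (rule Suc.IH) (use s Suc.prems in auto)
      then show ?thesis using x s False w by auto
    qed
  qed
qed simp

section \<open>Removing the bits at one vertex\<close>

text \<open>The bits of the left copy of \<open>v t\<close> are switched off as well: when the
  orientations share a bit, they are the very bits that decide whether \<open>v t\<close> gets
  matched.\<close>

definition cut :: "nat \<Rightarrow> ('e \<Rightarrow> bool) \<Rightarrow> 'e \<Rightarrow> bool" where
  "cut t x = (\<lambda>e. x e \<and> \<not> inc (v t) e)"

lemma net_cut:
  assumes "t < n"
  shows "(i, j) \<in> net (cut t x) \<longleftrightarrow> (i, j) \<in> net x \<and> i \<noteq> v t \<and> j \<noteq> v t"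
  using inc_bit[of i j "v t"] v_in[OF assms] by (auto simp: net_def cut_def)

text \<open>Before time \<open>t\<close> the two networks differ only in arcs at the left vertex
  \<open>v t\<close>. A disagreement about \<open>u\<close> is inherited from an earlier competitor
  \<open>w\<close>, which either lies in the explored set, as \<open>v t\<close> does, or shows a
  disagreement itself.\<close>

lemma avail_cut:
  assumes "t < n" "s \<le> t" "u \<in> Z" "u \<noteq> v t" "v s \<in> Z" "v t \<in> Z"
    "(u \<in> avail (net x) s) \<noteq> (u \<in> avail (net (cut t x)) s)"
  shows "ech k x u s Z"
  using assms(2-)
proof (induction k arbitrary: u s Z)
  case (Suc k)
  let ?G = "net x" and ?G' = "net (cut t x)"
  have arc: "(w, v r) \<in> ?G' \<longleftrightarrow> (w, v r) \<in> ?G" if "w \<noteq> v t" "r < s" for w r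
    using net_cut[OF assms(1)] that Suc.prems assms(1) v_eq_iff[of r t] by auto
  have "\<exists>r<s. (u, v r) \<in> ?G \<and> {w. (w, v r) \<in> ?G \<and> w \<noteq> u \<and> w \<in> avail ?G r} \<noteq>
      {w. (w, v r) \<in> ?G' \<and> w \<noteq> u \<and> w \<in> avail ?G' r}"
  proof (rule ccontr)
    assume "\<not> ?thesis"
    then have "u \<in> avail ?G s \<longleftrightarrow> u \<in> avail ?G' s"
      using arc[OF \<open>u \<noteq> v t\<close>] by (subst (1 2) avail_iff) auto
    then show False using Suc.prems by blast
  qed
  then obtain r w where r: "r < s" "(u, v r) \<in> ?G" "w \<noteq> u"
    and w: "((w, v r) \<in> ?G \<and> w \<in> avail ?G r) \<noteq> ((w, v r) \<in> ?G' \<and> w \<in> avail ?G' r)" by auto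
  have wG: "(w, v r) \<in> ?G" using w net_cut[OF assms(1)] by auto
  have x: "x (bit (u, v r))" "x (bit (w, v r))" "w \<in> V n" using r wG by (auto simp: net_def)
  have ne: "v r \<noteq> v s" using r Suc.prems assms(1) v_eq_iff[of r s] by auto
  show ?case
  proof (cases "v r \<in> Z")
    case True
    then show ?thesis using x ne by auto
  next
    case False
    show ?thesis
    proof (cases "w \<in> insert (v r) Z")
      case True
      then show ?thesis using x r False by auto
    next
      case wZ: False
      then have wt: "w \<noteq> v t" using Suc.prems by auto
      have "ech k x w r (insert w (insert (v r) Z))"
        by (rule Suc.IH) (use r w wt arc[OF wt] Suc.prems in auto)
      then show ?thesis using x r False wZ by auto
    qed
  qed
qed simp

text \<open>The bad event at time \<open>t\<close>. It covers long chains as well as returns to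
  explored vertices, so a single estimate handles both the error of stopping at depth
  \<open>k\<close> and the effect of removing the bits at \<open>v t\<close>.\<close>

definition expl :: "nat \<Rightarrow> nat \<Rightarrow> ('e \<Rightarrow> bool) \<Rightarrow> bool" where
  "expl k t x \<longleftrightarrow> x (bit (v t, v t)) \<or> (\<exists>w\<in>V n - {v t}. x (bit (w, v t)) \<and> ech k x w t {w, v t})"

text \<open>The cavity version of \<open>unm\<close>: the free vertices are computed without the
  bits at \<open>v t\<close> and are therefore independent of them. The left copy of
  \<open>v t\<close> is left out because its bit is a loop.\<close>

definition cav_unm :: "nat \<Rightarrow> ('e \<Rightarrow> bool) \<Rightarrow> bool" where
  "cav_unm t x \<longleftrightarrow> (\<forall>u\<in>avail (net (cut t x)) t - {v t}. \<not> x (bit (u, v t)))"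

lemma chain_from_expl: "t < n \<Longrightarrow> chain_from (net x) k t \<Longrightarrow> expl k t x"
  using chain_ech by (fastforce simp: chain_from_def expl_def net_def)

lemma cav_unm_expl:
  assumes t: "t < n" and ne: "cav_unm t x \<noteq> unm (net x) t"
  shows "expl k t x"
proof (rule ccontr)
  assume no: "\<not> expl k t x"
  have vt: "v t \<in> V n" by (rule v_in[OF t])
  have loop: "\<not> x (bit (v t, v t))" using no by (auto simp: expl_def)
  have *: "u \<in> avail (net x) t \<longleftrightarrow> u \<in> avail (net (cut t x)) t" if "u \<in> V n" "u \<noteq> v t" "x (bit (u, v t))" for u
  proof (rule ccontr)
    assume "\<not> ?thesis"
    then have "ech k x u t {u, v t}" by (intro avail_cut[OF t order_refl]) (use that in auto)
    then show False using no that by (auto simp: expl_def)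
  qed
  have "cav_unm t x \<longleftrightarrow> (\<forall>u\<in>V n. u \<noteq> v t \<longrightarrow> x (bit (u, v t)) \<longrightarrow> u \<notin> avail (net (cut t x)) t)"
    using avail_subset[of "net (cut t x)" t] by (auto simp: cav_unm_def)
  moreover have "(u, v t) \<in> net x \<longleftrightarrow> u \<in> V n \<and> u \<noteq> v t \<and> x (bit (u, v t))" for u
    using loop vt by (auto simp: net_def)
  then have "unm (net x) t \<longleftrightarrow> (\<forall>u\<in>V n. u \<noteq> v t \<longrightarrow> x (bit (u, v t)) \<longrightarrow> u \<notin> avail (net x) t)"
    by (auto simp: unm_def)
  ultimately show False using ne * by simp
qed

lemma cut_upd: "inc (v t) e \<Longrightarrow> cut t (x(e := b)) = cut t x"
  by (auto simp: cut_def)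

end

text \<open>Collects the terms of order \<open>1 / n\<close> when \<open>m\<close> bounds the number
  of explored vertices: \<open>u\<close> sees an explored vertex, or a new right vertex has an
  explored neighbour, or one of these happens in a later round, with two more vertices
  explored.\<close>

fun rem_const :: "real \<Rightarrow> nat \<Rightarrow> real \<Rightarrow> real" where
  "rem_const C 0 m = 0"
| "rem_const C (Suc k) m = m * C + (m + 1) * C\<^sup>2 + C\<^sup>2 * rem_const C k (m + 2)"

text \<open>\<open>q\<close> is the probability of loops and \<open>p\<close> that of all other
  bits.\<close>

locale rbits = bits n v ch bit for n v ch and bit :: "nat \<times> nat \<Rightarrow> 'e" +
  fixes p q C :: real
  assumes q0: "0 \<le> q" and qp: "q \<le> p" and p1: "p \<le> 1" and pC: "real n * p \<le> C"
begin

definition pr :: "'e \<Rightarrow> real" where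
  "pr e = (if \<exists>i\<in>V n. e = bit (i, i) then q else p)"

abbreviation "M \<equiv> bprod EE pr"
abbreviation "Ev f \<equiv> measure_pmf.expectation (bprod EE pr) (f :: _ \<Rightarrow> real)"
abbreviation "Pb Q \<equiv> measure_pmf.prob (bprod EE pr) {x. Q x}"

lemma pr_bounds: "0 \<le> pr e" "pr e \<le> 1" "pr e \<le> p"
  using q0 qp p1 by (auto simp: pr_def)

lemma pr_bit: "i \<in> V n \<Longrightarrow> j \<in> V n \<Longrightarrow> i \<noteq> j \<Longrightarrow> pr (bit (i, j)) = p"
  using bit_inj by (force simp: pr_def doubleton_eq_iff)

lemma p0: "0 \<le> p" and C0: "0 \<le> C"
proof -
  show "0 \<le> p" using q0 qp by simp
  then have "0 \<le> real n * p" by simp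
  then show "0 \<le> C" using pC by simp
qed

lemma sum_pr: "(\<Sum>e\<in>EE. pr e) \<le> C * real n"
proof -
  have "(\<Sum>e\<in>EE. pr e) \<le> (\<Sum>e\<in>EE. p)" by (intro sum_mono pr_bounds)
  also have "\<dots> = real (card EE) * p" by simp
  also have "\<dots> \<le> real (n\<^sup>2) * p" using card_EE p0 by (intro mult_right_mono of_nat_mono)
  also have "\<dots> = (real n * p) * real n" by (simp add: power2_eq_square)
  also have "\<dots> \<le> C * real n" using pC by (rule mult_right_mono) simp
  finally show ?thesis .
qed

lemma Pb_bit: "i \<in> V n \<Longrightarrow> j \<in> V n \<Longrightarrow> Pb (\<lambda>x. x (bit (i, j))) \<le> p"
  using prob_bit[of EE "bit (i, j)" pr] pr_bounds bit_in_EE by simp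

lemma Pb_bit_and:
  assumes "i \<in> V n" "j \<in> V n" "\<And>x b. Q (x(bit (i, j) := b)) = Q x"
  shows "Pb (\<lambda>x. x (bit (i, j)) \<and> Q x) \<le> p * Pb Q"
  using prob_bit_on[of EE "bit (i, j)" pr Q] pr_bounds bit_in_EE assms
  by (simp add: mult_right_mono)

abbreviation "rem \<equiv> rem_const C"

lemma np2: "real n * p\<^sup>2 \<le> C\<^sup>2 / real n"
proof (cases "n = 0")
  case False
  have "(real n * p)\<^sup>2 \<le> C\<^sup>2" using pC p0 by (intro power_mono) auto
  then show ?thesis using False by (simp add: field_simps power2_eq_square)
qed simp

lemma rem_nonneg: "0 \<le> m \<Longrightarrow> 0 \<le> rem k m"
  using C0 by (induction k arbitrary: m) auto

text \<open>One round to new vertices costs two fresh bits, that is \<open>p ^ 2\<close>, for at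
  most \<open>n\<close> choices of \<open>w\<close> and one choice of \<open>s < t\<close>. Summing
  over \<open>s\<close> turns \<open>s ^ k\<close> into \<open>t ^ Suc k / Suc k\<close>. Returns to
  explored vertices are rarer by a factor \<open>n\<close> and go into
  \<open>rem_const\<close>.\<close>

lemma Pb_ech:
  assumes "t < n" "Z \<subseteq> V n" "u \<in> Z" "v t \<in> Z" "real (card Z) \<le> m"
  shows "Pb (\<lambda>x. ech k x u t Z) \<le> C ^ (2 * k) * (real t / real n) ^ k / fact k + rem k m / real n"
  using assms
proof (induction k arbitrary: u t Z m)
  case (Suc k)
  have n0: "0 < n" using Suc.prems by simp
  have finZ: "finite Z" using Suc.prems(2) finite_V by (rule finite_subset)
  have uV: "u \<in> V n" using Suc.prems by auto
  have m0: "0 \<le> m" using Suc.prems(5) by linarith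
  define S where "S = {s. s < t \<and> v s \<notin> Z}"
  have S: "finite S" "S \<subseteq> {..<t}" by (auto simp: S_def)
  have vs: "v s \<in> V n" "v s \<notin> Z" "s < n" if "s \<in> S" for s
    using that Suc.prems v_in[of s] by (auto simp: S_def)
  have A: "Pb (\<lambda>x. \<exists>z\<in>Z. z \<noteq> v t \<and> x (bit (u, z))) \<le> m * C / real n"
  proof -
    have "Pb (\<lambda>x. \<exists>z\<in>Z. z \<noteq> v t \<and> x (bit (u, z))) \<le> (\<Sum>z\<in>Z. Pb (\<lambda>x. z \<noteq> v t \<and> x (bit (u, z))))"
      by (rule prob_bex_le[OF finZ])
    also have "\<dots> \<le> (\<Sum>z\<in>Z. p)"
    proof (rule sum_mono)
      fix z assume "z \<in> Z"
      then have "Pb (\<lambda>x. x (bit (u, z))) \<le> p" using Pb_bit uV Suc.prems by auto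
      then show "Pb (\<lambda>x. z \<noteq> v t \<and> x (bit (u, z))) \<le> p"
        using prob_imp_le[of "\<lambda>x. z \<noteq> v t \<and> x (bit (u, z))" "\<lambda>x. x (bit (u, z))" M] by linarith
    qed
    also have "\<dots> \<le> m * p" using Suc.prems p0 by (simp add: mult_right_mono)
    also have "\<dots> \<le> m * (C / real n)"
      using pC n0 m0 by (intro mult_left_mono) (auto simp: field_simps)
    finally show ?thesis by simp
  qed
  have B: "Pb (\<lambda>x. \<exists>w\<in>insert (v s) Z - {u}. x (bit (u, v s)) \<and> x (bit (w, v s))) \<le> (m + 1) * p\<^sup>2"
    if s: "s \<in> S" for s
  proof -
    have "Pb (\<lambda>x. \<exists>w\<in>insert (v s) Z - {u}. x (bit (u, v s)) \<and> x (bit (w, v s))) \<le>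
        (\<Sum>w\<in>insert (v s) Z - {u}. Pb (\<lambda>x. x (bit (u, v s)) \<and> x (bit (w, v s))))"
      by (rule prob_bex_le) (use finZ in simp)
    also have "\<dots> \<le> (\<Sum>w\<in>insert (v s) Z - {u}. p\<^sup>2)"
    proof (rule sum_mono)
      fix w assume w: "w \<in> insert (v s) Z - {u}"
      then have wV: "w \<in> V n" using vs[OF s] Suc.prems by auto
      have "{w, v s} \<noteq> {u, v s}" using w vs[OF s] Suc.prems by (auto simp: doubleton_eq_iff)
      then have "bit (w, v s) \<noteq> bit (u, v s)" using bit_inj[of w "v s" u "v s"] wV uV vs[OF s] by auto
      then have "Pb (\<lambda>x. x (bit (u, v s)) \<and> x (bit (w, v s))) \<le> p * Pb (\<lambda>x. x (bit (w, v s)))"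
        by (intro Pb_bit_and) (use uV vs[OF s] in auto)
      also have "\<dots> \<le> p * p" using Pb_bit wV vs[OF s] p0 by (intro mult_left_mono) auto
      finally show "Pb (\<lambda>x. x (bit (u, v s)) \<and> x (bit (w, v s))) \<le> p\<^sup>2" by (simp add: power2_eq_square)
    qed
    also have "\<dots> = real (card (insert (v s) Z - {u})) * p\<^sup>2" by simp
    also have "\<dots> \<le> (m + 1) * p\<^sup>2"
    proof (rule mult_right_mono)
      have "card (insert (v s) Z - {u}) \<le> card (insert (v s) Z)" by (rule card_mono) (use finZ in auto)
      also have "\<dots> \<le> card Z + 1" using finZ by (simp add: card_insert_if)
      finally show "real (card (insert (v s) Z - {u})) \<le> m + 1" using Suc.prems(5) by linarith
    qed simp
    finally show ?thesis .
  qed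
  define F where "F = (\<lambda>s. C ^ (2 * k) * (real s / real n) ^ k / fact k + rem k (m + 2) / real n)"
  have F0: "0 \<le> F s" for s unfolding F_def using C0 m0 rem_nonneg[of "m + 2" k] by simp
  \<comment> \<open>Both bits join vertices that count as explored in the next round, so by
    \<open>ech_upd\<close> the rest of the exploration does not depend on them.\<close>
  have D: "Pb (\<lambda>x. \<exists>w\<in>V n - insert (v s) Z. x (bit (u, v s)) \<and> x (bit (w, v s)) \<and>
      ech k x w s (insert w (insert (v s) Z))) \<le> C\<^sup>2 / real n * F s" if s: "s \<in> S" for s
  proof -
    have "Pb (\<lambda>x. \<exists>w\<in>V n - insert (v s) Z. x (bit (u, v s)) \<and> x (bit (w, v s)) \<and>
        ech k x w s (insert w (insert (v s) Z))) \<le> (\<Sum>w\<in>V n - insert (v s) Z.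
        Pb (\<lambda>x. x (bit (u, v s)) \<and> x (bit (w, v s)) \<and> ech k x w s (insert w (insert (v s) Z))))"
      by (rule prob_bex_le) simp
    also have "\<dots> \<le> (\<Sum>w\<in>V n - insert (v s) Z. p * (p * F s))"
    proof (rule sum_mono)
      fix w assume w: "w \<in> V n - insert (v s) Z"
      let ?Z = "insert w (insert (v s) Z)"
      let ?Q = "\<lambda>x. ech k x w s ?Z"
      have ZV: "?Z \<subseteq> V n" using w vs[OF s] Suc.prems by auto
      have inv1: "?Q (x(bit (u, v s) := b)) = ?Q x" for x b
        by (rule ech_upd) (use w vs[OF s] ZV Suc.prems in auto)
      have inv2: "?Q (x(bit (w, v s) := b)) = ?Q x" for x b
        by (rule ech_upd) (use w vs[OF s] ZV Suc.prems in auto)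
      have "{w, v s} \<noteq> {u, v s}" using w Suc.prems by (auto simp: doubleton_eq_iff)
      then have ne: "bit (w, v s) \<noteq> bit (u, v s)"
        using bit_inj[of w "v s" u "v s"] w uV vs[OF s] by auto
      have "Pb (\<lambda>x. x (bit (u, v s)) \<and> (x (bit (w, v s)) \<and> ?Q x)) \<le> p * Pb (\<lambda>x. x (bit (w, v s)) \<and> ?Q x)"
        by (rule Pb_bit_and) (use uV vs[OF s] inv1 ne in auto)
      also have "Pb (\<lambda>x. x (bit (w, v s)) \<and> ?Q x) \<le> p * Pb ?Q"
        by (rule Pb_bit_and) (use w vs[OF s] inv2 in auto)
      also have "Pb ?Q \<le> F s" unfolding F_def
      proof (rule Suc.IH)
        have "card ?Z \<le> card Z + 2" using finZ by (simp add: card_insert_if)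
        then show "real (card ?Z) \<le> m + 2" using Suc.prems(5) by linarith
      qed (use vs[OF s] ZV in auto)
      finally show "Pb (\<lambda>x. x (bit (u, v s)) \<and> x (bit (w, v s)) \<and> ?Q x) \<le> p * (p * F s)"
        using p0 by (simp add: mult_left_mono)
    qed
    also have "\<dots> = real (card (V n - insert (v s) Z)) * (p * (p * F s))" by simp
    also have "\<dots> \<le> real n * (p * (p * F s))"
    proof (rule mult_right_mono)
      have "card (V n - insert (v s) Z) \<le> card (V n)" by (rule card_mono) auto
      then show "real (card (V n - insert (v s) Z)) \<le> real n" by simp
    qed (use p0 F0 in auto)
    also have "\<dots> = (real n * p\<^sup>2) * F s" by (simp add: power2_eq_square)
    also have "\<dots> \<le> C\<^sup>2 / real n * F s" by (rule mult_right_mono[OF np2 F0])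
    finally show ?thesis .
  qed
  have "Pb (\<lambda>x. ech (Suc k) x u t Z) \<le> Pb (\<lambda>x. \<exists>z\<in>Z. z \<noteq> v t \<and> x (bit (u, z))) +
      Pb (\<lambda>x. \<exists>s\<in>S. (\<exists>w\<in>insert (v s) Z - {u}. x (bit (u, v s)) \<and> x (bit (w, v s))) \<or>
       (\<exists>w\<in>V n - insert (v s) Z. x (bit (u, v s)) \<and> x (bit (w, v s)) \<and>
          ech k x w s (insert w (insert (v s) Z))))"
    unfolding ech.simps S_def by (rule prob_disj_le)
  also have "\<dots> \<le> m * C / real n + (\<Sum>s\<in>S. (m + 1) * p\<^sup>2 + C\<^sup>2 / real n * F s)"
    by (intro add_mono A order_trans[OF prob_bex_le[OF S(1)]] sum_mono order_trans[OF prob_disj_le] B D)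
  also have "\<dots> \<le> m * C / real n + (\<Sum>s<t. (m + 1) * p\<^sup>2 + C\<^sup>2 / real n * F s)"
    using S m0 F0 by (intro add_left_mono sum_mono2) auto
  also have "\<dots> = m * C / real n + real t * (m + 1) * p\<^sup>2 + C\<^sup>2 / real n * (\<Sum>s<t. F s)"
    by (simp add: sum.distrib sum_distrib_left)
  also have "\<dots> \<le> m * C / real n + (m + 1) * C\<^sup>2 / real n +
      (C ^ (2 * Suc k) * (real t / real n) ^ Suc k / fact (Suc k) + C\<^sup>2 * rem k (m + 2) / real n)"
  proof (intro add_mono order_refl)
    have "real t * (m + 1) * p\<^sup>2 \<le> real n * (m + 1) * p\<^sup>2"
      using Suc.prems m0 by (intro mult_right_mono) auto
    also have "\<dots> = (m + 1) * (real n * p\<^sup>2)" by simp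
    also have "\<dots> \<le> (m + 1) * (C\<^sup>2 / real n)" using np2 m0 by (intro mult_left_mono) auto
    finally show "real t * (m + 1) * p\<^sup>2 \<le> (m + 1) * C\<^sup>2 / real n" by simp
  next
    \<comment> \<open>The main part is a power sum; the remainder does not depend on
      \<open>s\<close> and is summed over at most \<open>n\<close> times.\<close>
    have "(\<Sum>s<t. F s) = C ^ (2 * k) / (real n ^ k * fact k) * (\<Sum>s<t. real s ^ k) + real t * (rem k (m + 2) / real n)"
      by (simp add: F_def sum.distrib sum_distrib_left power_divide field_simps) (simp add: sum_divide_distrib)
    also have "\<dots> \<le> C ^ (2 * k) / (real n ^ k * fact k) * (real t ^ Suc k / real (Suc k)) + rem k (m + 2)"
    proof (intro add_mono mult_left_mono sum_power_le)
      have "real t * (rem k (m + 2) / real n) \<le> real n * (rem k (m + 2) / real n)"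
        using Suc.prems rem_nonneg[of "m + 2" k] m0 by (intro mult_right_mono) auto
      then show "real t * (rem k (m + 2) / real n) \<le> rem k (m + 2)" using n0 by simp
    qed (use C0 in auto)
    finally have "C\<^sup>2 / real n * (\<Sum>s<t. F s) \<le> C\<^sup>2 / real n *
        (C ^ (2 * k) / (real n ^ k * fact k) * (real t ^ Suc k / real (Suc k)) + rem k (m + 2))"
      by (rule mult_left_mono) simp
    also have "\<dots> = C ^ (2 * Suc k) * (real t / real n) ^ Suc k / fact (Suc k) + C\<^sup>2 * rem k (m + 2) / real n"
      by (simp add: power_divide power_add power2_eq_square divide_simps) (simp add: algebra_simps)
    finally show "C\<^sup>2 / real n * (\<Sum>s<t. F s) \<le>
      C ^ (2 * Suc k) * (real t / real n) ^ Suc k / fact (Suc k) + C\<^sup>2 * rem k (m + 2) / real n" .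
  qed
  also have "\<dots> = C ^ (2 * Suc k) * (real t / real n) ^ Suc k / fact (Suc k) + rem (Suc k) m / real n"
    by (simp add: add_divide_distrib)
  finally show ?case .
qed simp

definition beta :: "nat \<Rightarrow> real" where
  "beta k = C / real n + C * (C ^ (2 * k) / fact k + rem k 2 / real n)"

lemma Pb_expl:
  assumes t: "t < n"
  shows "Pb (expl k t) \<le> beta k"
proof -
  have n0: "0 < n" using t by simp
  have vt: "v t \<in> V n" by (rule v_in[OF t])
  let ?F = "C ^ (2 * k) / fact k + rem k 2 / real n"
  have F0: "0 \<le> ?F" using C0 rem_nonneg[of 2 k] by simp
  have pn: "p \<le> C / real n" using pC n0 by (simp add: field_simps)
  have "Pb (expl k t) \<le> Pb (\<lambda>x. x (bit (v t, v t))) +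
      Pb (\<lambda>x. \<exists>w\<in>V n - {v t}. x (bit (w, v t)) \<and> ech k x w t {w, v t})"
    unfolding expl_def by (rule prob_disj_le)
  also have "\<dots> \<le> C / real n + (\<Sum>w\<in>V n - {v t}. p * ?F)"
  proof (intro add_mono order_trans[OF prob_bex_le] sum_mono)
    show "Pb (\<lambda>x. x (bit (v t, v t))) \<le> C / real n" using Pb_bit[OF vt vt] pn by linarith
  next
    fix w assume w: "w \<in> V n - {v t}"
    have inv: "ech k (x(bit (w, v t) := b)) w t {w, v t} = ech k x w t {w, v t}" for x b
      by (rule ech_upd) (use w vt t in auto)
    have "Pb (\<lambda>x. x (bit (w, v t)) \<and> ech k x w t {w, v t}) \<le> p * Pb (\<lambda>x. ech k x w t {w, v t})"
      by (rule Pb_bit_and) (use w vt inv in auto)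
    also have "Pb (\<lambda>x. ech k x w t {w, v t}) \<le> C ^ (2 * k) * (real t / real n) ^ k / fact k + rem k 2 / real n"
      by (rule Pb_ech) (use w vt t in \<open>auto simp: card_insert_if\<close>)
    also have "\<dots> \<le> C ^ (2 * k) * 1 / fact k + rem k 2 / real n"
      using C0 t by (intro add_right_mono divide_right_mono mult_left_mono power_le_one) auto
    finally show "Pb (\<lambda>x. x (bit (w, v t)) \<and> ech k x w t {w, v t}) \<le> p * ?F"
      using p0 by (simp add: mult_left_mono)
  qed simp
  also have "(\<Sum>w\<in>V n - {v t}. p * ?F) = real (card (V n - {v t})) * p * ?F" by simp
  also have "\<dots> \<le> real n * p * ?F"
  proof (intro mult_right_mono F0 p0)
    have "card (V n - {v t}) \<le> card (V n)" by (rule card_mono) auto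
    then show "real (card (V n - {v t})) \<le> real n" by simp
  qed
  also have "\<dots> \<le> C * ?F" by (rule mult_right_mono[OF pC F0])
  finally show ?thesis by (simp add: beta_def)
qed

text \<open>Fix the value \<open>A\<close> of the free set, which does not involve bits at
  \<open>v t\<close>. The bits between \<open>A\<close> and \<open>v t\<close> are then independent
  of it, distinct, and of probability \<open>p\<close>, loops being excluded.\<close>

lemma Pb_cav_unm:
  assumes t: "t < n"
  shows "Pb (cav_unm t) = Ev (\<lambda>x. (1 - p) ^ card (avail (net (cut t x)) t - {v t}))"
proof -
  have vt: "v t \<in> V n" by (rule v_in[OF t])
  let ?L = "\<lambda>x. avail (net (cut t x)) t"
  have "Pb (cav_unm t) = Ev (\<lambda>x. \<Sum>A\<in>Pow (V n). of_bool ((\<forall>e\<in>(\<lambda>u. bit (u, v t)) ` (A - {v t}). \<not> x e) \<and> ?L x = A))"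
    unfolding prob_eq_expectation
  proof (intro Bochner_Integration.integral_cong refl)
    fix x
    have "(\<Sum>A\<in>Pow (V n). of_bool ((\<forall>e\<in>(\<lambda>u. bit (u, v t)) ` (A - {v t}). \<not> x e) \<and> ?L x = A)) =
        (\<Sum>A\<in>Pow (V n). if A = ?L x then of_bool (cav_unm t x) else (0::real))"
      by (intro sum.cong) (auto simp: cav_unm_def)
    also have "\<dots> = of_bool (cav_unm t x)" using avail_subset by (simp add: sum.delta)
    finally show "(of_bool (cav_unm t x) :: real) =
      (\<Sum>A\<in>Pow (V n). of_bool ((\<forall>e\<in>(\<lambda>u. bit (u, v t)) ` (A - {v t}). \<not> x e) \<and> ?L x = A))" by simp
  qed
  also have "\<dots> = (\<Sum>A\<in>Pow (V n). Pb (\<lambda>x. (\<forall>e\<in>(\<lambda>u. bit (u, v t)) ` (A - {v t}). \<not> x e) \<and> ?L x = A))"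
    unfolding prob_eq_expectation by (rule Bochner_Integration.integral_sum) simp
  also have "\<dots> = (\<Sum>A\<in>Pow (V n). (1 - p) ^ card (A - {v t}) * Pb (\<lambda>x. ?L x = A))"
  proof (rule sum.cong[OF refl])
    fix A assume A: "A \<in> Pow (V n)"
    have inj: "inj_on (\<lambda>u. bit (u, v t)) (A - {v t})"
    proof (rule inj_onI)
      fix a b assume "a \<in> A - {v t}" "b \<in> A - {v t}" "bit (a, v t) = bit (b, v t)"
      then show "a = b" using bit_inj[of a "v t" b "v t"] A vt by (auto simp: doubleton_eq_iff)
    qed
    have "Pb (\<lambda>x. (\<forall>e\<in>(\<lambda>u. bit (u, v t)) ` (A - {v t}). \<not> x e) \<and> ?L x = A) =
        (\<Prod>e\<in>(\<lambda>u. bit (u, v t)) ` (A - {v t}). 1 - pr e) * Pb (\<lambda>x. ?L x = A)"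
    proof (rule prob_bits_off)
      fix x b e assume "e \<in> (\<lambda>u. bit (u, v t)) ` (A - {v t})"
      then have "inc (v t) e" using A by (auto simp: inc_def)
      then show "(?L (x(e := b)) = A) = (?L x = A)" by (simp add: cut_upd)
    qed (use A vt pr_bounds bit_in_EE in auto)
    also have "(\<Prod>e\<in>(\<lambda>u. bit (u, v t)) ` (A - {v t}). 1 - pr e) = (\<Prod>u\<in>A - {v t}. 1 - p)"
      unfolding prod.reindex[OF inj] using A vt pr_bit by (intro prod.cong) auto
    finally show "Pb (\<lambda>x. (\<forall>e\<in>(\<lambda>u. bit (u, v t)) ` (A - {v t}). \<not> x e) \<and> ?L x = A) =
      (1 - p) ^ card (A - {v t}) * Pb (\<lambda>x. ?L x = A)" by simp
  qed
  also have "\<dots> = Ev (\<lambda>x. \<Sum>A\<in>Pow (V n). (1 - p) ^ card (A - {v t}) * of_bool (?L x = A))"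
    unfolding prob_eq_expectation by (subst Bochner_Integration.integral_sum) auto
  also have "\<dots> = Ev (\<lambda>x. (1 - p) ^ card (?L x - {v t}))"
  proof (intro Bochner_Integration.integral_cong refl)
    fix x
    have "(\<Sum>A\<in>Pow (V n). (1 - p) ^ card (A - {v t}) * of_bool (?L x = A)) =
        (\<Sum>A\<in>Pow (V n). if A = ?L x then (1 - p) ^ card (?L x - {v t}) else 0)"
      by (intro sum.cong) auto
    also have "\<dots> = (1 - p) ^ card (?L x - {v t})" using avail_subset by (simp add: sum.delta)
    finally show "(\<Sum>A\<in>Pow (V n). (1 - p) ^ card (A - {v t}) * of_bool (?L x = A)) = (1 - p) ^ card (?L x - {v t})" .
  qed
  finally show ?thesis .
qed

end

section \<open>The limit in the model of independent bits\<close>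

text \<open>The limiting fraction of unmatched vertices. The value at 0 is the continuous extension
  of the formula.\<close>

definition free_limit :: "real \<Rightarrow> real" where
  "free_limit lam = (if lam = 0 then 1 else ln (2 - exp (- lam)) / lam)"

text \<open>
  In terms of \<open>z = exp (lam l / n)\<close> the drift equation becomes linear,
  \<open>z' = - lam (z - 1)\<close>, which gives the closed form of the limit.
\<close>
lemma free_limit_recursion:
  fixes l :: "nat \<Rightarrow> real"
  assumes n: "0 < n" "lam \<le> real n" and lam: "0 \<le> lam" and l0: "l 0 = real n" and \<eta>: "0 \<le> \<eta>"
    and range: "\<And>t. t \<le> n \<Longrightarrow> 0 \<le> l t \<and> l t \<le> real n"
    and mono: "\<And>t. t < n \<Longrightarrow> \<bar>l (Suc t) - l t\<bar> \<le> 1"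
    and step: "\<And>t. t < n \<Longrightarrow> \<bar>l (Suc t) - l t + 1 - exp (- (lam / real n * l t))\<bar> \<le> \<eta>"
  shows "\<bar>l n / real n - free_limit lam\<bar> \<le> exp lam * (\<eta> + 2 * lam / real n)"
proof (cases "lam = 0")
  case True
  have "\<bar>l t - real n\<bar> \<le> real t * \<eta>" if "t \<le> n" for t
    using that
  proof (induction t)
    case (Suc t)
    have "\<bar>l (Suc t) - real n\<bar> \<le> \<bar>l (Suc t) - l t\<bar> + \<bar>l t - real n\<bar>" by simp
    also have "\<bar>l (Suc t) - l t\<bar> \<le> \<eta>" using step[of t] Suc True by simp
    also have "\<bar>l t - real n\<bar> \<le> real t * \<eta>" using Suc by simp
    finally show ?case by (simp add: algebra_simps)
  qed (simp add: l0)
  from this[of n] have "\<bar>l n / real n - 1\<bar> \<le> \<eta>"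
    using n by (simp add: abs_le_iff field_simps)
  then show ?thesis using True by (simp add: free_limit_def)
next
  case False
  then have lp: "0 < lam" using lam by simp
  define h where "h = lam / real n"
  have h: "0 < h" "h \<le> 1" using n lp by (auto simp: h_def)
  define z where "z = (\<lambda>t. exp (h * l t))"
  have z: "1 \<le> z t" "z t \<le> exp lam" if "t \<le> n" for t
  proof -
    have "0 \<le> h * l t" using range[OF that] h by simp
    then show "1 \<le> z t" by (simp add: z_def)
    have "h * l t \<le> h * real n" using range[OF that] h by (intro mult_left_mono) auto
    then show "z t \<le> exp lam" using n by (simp add: z_def h_def)
  qed
  define \<rho> where "\<rho> = exp lam * (h * \<eta> + h\<^sup>2)"
  have \<rho>: "\<bar>(z (Suc t) - 1) - (1 - h) * (z t - 1)\<bar> \<le> \<rho>" if t: "t < n" for t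
  proof -
    define d where "d = l (Suc t) - l t"
    define r where "r = d + 1 - exp (- (h * l t))"
    have d: "\<bar>d\<bar> \<le> 1" using mono[OF t] by (simp add: d_def)
    have r: "\<bar>r\<bar> \<le> \<eta>" using step[OF t] by (simp add: r_def d_def h_def)
    have "\<bar>h * d\<bar> \<le> 1 * 1" unfolding abs_mult using h d by (intro mult_mono) auto
    then have "exp (h * d) \<le> 1 + h * d + (h * d)\<^sup>2" by (intro exp_le_quadratic) simp
    moreover have "1 + h * d \<le> exp (h * d)" by simp
    moreover have "(h * d)\<^sup>2 \<le> h\<^sup>2"
    proof -
      have "d\<^sup>2 \<le> 1" using d by (simp add: abs_square_le_1)
      then show ?thesis using mult_left_mono[of "d\<^sup>2" 1 "h\<^sup>2"] by (simp add: power_mult_distrib)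
    qed
    ultimately have e: "\<bar>exp (h * d) - 1 - h * d\<bar> \<le> h\<^sup>2" by linarith
    have "z (Suc t) = z t * exp (h * d)" by (simp add: z_def d_def exp_add[symmetric] algebra_simps)
    \<comment> \<open>The linearization: the nonlinear drift \<open>exp (- (h * l t))\<close> is the
      reciprocal of \<open>z t\<close>, so multiplying by \<open>z t\<close> turns it into the
      constant 1.\<close>
    moreover have "z t * exp (- (h * l t)) = 1" by (simp add: z_def exp_add[symmetric])
    then have "z t * d = z t * r - z t + 1" by (simp add: r_def algebra_simps)
    then have "z t * (h * d) = h * (z t * r - z t + 1)" by (metis mult.left_commute)
    ultimately have "(z (Suc t) - 1) - (1 - h) * (z t - 1) = z t * (exp (h * d) - 1 - h * d) + z t * (h * r)"
      by (simp add: algebra_simps)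
    also have "\<bar>\<dots>\<bar> \<le> z t * h\<^sup>2 + z t * (h * \<eta>)"
    proof (rule order_trans[OF abs_triangle_ineq], rule add_mono)
      show "\<bar>z t * (exp (h * d) - 1 - h * d)\<bar> \<le> z t * h\<^sup>2"
        using e z[of t] t by (simp add: abs_mult mult_left_mono)
      show "\<bar>z t * (h * r)\<bar> \<le> z t * (h * \<eta>)"
        using r z[of t] t h by (simp add: abs_mult mult_left_mono)
    qed
    also have "\<dots> = z t * (h * \<eta> + h\<^sup>2)" by (simp add: algebra_simps)
    also have "\<dots> \<le> \<rho>" unfolding \<rho>_def using z[of t] t h \<eta> by (intro mult_right_mono) auto
    finally show ?thesis .
  qed
  have \<rho>0: "0 \<le> \<rho>" using h \<eta> by (simp add: \<rho>_def)
  have it: "\<bar>(z t - 1) - (1 - h) ^ t * (exp lam - 1)\<bar> \<le> real t * \<rho>" if "t \<le> n" for t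
    using that
  proof (induction t)
    case 0
    have "z 0 = exp lam" using n l0 by (simp add: z_def h_def)
    then show ?case by simp
  next
    case (Suc t)
    have "(z (Suc t) - 1) - (1 - h) ^ Suc t * (exp lam - 1) =
        ((z (Suc t) - 1) - (1 - h) * (z t - 1)) + (1 - h) * ((z t - 1) - (1 - h) ^ t * (exp lam - 1))"
      by (simp add: algebra_simps)
    also have "\<bar>\<dots>\<bar> \<le> \<rho> + real t * \<rho>"
    proof (rule order_trans[OF abs_triangle_ineq], rule add_mono[OF \<rho>])
      have "\<bar>(1 - h) * ((z t - 1) - (1 - h) ^ t * (exp lam - 1))\<bar> \<le> 1 * \<bar>(z t - 1) - (1 - h) ^ t * (exp lam - 1)\<bar>"
        unfolding abs_mult using h by (intro mult_right_mono) auto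
      also have "\<dots> \<le> real t * \<rho>" using Suc by simp
      finally show "\<bar>(1 - h) * ((z t - 1) - (1 - h) ^ t * (exp lam - 1))\<bar> \<le> real t * \<rho>" .
    qed (use Suc in simp)
    finally show ?case by (simp add: algebra_simps)
  qed
  have pw: "\<bar>(1 - h) ^ n - exp (- lam)\<bar> \<le> real n * h\<^sup>2"
  proof -
    have "exp (- lam) = exp (- h) ^ n" using n by (simp add: exp_of_nat_mult[symmetric] h_def)
    then have "\<bar>(1 - h) ^ n - exp (- lam)\<bar> = norm ((1 - h) ^ n - exp (- h) ^ n)" by simp
    also have "\<dots> \<le> real n * norm ((1 - h) - exp (- h))" using h by (intro norm_power_diff) auto
    also have "norm ((1 - h) - exp (- h)) \<le> h\<^sup>2"
      using exp_le_quadratic[of "- h"] exp_ge_add_one_self[of "- h"] h by simp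
    finally show ?thesis by (simp add: mult_left_mono)
  qed
  \<comment> \<open>The value predicted for \<open>z n\<close>: the recursion gives
    \<open>1 + (1 - h) ^ n * (exp lam - 1)\<close>, and \<open>(1 - h) ^ n\<close> is close to
    \<open>exp (- lam)\<close>.\<close>
  define w where "w = 2 - exp (- lam)"
  have w1: "1 \<le> w" using lp by (simp add: w_def)
  have "z n - w = ((z n - 1) - (1 - h) ^ n * (exp lam - 1)) + ((1 - h) ^ n - exp (- lam)) * (exp lam - 1)"
    unfolding w_def by (simp add: algebra_simps exp_add[symmetric])
  also have "\<bar>\<dots>\<bar> \<le> real n * \<rho> + (real n * h\<^sup>2) * exp lam"
  proof (rule order_trans[OF abs_triangle_ineq], rule add_mono)
    show "\<bar>(z n - 1) - (1 - h) ^ n * (exp lam - 1)\<bar> \<le> real n * \<rho>" using it by simp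
    show "\<bar>((1 - h) ^ n - exp (- lam)) * (exp lam - 1)\<bar> \<le> (real n * h\<^sup>2) * exp lam"
      unfolding abs_mult using pw lp by (intro mult_mono) auto
  qed
  also have "\<dots> = exp lam * (real n * h) * (\<eta> + 2 * h)"
    unfolding \<rho>_def by (simp add: algebra_simps power2_eq_square)
  also have "\<dots> = lam * (exp lam * (\<eta> + 2 * lam / real n))"
    using n by (simp add: h_def)
  finally have zw: "\<bar>z n - w\<bar> \<le> lam * (exp lam * (\<eta> + 2 * lam / real n))" .
  have lnl: "\<bar>ln a - ln b\<bar> \<le> \<bar>a - b\<bar>" if "1 \<le> a" "1 \<le> b" for a b :: real
  proof -
    have "ln a - ln b \<le> \<bar>a - b\<bar>" if "1 \<le> a" "1 \<le> b" for a b :: real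
    proof -
      have "ln a - ln b = ln (a / b)" using that by (simp add: ln_div)
      also have "\<dots> \<le> a / b - 1" using that by (intro ln_le_minus_one) auto
      also have "\<dots> = (a - b) / b" using that by (simp add: field_simps)
      also have "\<dots> \<le> \<bar>a - b\<bar> / b" using that by (intro divide_right_mono) auto
      also have "\<dots> \<le> \<bar>a - b\<bar>" using that by (simp add: divide_le_eq mult_le_cancel_left1)
      finally show ?thesis .
    qed
    from this[OF that] this[OF that(2,1)] show ?thesis by linarith
  qed
  have "\<bar>ln (z n) - ln w\<bar> \<le> \<bar>z n - w\<bar>" using z[of n] w1 by (intro lnl) auto
  then have "\<bar>h * l n - ln w\<bar> \<le> lam * (exp lam * (\<eta> + 2 * lam / real n))" using zw by (simp add: z_def)
  moreover have "h * l n - ln w = lam * (l n / real n - free_limit lam)"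
    using False by (simp add: h_def free_limit_def w_def field_simps)
  ultimately have "lam * \<bar>l n / real n - free_limit lam\<bar> \<le> lam * (exp lam * (\<eta> + 2 * lam / real n))"
    using lp by (simp add: abs_mult)
  then show ?thesis using lp by simp
qed

section \<open>Moments of the degrees and of the approximation error\<close>

context rbits
begin

lemma abs_Ev_diff_le:
  assumes "\<And>x. \<bar>f x - g x\<bar> \<le> h x"
  shows "\<bar>Ev f - Ev g\<bar> \<le> Ev h"
proof -
  have "\<bar>Ev (\<lambda>x. f x - g x)\<bar> \<le> Ev (\<lambda>x. \<bar>f x - g x\<bar>)" by (rule integral_abs_bound)
  moreover have "Ev (\<lambda>x. \<bar>f x - g x\<bar>) \<le> Ev h" using assms by (intro integral_mono) auto
  moreover have "Ev (\<lambda>x. f x - g x) = Ev f - Ev g" by (rule Bochner_Integration.integral_diff) auto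
  ultimately show ?thesis by simp
qed

lemma card_inc:
  assumes "w \<in> V n"
  shows "card {e \<in> EE. inc w e} \<le> 2 * n"
proof -
  have "{e \<in> EE. inc w e} \<subseteq> (\<lambda>a. bit (a, w)) ` V n \<union> (\<lambda>a. bit (w, a)) ` V n" by (auto simp: inc_def)
  then have "card {e \<in> EE. inc w e} \<le> card ((\<lambda>a. bit (a, w)) ` V n \<union> (\<lambda>a. bit (w, a)) ` V n)"
    by (rule card_mono[rotated]) simp
  also have "\<dots> \<le> card ((\<lambda>a. bit (a, w)) ` V n) + card ((\<lambda>a. bit (w, a)) ` V n)" by (rule card_Un_le)
  also have "\<dots> \<le> card (V n) + card (V n)" by (intro add_mono card_image_le) auto
  finally show ?thesis by simp
qed

lemma sum_pr_inc:
  assumes "w \<in> V n"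
  shows "(\<Sum>e\<in>{e \<in> EE. inc w e}. pr e) \<le> 2 * C"
proof -
  have "(\<Sum>e\<in>{e \<in> EE. inc w e}. pr e) \<le> (\<Sum>e\<in>{e \<in> EE. inc w e}. p)" by (intro sum_mono pr_bounds)
  also have "\<dots> = real (card {e \<in> EE. inc w e}) * p" by simp
  also have "\<dots> \<le> real (2 * n) * p" using card_inc[OF assms] p0 by (intro mult_right_mono of_nat_mono)
  also have "\<dots> \<le> 2 * C" using pC by simp
  finally show ?thesis .
qed

lemma deg_eq_sum: "real (deg x w) = (\<Sum>e\<in>{e \<in> EE. inc w e}. of_bool (x e))"
proof -
  have "{e \<in> EE. inc w e} \<inter> Collect x = {e \<in> EE. x e \<and> inc w e}" by auto
  then show ?thesis by (simp add: deg_def of_bool_def sum.If_cases)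
qed

lemma Ev_deg:
  assumes "w \<in> V n"
  shows "Ev (\<lambda>x. real (deg x w)) \<le> 2 * C"
proof -
  have "Ev (\<lambda>x. real (deg x w)) = (\<Sum>e\<in>{e \<in> EE. inc w e}. Pb (\<lambda>x. x e))"
    unfolding deg_eq_sum prob_eq_expectation by (rule Bochner_Integration.integral_sum) simp
  also have "\<dots> = (\<Sum>e\<in>{e \<in> EE. inc w e}. pr e)"
    by (intro sum.cong refl prob_bit) (auto simp: pr_bounds)
  finally show ?thesis using sum_pr_inc[OF assms] by simp
qed

lemma Ev_exp_deg:
  assumes "w \<in> V n"
  shows "Ev (\<lambda>x. exp (real (deg x w))) \<le> exp (4 * C)"
proof -
  have "exp (real (deg x w)) = (\<Prod>e\<in>EE. if inc w e \<and> x e then exp 1 else 1)" for x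
  proof -
    have "exp (real (deg x w)) = (\<Prod>e\<in>{e \<in> EE. inc w e}. exp (of_bool (x e)))"
      unfolding deg_eq_sum by (rule exp_sum) simp
    also have "\<dots> = (\<Prod>e\<in>EE. if inc w e then exp (of_bool (x e)) else 1)"
      by (rule prod.inter_filter) simp
    also have "\<dots> = (\<Prod>e\<in>EE. if inc w e \<and> x e then exp 1 else 1)" by (intro prod.cong) auto
    finally show ?thesis .
  qed
  then have "Ev (\<lambda>x. exp (real (deg x w))) =
      (\<Prod>e\<in>EE. measure_pmf.expectation (bernoulli_pmf (pr e)) (\<lambda>b. if inc w e \<and> b then exp 1 else 1))"
    unfolding bprod_def by (simp, intro expectation_prod_Pi_pmf) (auto intro!: integrable_measure_pmf_finite)
  also have "\<dots> \<le> (\<Prod>e\<in>EE. exp (of_bool (inc w e) * (2 * pr e)))"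
  proof (intro prod_mono conjI)
    fix e
    show "0 \<le> measure_pmf.expectation (bernoulli_pmf (pr e)) (\<lambda>b. if inc w e \<and> b then exp 1 else (1::real))"
      by (intro integral_nonneg_AE) auto
    have "measure_pmf.expectation (bernoulli_pmf (pr e)) (\<lambda>b. if inc w e \<and> b then exp 1 else (1::real)) =
        pr e * (if inc w e then exp 1 else 1) + (1 - pr e)"
      using pr_bounds[of e] by simp
    \<comment> \<open>By \<open>exp 1\<close> \<le> 3 a bit contributes at most
      \<open>2 * pr e\<close>. Together with the sum of probabilities at a vertex, at most
      \<open>2 * C\<close>, this explains the \<open>4 * C\<close>.\<close>
    also have "\<dots> \<le> 1 + of_bool (inc w e) * (2 * pr e)"
      using mult_left_mono[OF exp_le, of "pr e"] pr_bounds[of e] by (auto simp: algebra_simps)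
    also have "\<dots> \<le> exp (of_bool (inc w e) * (2 * pr e))" by simp
    finally show "measure_pmf.expectation (bernoulli_pmf (pr e)) (\<lambda>b. if inc w e \<and> b then exp 1 else (1::real)) \<le>
      exp (of_bool (inc w e) * (2 * pr e))" .
  qed
  also have "\<dots> = exp (\<Sum>e\<in>EE. of_bool (inc w e) * (2 * pr e))" by (rule exp_sum[symmetric]) simp
  also have "(\<Sum>e\<in>EE. of_bool (inc w e) * (2 * pr e)) = (\<Sum>e\<in>{e \<in> EE. inc w e}. 2 * pr e)"
    unfolding sum.inter_filter[OF finite_EE] by (intro sum.cong) auto
  also have "\<dots> \<le> 4 * C" using sum_pr_inc[OF assms] by (simp add: sum_distrib_left[symmetric])
  finally show ?thesis by simp
qed

text \<open>The surplus over \<open>D\<close> is at most the exponential of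
  \<open>deg x w - D\<close>. The exponential decay in \<open>D\<close> matters, since the surplus
  gets multiplied by \<open>ball_const D k\<close>, a polynomial in \<open>D\<close>.\<close>

lemma Ev_excess: "Ev (excess D) \<le> real n * exp (4 * C - real D)"
proof -
  have "Ev (excess D) = (\<Sum>w\<in>V n. Ev (\<lambda>x. real (deg x w - D)))"
    unfolding excess_def by (rule Bochner_Integration.integral_sum) simp
  also have "\<dots> \<le> (\<Sum>w\<in>V n. exp (4 * C - real D))"
  proof (rule sum_mono)
    fix w assume w: "w \<in> V n"
    have "real (deg x w - D) \<le> exp (- real D) * exp (real (deg x w))" for x
    proof (cases "D \<le> deg x w")
      case True
      have "real (deg x w - D) \<le> exp (real (deg x w - D))"
        using exp_ge_add_one_self[of "real (deg x w - D)"] by linarith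
      then show ?thesis using True by (simp add: exp_add[symmetric] of_nat_diff)
    qed simp
    then have "Ev (\<lambda>x. real (deg x w - D)) \<le> Ev (\<lambda>x. exp (- real D) * exp (real (deg x w)))"
      by (intro integral_mono) auto
    also have "\<dots> \<le> exp (- real D) * exp (4 * C)" using Ev_exp_deg[OF w] by simp
    finally show "Ev (\<lambda>x. real (deg x w - D)) \<le> exp (4 * C - real D)" by (simp add: exp_add[symmetric])
  qed
  finally show ?thesis by simp
qed

lemma Ev_chain: "Ev (\<lambda>x. tally (chain_from (net x) k) n) \<le> real n * beta k"
proof -
  have "Ev (\<lambda>x. tally (chain_from (net x) k) n) = (\<Sum>t<n. Pb (\<lambda>x. chain_from (net x) k t))"
    unfolding tally_def prob_eq_expectation by (rule Bochner_Integration.integral_sum) simp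
  also have "\<dots> \<le> (\<Sum>t<n. beta k)"
    by (intro sum_mono order_trans[OF prob_imp_le Pb_expl]) (use chain_from_expl in auto)
  finally show ?thesis by simp
qed

text \<open>Mean approximation error per vertex. It becomes small by choosing \<open>k\<close>
  large, then \<open>D\<close> depending on \<open>k\<close>, then \<open>n\<close>.\<close>

definition eps0 :: "nat \<Rightarrow> nat \<Rightarrow> real" where
  "eps0 D k = beta k + ball_const D k * exp (4 * C - real D)"

lemma Ev_err: "Ev (err D k) \<le> real n * eps0 D k"
proof -
  have "Ev (err D k) = Ev (\<lambda>x. tally (chain_from (net x) k) n) + ball_const D k * Ev (excess D)"
    unfolding err_def by simp
  also have "\<dots> \<le> real n * beta k + ball_const D k * (real n * exp (4 * C - real D))"
    by (intro add_mono mult_left_mono Ev_chain Ev_excess) (simp add: ball_const_def)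
  finally show ?thesis by (simp add: eps0_def algebra_simps)
qed

lemma flip_const_pos: "0 < flip_const D k"
  by (simp add: flip_const_def)

lemma lip_unm: "T \<le> n \<Longrightarrow> lipschitz_bits EE pr (\<lambda>x. tally (av_unm (trunc D x) k) T) (flip_const D k) (C * real n)"
  using pr_bounds sum_pr trunc_flip(1) flip_const_pos[of D k] by unfold_locales auto

lemma lip_chain: "lipschitz_bits EE pr (\<lambda>x. tally (chain_from (trunc D x) k) n) (flip_const D k) (C * real n)"
  using pr_bounds sum_pr trunc_flip(2) flip_const_pos[of D k] by unfold_locales auto

lemma lip_excess: "lipschitz_bits EE pr (excess D) 2 (C * real n)"
  using pr_bounds sum_pr excess_flip by unfold_locales auto

lemma trunc_cut:
  assumes T: "T \<le> n" and B: "finite B" "B \<subseteq> EE"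
  shows "\<bar>tally (av_unm (trunc D x) k) T - tally (av_unm (trunc D (\<lambda>e. x e \<and> e \<notin> B)) k) T\<bar>
    \<le> flip_const D k * real (card {e \<in> B. x e})"
  using B
proof (induction B)
  case (insert e B)
  let ?f = "\<lambda>x. tally (av_unm (trunc D x) k) T"
  let ?y = "\<lambda>e. x e \<and> e \<notin> B" and ?z = "\<lambda>e'. x e' \<and> e' \<notin> insert e B"
  have z: "?z = ?y(e := False)" by (auto simp: fun_eq_iff)
  show ?case
  proof (cases "x e")
    case True
    then have y: "?y = ?y(e := True)" using insert.hyps by (auto simp: fun_eq_iff)
    have "\<bar>?f ?y - ?f ?z\<bar> \<le> flip_const D k"
      unfolding z by (subst y, rule trunc_flip(1)[OF T]) (use insert.prems in simp)
    moreover have "{e' \<in> insert e B. x e'} = insert e {e' \<in> B. x e'}" using True by auto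
    then have "real (card {e' \<in> insert e B. x e'}) = 1 + real (card {e' \<in> B. x e'})" using insert.hyps by simp
    ultimately show ?thesis using insert by (simp add: algebra_simps)
  next
    case False
    then have "?z = ?y" "{e' \<in> insert e B. x e'} = {e' \<in> B. x e'}" by auto
    then show ?thesis using insert by simp
  qed
qed simp

text \<open>The drift involves the random number of free vertices after the cut, the recursion its
  mean before the cut. They are compared through the truncated count: the cut costs a bounded amount
  per bit at \<open>v t\<close>, of which there are at most \<open>2 * C\<close> on average, and the
  truncated count is concentrated.\<close>

lemma Ev_abs_free:
  assumes t: "t < n"
  shows "Ev (\<lambda>x. \<bar>real (U (net (cut t x)) t) - Ev (\<lambda>x. real (U (net x) t))\<bar>) \<le>
    2 * real n * eps0 D k + 2 * C * flip_const D k + 2 * flip_const D k * exp C * sqrt (real n)"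
proof -
  let ?f = "\<lambda>x. tally (av_unm (trunc D x) k) t" and ?u = "\<lambda>x. real (U (net x) t)" and ?c = "flip_const D k"
  have n0: "0 < real n" using t by simp
  have vt: "v t \<in> V n" by (rule v_in[OF t])
  have tn: "t \<le> n" using t by simp
  interpret L: lipschitz_bits EE pr ?f ?c "C * real n" by (rule lip_unm[OF tn])
  have 1: "\<bar>?u x - ?f x\<bar> \<le> err D k x" for x by (rule U_approx[OF tn])
  \<comment> \<open>Monotonicity of \<open>err\<close> allows the error of the cut network to be
    measured at \<open>x\<close> itself.\<close>
  have 2: "\<bar>?u (cut t x) - ?f (cut t x)\<bar> \<le> err D k x" for x
    using U_approx[OF tn, of "cut t x" D k] err_mono[of "cut t x" x D k] by (auto simp: cut_def)
  have 3: "\<bar>?f x - ?f (cut t x)\<bar> \<le> ?c * real (deg x (v t))" for x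
  proof -
    let ?B = "{e \<in> EE. inc (v t) e}"
    have "inc (v t) e \<longleftrightarrow> e \<in> ?B" for e using vt bit_in_EE by (auto simp: inc_def)
    then have "cut t x = (\<lambda>e. x e \<and> e \<notin> ?B)" by (simp add: cut_def)
    moreover have "{e \<in> ?B. x e} = {e \<in> EE. x e \<and> inc (v t) e}" by auto
    ultimately show ?thesis using trunc_cut[OF tn, of ?B D x k] by (simp add: deg_def)
  qed
  have 4: "\<bar>L.m - Ev ?u\<bar> \<le> Ev (err D k)"
    by (rule abs_Ev_diff_le) (use 1 in \<open>simp add: abs_minus_commute\<close>)
  have 5: "Ev (\<lambda>x. \<bar>?f x - L.m\<bar>) \<le> 2 * ?c * exp C * sqrt (real n)"
  proof -
    \<comment> \<open>With this choice the exponent in \<open>abs_dev\<close> is the constant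
      \<open>C\<close> and the prefactor is of order \<open>sqrt n\<close>.\<close>
    define \<theta> where "\<theta> = 1 / (?c * sqrt (real n))"
    have \<theta>: "0 < \<theta>" using n0 flip_const_pos by (simp add: \<theta>_def)
    have n1: "1 \<le> real n" using t by simp
    have "\<theta> * ?c = 1 / sqrt (real n)" using flip_const_pos[of D k] by (simp add: \<theta>_def)
    also have "\<dots> \<le> 1" using n1 by simp
    finally have "Ev (\<lambda>x. \<bar>?f x - L.m\<bar>) \<le> 2 / \<theta> * exp (\<theta>\<^sup>2 * ?c\<^sup>2 * (C * real n))"
      by (rule L.abs_dev[OF \<theta>])
    also have "\<theta>\<^sup>2 * ?c\<^sup>2 * (C * real n) = C"
      using n0 flip_const_pos[of D k] by (simp add: \<theta>_def power_mult_distrib power_divide)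
    also have "2 / \<theta> = 2 * ?c * sqrt (real n)" by (simp add: \<theta>_def)
    finally show ?thesis by (simp add: algebra_simps)
  qed
  have "Ev (\<lambda>x. \<bar>?u (cut t x) - Ev ?u\<bar>) \<le>
      Ev (\<lambda>x. err D k x + ?c * real (deg x (v t)) + \<bar>?f x - L.m\<bar> + Ev (err D k))"
  proof (intro integral_mono)
    fix x
    show "\<bar>?u (cut t x) - Ev ?u\<bar> \<le> err D k x + ?c * real (deg x (v t)) + \<bar>?f x - L.m\<bar> + Ev (err D k)"
      using 2[of x] 3[of x] 4 by linarith
  qed auto
  also have "\<dots> = Ev (err D k) + ?c * Ev (\<lambda>x. real (deg x (v t))) + Ev (\<lambda>x. \<bar>?f x - L.m\<bar>) + Ev (err D k)"
    by simp
  also have "\<dots> \<le> real n * eps0 D k + ?c * (2 * C) + 2 * ?c * exp C * sqrt (real n) + real n * eps0 D k"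
    using flip_const_pos[of D k] by (intro add_mono mult_left_mono Ev_err Ev_deg[OF vt] 5) auto
  finally show ?thesis by (simp add: algebra_simps)
qed

definition step_err :: "real \<Rightarrow> nat \<Rightarrow> nat \<Rightarrow> real" where
  "step_err lam D k = beta k + C / real n + \<bar>real n * p - lam\<bar> + lam\<^sup>2 / real n +
     lam * (2 * eps0 D k + 2 * C * flip_const D k / real n + 2 * flip_const D k * exp C / sqrt (real n))"

text \<open>\<open>v t\<close> is unmatched with nearly its cavity probability, up to
  \<open>beta k\<close>. In that probability the power of \<open>1 - p\<close> is replaced by an
  exponential with rate \<open>lam / n\<close>, and the random number of free vertices by its
  mean.\<close>

lemma drift:
  assumes t: "t < n" and lam: "0 \<le> lam" "lam \<le> real n"
  defines "l \<equiv> \<lambda>t. real n - real t + Ev (\<lambda>x. real (U (net x) t))"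
  shows "\<bar>l (Suc t) - l t + 1 - exp (- (lam / real n * l t))\<bar> \<le> step_err lam D k"
proof -
  have n0: "0 < real n" using t by simp
  define h where "h = lam / real n"
  have h: "0 \<le> h" "h \<le> 1" using lam n0 by (auto simp: h_def)
  let ?L = "\<lambda>x. avail (net (cut t x)) t"
  have cardL: "real (card (?L x)) = real n - real t + real (U (net (cut t x)) t)" for x
    using card_avail[of "net (cut t x)" t] by linarith
  have "l (Suc t) - l t + 1 = Pb (\<lambda>x. unm (net x) t)"
  proof -
    have "real (U (net x) (Suc t)) = real (U (net x) t) + of_bool (unm (net x) t)" for x by (simp add: U_Suc)
    then show ?thesis unfolding l_def prob_eq_expectation by simp
  qed
  moreover have "\<bar>Pb (\<lambda>x. unm (net x) t) - Pb (cav_unm t)\<bar> \<le> beta k"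
  proof -
    have "\<bar>Pb (\<lambda>x. unm (net x) t) - Pb (cav_unm t)\<bar> \<le> Pb (expl k t)" unfolding prob_eq_expectation
    proof (rule abs_Ev_diff_le)
      fix x
      show "\<bar>of_bool (unm (net x) t) - of_bool (cav_unm t x)\<bar> \<le> (of_bool (expl k t x) :: real)"
        using cav_unm_expl[OF t, of x k] by (auto simp: of_bool_def)
    qed
    then show ?thesis using Pb_expl[OF t, of k] by simp
  qed
  moreover have "\<bar>Pb (cav_unm t) - exp (- (h * l t))\<bar> \<le>
      C / real n + \<bar>real n * p - lam\<bar> + lam\<^sup>2 / real n +
      h * (2 * real n * eps0 D k + 2 * C * flip_const D k + 2 * flip_const D k * exp C * sqrt (real n))"
  proof -
    have "\<bar>(1 - p) ^ card (?L x - {v t}) - exp (- (h * l t))\<bar> \<le> C / real n + \<bar>real n * p - lam\<bar> + lam\<^sup>2 / real n +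
        h * \<bar>real (U (net (cut t x)) t) - Ev (\<lambda>x. real (U (net x) t))\<bar>" for x
    proof -
      let ?m = "card (?L x)"
      have mn: "real ?m \<le> real n"
        using card_mono[OF finite_V avail_subset[of "net (cut t x)" t]] by simp
      \<comment> \<open>Whether the left copy of \<open>v t\<close> is counted among the free
        vertices changes the power by at most \<open>p\<close>.\<close>
      have a: "\<bar>(1 - p) ^ card (?L x - {v t}) - (1 - p) ^ ?m\<bar> \<le> p"
      proof (cases "v t \<in> ?L x")
        case True
        then have "?m = Suc (card (?L x - {v t}))" by (simp only: card_Suc_Diff1 finite_avail)
        then have "(1 - p) ^ card (?L x - {v t}) - (1 - p) ^ ?m = p * (1 - p) ^ card (?L x - {v t})"
          by (simp add: algebra_simps)
        moreover have "(1 - p) ^ card (?L x - {v t}) \<le> 1" "0 \<le> (1 - p) ^ card (?L x - {v t})"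
          using p0 p1 by (auto intro!: power_le_one)
        ultimately show ?thesis using p0 mult_left_mono[of _ 1 p] by (simp add: abs_mult)
      qed (use p0 in simp)
      have b: "\<bar>(1 - p) ^ ?m - exp (- h) ^ ?m\<bar> \<le> \<bar>real n * p - lam\<bar> + lam\<^sup>2 / real n"
      proof -
        have "norm ((1 - p) ^ ?m - exp (- h) ^ ?m) \<le> real ?m * norm ((1 - p) - exp (- h))"
          using h p0 p1 by (intro norm_power_diff) auto
        also have "\<dots> \<le> real n * norm ((1 - p) - exp (- h))" by (rule mult_right_mono[OF mn]) simp
        also have "norm ((1 - p) - exp (- h)) \<le> \<bar>p - h\<bar> + h\<^sup>2"
        proof -
          have "exp (- h) \<le> 1 + - h + (- h)\<^sup>2" using h by (intro exp_le_quadratic) simp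
          moreover have "1 + - h \<le> exp (- h)" by (rule exp_ge_add_one_self)
          ultimately show ?thesis unfolding real_norm_def by (simp add: abs_le_iff) linarith
        qed
        also have "real n * (\<bar>p - h\<bar> + h\<^sup>2) = \<bar>real n * (p - h)\<bar> + lam\<^sup>2 / real n"
        proof -
          have "real n * \<bar>p - h\<bar> = \<bar>real n * (p - h)\<bar>" using n0 by (simp add: abs_mult)
          moreover have "real n * h\<^sup>2 = lam\<^sup>2 / real n" using n0 by (simp add: h_def power_divide power2_eq_square)
          ultimately show ?thesis by (simp add: distrib_left)
        qed
        also have "real n * (p - h) = real n * p - lam" using n0 by (simp add: h_def algebra_simps)
        finally show ?thesis by (simp add: mult_left_mono)
      qed
      \<comment> \<open>\<open>exp (- y)\<close> is Lipschitz with constant 1 for nonnegative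
        \<open>y\<close>, so this error is linear in the deviation of the number of free
        vertices.\<close>
      have c: "\<bar>exp (- h) ^ ?m - exp (- (h * l t))\<bar> \<le> h * \<bar>real ?m - l t\<bar>"
      proof -
        have lip: "exp (- y) - exp (- z) \<le> \<bar>y - z\<bar>" if "0 \<le> y" for y z :: real
        proof -
          have "exp (- y) - exp (- z) = exp (- y) * (1 - exp (y - z))"
            by (simp add: algebra_simps exp_add[symmetric])
          also have "\<dots> \<le> exp (- y) * \<bar>y - z\<bar>"
          proof (rule mult_left_mono)
            show "1 - exp (y - z) \<le> \<bar>y - z\<bar>" using exp_ge_add_one_self[of "y - z"] by linarith
          qed simp
          also have "\<dots> \<le> 1 * \<bar>y - z\<bar>" using that by (intro mult_right_mono) auto
          finally show ?thesis by simp
        qed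
        have "0 \<le> l t" using t by (simp add: l_def add_nonneg_nonneg)
        then have "exp (- (h * real ?m)) - exp (- (h * l t)) \<le> \<bar>h * real ?m - h * l t\<bar>"
          "exp (- (h * l t)) - exp (- (h * real ?m)) \<le> \<bar>h * l t - h * real ?m\<bar>"
          using h by (auto intro!: lip)
        moreover have "exp (- h) ^ ?m = exp (- (h * real ?m))"
          by (simp add: exp_of_nat_mult[symmetric] mult.commute)
        moreover have "\<bar>h * real ?m - h * l t\<bar> = h * \<bar>real ?m - l t\<bar>"
          using h by (simp add: abs_mult right_diff_distrib[symmetric])
        ultimately show ?thesis by (simp add: abs_le_iff abs_minus_commute)
      qed
      have eqm: "real ?m - l t = real (U (net (cut t x)) t) - Ev (\<lambda>x. real (U (net x) t))"
        by (simp add: cardL l_def)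
      have "p \<le> C / real n" using pC n0 by (simp add: field_simps)
      then show ?thesis using a b c[unfolded eqm] by linarith
    qed note pt = this
    have "\<bar>Pb (cav_unm t) - Ev (\<lambda>_. exp (- (h * l t)))\<bar> \<le>
        Ev (\<lambda>x. C / real n + \<bar>real n * p - lam\<bar> + lam\<^sup>2 / real n +
        h * \<bar>real (U (net (cut t x)) t) - Ev (\<lambda>x. real (U (net x) t))\<bar>)"
      unfolding Pb_cav_unm[OF t] by (rule abs_Ev_diff_le) (rule pt)
    also have "\<dots> = C / real n + \<bar>real n * p - lam\<bar> + lam\<^sup>2 / real n +
        h * Ev (\<lambda>x. \<bar>real (U (net (cut t x)) t) - Ev (\<lambda>x. real (U (net x) t))\<bar>)" by simp
    also have "\<dots> \<le> C / real n + \<bar>real n * p - lam\<bar> + lam\<^sup>2 / real n +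
      h * (2 * real n * eps0 D k + 2 * C * flip_const D k + 2 * flip_const D k * exp C * sqrt (real n))"
      using h by (intro add_left_mono mult_left_mono Ev_abs_free[OF t]) auto
    finally show ?thesis by simp
  qed
  moreover have "h * (2 * real n * eps0 D k + 2 * C * flip_const D k + 2 * flip_const D k * exp C * sqrt (real n)) =
      lam * (2 * eps0 D k + 2 * C * flip_const D k / real n + 2 * flip_const D k * exp C / sqrt (real n))"
  proof -
    have "sqrt (real n) / real n = 1 / sqrt (real n)" using n0 by (simp add: real_div_sqrt field_simps)
    then have "2 * flip_const D k * exp C * sqrt (real n) / real n = 2 * flip_const D k * exp C / sqrt (real n)"
      by (metis mult.right_neutral times_divide_eq_right)
    then have "(2 * real n * eps0 D k + 2 * C * flip_const D k + 2 * flip_const D k * exp C * sqrt (real n)) / real n =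
        2 * eps0 D k + 2 * C * flip_const D k / real n + 2 * flip_const D k * exp C / sqrt (real n)"
      using n0 by (simp add: add_divide_distrib)
    moreover have "h * X = lam * (X / real n)" for X by (simp add: h_def)
    ultimately show ?thesis by (simp only:)
  qed
  ultimately show ?thesis unfolding step_err_def h_def by linarith
qed

lemma Ev_U_limit:
  assumes "0 < n" "0 \<le> lam" "lam \<le> real n"
  shows "\<bar>Ev (\<lambda>x. real (U (net x) n)) / real n - free_limit lam\<bar> \<le>
    exp lam * (step_err lam D k + 2 * lam / real n)"
proof -
  define l where "l = (\<lambda>t. real n - real t + Ev (\<lambda>x. real (U (net x) t)))"
  have U0: "0 \<le> Ev (\<lambda>x. real (U (net x) t))" for t by simp
  have Ut: "Ev (\<lambda>x. real (U (net x) t)) \<le> real t" for t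
  proof -
    have "Ev (\<lambda>x. real (U (net x) t)) \<le> Ev (\<lambda>x. real t)" using U_le by (intro integral_mono) auto
    then show ?thesis by simp
  qed
  have inc: "Ev (\<lambda>x. real (U (net x) t)) \<le> Ev (\<lambda>x. real (U (net x) (Suc t)))"
    "Ev (\<lambda>x. real (U (net x) (Suc t))) \<le> Ev (\<lambda>x. real (U (net x) t)) + 1" for t
  proof -
    show "Ev (\<lambda>x. real (U (net x) t)) \<le> Ev (\<lambda>x. real (U (net x) (Suc t)))"
      by (intro integral_mono) (auto simp: U_Suc)
    have "Ev (\<lambda>x. real (U (net x) (Suc t))) \<le> Ev (\<lambda>x. real (U (net x) t) + 1)"
      by (intro integral_mono) (auto simp: U_Suc)
    then show "Ev (\<lambda>x. real (U (net x) (Suc t))) \<le> Ev (\<lambda>x. real (U (net x) t)) + 1" by simp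
  qed
  have se: "\<bar>l (Suc t) - l t + 1 - exp (- (lam / real n * l t))\<bar> \<le> step_err lam D k" if "t < n" for t
    unfolding l_def by (rule drift[OF that assms(2,3)])
  have "\<bar>l n / real n - free_limit lam\<bar> \<le> exp lam * (step_err lam D k + 2 * lam / real n)"
  proof (rule free_limit_recursion[OF assms(1,3,2)])
    show "l 0 = real n" by (simp add: l_def)
    show "0 \<le> step_err lam D k" using se[OF assms(1)] by linarith
    show "0 \<le> l t \<and> l t \<le> real n" if "t \<le> n" for t using that U0[of t] Ut[of t] unfolding l_def by simp
    show "\<bar>l (Suc t) - l t\<bar> \<le> 1" for t using inc[of t] unfolding l_def by simp
  qed (use se in auto)
  then show ?thesis by (simp add: l_def)
qed

text \<open>Concentration is applied to the three Lipschitz functions: the truncated count, the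
  truncated number of chains, and the excess. The excess enters with weight
  \<open>2 * ball_const D k\<close>, so it may deviate only by \<open>z\<close> divided by that
  weight; hence its separate parameter \<open>\<theta>'\<close>.\<close>

lemma U_tail:
  assumes z: "0 < z" "eps0 D k \<le> z" and th: "0 < \<theta>" "\<theta> * flip_const D k \<le> 1" "\<theta> * (flip_const D k)\<^sup>2 * C \<le> z / 2"
    and th': "0 < \<theta>'" "\<theta>' * 2 \<le> 1" "\<theta>' * 4 * C \<le> z / (2 * ball_const D k) / 2"
  shows "Pb (\<lambda>x. \<bar>real (U (net x) n) - Ev (\<lambda>x. real (U (net x) n))\<bar> \<ge> 6 * z * real n) \<le>
    3 * exp (- (\<theta> * z / 2) * real n) + exp (- (\<theta>' * (z / (2 * ball_const D k)) / 2) * real n)"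
proof -
  let ?f = "\<lambda>x. tally (av_unm (trunc D x) k) n" and ?u = "\<lambda>x. real (U (net x) n)" and ?c = "flip_const D k"
  let ?g = "\<lambda>x. tally (chain_from (trunc D x) k) n" and ?b = "ball_const D k"
  define y where "y = z / (2 * ?b)"
  have b: "0 < ?b" by (simp add: ball_const_def)
  have y: "2 * ?b * y = z" using b by (simp add: y_def)
  interpret F: lipschitz_bits EE pr ?f ?c "C * real n" by (rule lip_unm) simp
  interpret H: lipschitz_bits EE pr ?g ?c "C * real n" by (rule lip_chain)
  interpret X: lipschitz_bits EE pr "excess D" 2 "C * real n" by (rule lip_excess)
  have 1: "\<bar>?u x - ?f x\<bar> \<le> err D k x" for x by (rule U_approx) simp
  have 2: "\<bar>F.m - Ev ?u\<bar> \<le> Ev (err D k)"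
    by (rule abs_Ev_diff_le) (use 1 in \<open>simp add: abs_minus_commute\<close>)
  have 3: "H.m \<le> real n * beta k"
  proof -
    have "H.m \<le> Ev (\<lambda>x. tally (chain_from (net x) k) n)"
    proof (rule integral_mono)
      fix x
      show "?g x \<le> tally (chain_from (net x) k) n"
        by (rule tally_mono) (rule chain_from_mono[OF trunc_subset])
    qed auto
    then show ?thesis using Ev_chain[of k] by simp
  qed
  \<comment> \<open>The means contribute \<open>3 * z * real n\<close>. Each of the three deviations
    contributes another \<open>z * real n\<close>, which accounts for the factor 6.\<close>
  have 4: "H.m + 2 * ?b * X.m + Ev (err D k) \<le> 3 * z * real n"
  proof -
    have "2 * ?b * X.m \<le> 2 * ?b * (real n * exp (4 * C - real D))" using b by (intro mult_left_mono Ev_excess) auto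
    moreover have "0 \<le> beta k" using C0 rem_nonneg[of 2 k] by (simp add: beta_def)
    then have "0 \<le> real n * beta k" by simp
    ultimately have "H.m + 2 * ?b * X.m + Ev (err D k) \<le> 3 * (real n * eps0 D k)"
      using 3 Ev_err[of D k] by (simp add: eps0_def algebra_simps)
    also have "\<dots> \<le> 3 * (real n * z)" using z by (intro mult_left_mono) auto
    finally show ?thesis by (simp add: mult_ac)
  qed
  have "Pb (\<lambda>x. \<bar>?u x - Ev ?u\<bar> \<ge> 6 * z * real n) \<le>
      Pb (\<lambda>x. \<bar>?f x - F.m\<bar> \<ge> z * real n \<or> (?g x - H.m \<ge> z * real n \<or> excess D x - X.m \<ge> y * real n))"
  proof (rule prob_imp_le, rule ccontr)
    fix x
    assume big: "6 * z * real n \<le> \<bar>?u x - Ev ?u\<bar>"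
      and no: "\<not> (\<bar>?f x - F.m\<bar> \<ge> z * real n \<or> (?g x - H.m \<ge> z * real n \<or> excess D x - X.m \<ge> y * real n))"
    have "2 * ?b * excess D x \<le> 2 * ?b * (X.m + y * real n)" using no b by (intro mult_left_mono) auto
    also have "\<dots> = 2 * ?b * X.m + z * real n" using y by (simp add: algebra_simps)
    finally show False using big no 1[of x] 2 err_le[of D k x] 4 by linarith
  qed
  also have "\<dots> \<le> Pb (\<lambda>x. \<bar>?f x - F.m\<bar> \<ge> z * real n) +
      (Pb (\<lambda>x. ?g x - H.m \<ge> z * real n) + Pb (\<lambda>x. excess D x - X.m \<ge> y * real n))"
    by (intro order_trans[OF prob_disj_le] add_left_mono prob_disj_le)
  also have "\<dots> \<le> 2 * exp (\<theta>\<^sup>2 * ?c\<^sup>2 * (C * real n) - \<theta> * (z * real n)) +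
      (exp (\<theta>\<^sup>2 * ?c\<^sup>2 * (C * real n) - \<theta> * (z * real n)) +
       exp (\<theta>'\<^sup>2 * 2\<^sup>2 * (C * real n) - \<theta>' * (y * real n)))"
    by (intro add_mono F.abs_tail H.upper_tail X.upper_tail th th')
  also have "\<dots> \<le> 2 * exp (- (\<theta> * z / 2) * real n) + (exp (- (\<theta> * z / 2) * real n) +
      exp (- (\<theta>' * y / 2) * real n))"
  proof -
    have "\<theta>\<^sup>2 * ?c\<^sup>2 * (C * real n) - \<theta> * (z * real n) \<le> - (\<theta> * z / 2) * real n"
      using mult_left_mono[OF th(3), of "\<theta> * real n"] th(1) by (simp add: algebra_simps power2_eq_square)
    moreover have "\<theta>'\<^sup>2 * 2\<^sup>2 * (C * real n) - \<theta>' * (y * real n) \<le> - (\<theta>' * y / 2) * real n"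
      using mult_left_mono[OF th'(3)[folded y_def], of "\<theta>' * real n"] th'(1)
      by (simp add: algebra_simps power2_eq_square)
    ultimately show ?thesis by (intro add_mono mult_left_mono) auto
  qed
  finally show ?thesis by (simp add: y_def)
qed

end

section \<open>Deviation bounds for networks of independent bits\<close>

definition bit_net :: "nat \<Rightarrow> (nat \<times> nat \<Rightarrow> 'e) \<Rightarrow> real \<Rightarrow> real \<Rightarrow> network pmf" where
  "bit_net n bt p q = map_pmf (\<lambda>x. {(i, j). i \<in> V n \<and> j \<in> V n \<and> x (bt (i, j))})
     (bprod (bt ` (V n \<times> V n)) (\<lambda>e. if \<exists>i\<in>V n. e = bt (i, i) then q else p))"

definition bit_ok :: "nat \<Rightarrow> (nat \<times> nat \<Rightarrow> 'e) \<Rightarrow> bool" where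
  "bit_ok n bt \<longleftrightarrow> (\<forall>i j k l. {i, j, k, l} \<subseteq> V n \<longrightarrow> bt (i, j) = bt (k, l) \<longrightarrow> {i, j} = {k, l})"

lemma bits_rule: "valid_rule S \<Longrightarrow> bit_ok n bt \<Longrightarrow> bits n (vert S n) (snd S) bt"
proof (intro bits.intro run_rule bits_axioms.intro)
  fix i j k l
  assume "bit_ok n bt" and ijkl: "{i, j, k, l} \<subseteq> V n" "bt (i, j) = bt (k, l)"
  then have "\<forall>i j k l. {i, j, k, l} \<subseteq> V n \<longrightarrow> bt (i, j) = bt (k, l) \<longrightarrow> {i, j} = {k, l}"
    by (simp only: bit_ok_def)
  from this[rule_format, OF ijkl] show "{i, j} = {k, l}" .
qed

lemma tendsto_power_exp_shift: "(\<lambda>D. (real D + 2) ^ m * exp (a - real D)) \<longlonglongrightarrow> 0"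
proof -
  have "((\<lambda>x::real. x ^ m / exp x) \<longlongrightarrow> 0) at_top" by (rule tendsto_power_div_exp_0)
  moreover have "filterlim (\<lambda>D. real D + 2) at_top sequentially"
    by (subst add.commute) (rule filterlim_tendsto_add_at_top[OF tendsto_const filterlim_real_sequentially])
  ultimately have "(\<lambda>D. (real D + 2) ^ m / exp (real D + 2)) \<longlonglongrightarrow> 0" by (rule filterlim_compose)
  then have "(\<lambda>D. exp (a + 2) * ((real D + 2) ^ m / exp (real D + 2))) \<longlonglongrightarrow> exp (a + 2) * 0"
    by (rule tendsto_mult_left)
  moreover have "exp (a + 2) * ((real D + 2) ^ m / exp (real D + 2)) = (real D + 2) ^ m * exp (a - real D)" for D
    by (simp add: exp_add exp_diff field_simps)
  ultimately show ?thesis by simp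
qed

lemma eventually_div_le:
  assumes "0 < e"
  shows "eventually (\<lambda>n. c / real n \<le> e) sequentially" "eventually (\<lambda>n. c / sqrt (real n) \<le> e) sequentially"
proof -
  have "(\<lambda>n. c / real n) \<longlonglongrightarrow> 0" by (rule lim_const_over_n)
  then have "eventually (\<lambda>n. c / real n < e) sequentially" using assms by (rule order_tendstoD)
  then show "eventually (\<lambda>n. c / real n \<le> e) sequentially" by eventually_elim simp
  have "filterlim (\<lambda>n. sqrt (real n)) at_top sequentially"
    by (intro filterlim_compose[OF sqrt_at_top] filterlim_real_sequentially)
  then have "(\<lambda>n. c / sqrt (real n)) \<longlonglongrightarrow> 0"
    by (rule real_tendsto_divide_at_top[OF tendsto_const])
  then have "eventually (\<lambda>n. c / sqrt (real n) < e) sequentially" using assms by (rule order_tendstoD)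
  then show "eventually (\<lambda>n. c / sqrt (real n) \<le> e) sequentially" by eventually_elim simp
qed

text \<open>All constants depend on \<open>lam\<close> and \<open>eps\<close> only: \<open>k\<close>
  is chosen for \<open>lam\<close>, \<open>D\<close> for \<open>k\<close>, the exponents for both,
  and \<open>n0\<close> last. So the bound is uniform in the rule and in \<open>p\<close> near
  \<open>lam / n\<close>, and may be used when \<open>p\<close> varies with \<open>n\<close> or
  comes from a random number of edges.\<close>

theorem bit_net_greedy:
  fixes lam eps :: real
  assumes lam: "0 \<le> lam" and eps: "0 < eps"
  shows "\<exists>\<delta>>0. \<exists>\<gamma>>0. \<exists>n0. \<forall>n\<ge>n0. \<forall>S p q (bt :: nat \<times> nat \<Rightarrow> 'e).
    valid_rule S \<longrightarrow> bit_ok n bt \<longrightarrow> 0 \<le> q \<longrightarrow> q \<le> p \<longrightarrow> p \<le> 1 \<longrightarrow> \<bar>real n * p - lam\<bar> < \<delta> \<longrightarrow>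
    measure_pmf.prob (bit_net n bt p q)
      {G. \<bar>real (card (greedy_matching S n G)) / real n - (1 - free_limit lam)\<bar> > eps} \<le> 4 * exp (- \<gamma> * real n)"
proof -
  define C where "C = lam + 1"
  have C1: "1 \<le> C" using lam by (simp add: C_def)
  \<comment> \<open>The fluctuation is at most \<open>6 * z = eps / 3\<close>, less than the
    \<open>eps / 2\<close> that remains after the error of the mean.\<close>
  define z where "z = eps / 18"
  have z: "0 < z" using eps by (simp add: z_def)
  \<comment> \<open>The first bound gives \<open>eps0\<close> \<le> \<open>3 * e1\<close> \<le>
    \<open>z\<close>. The second keeps the error of the mean below \<open>eps / 2\<close>; the
    factor \<open>10 + 10 * lam\<close> generously bounds the number of error terms.\<close>
  define e1 where "e1 = min (z / 3) (eps / (2 * exp lam * (10 + 10 * lam)))"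
  have e1: "0 < e1" "e1 \<le> z / 3" using z eps lam by (auto simp: e1_def)
  have e1': "exp lam * (e1 * (10 + 10 * lam)) \<le> eps / 2"
  proof -
    have "e1 \<le> eps / (2 * exp lam * (10 + 10 * lam))" by (simp add: e1_def)
    moreover have "0 < 2 * exp lam * (10 + 10 * lam)" using lam by simp
    ultimately have "e1 * (2 * exp lam * (10 + 10 * lam)) \<le> eps" by (simp add: pos_le_divide_eq)
    then show ?thesis by (simp add: algebra_simps)
  qed
  have "(\<lambda>k. inverse (fact k) * (C\<^sup>2) ^ k) \<longlonglongrightarrow> 0" by (rule summable_LIMSEQ_zero[OF summable_exp])
  then have "(\<lambda>k. C * (inverse (fact k) * (C\<^sup>2) ^ k)) \<longlonglongrightarrow> C * 0" by (rule tendsto_mult_left)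
  then have "eventually (\<lambda>k. C * (inverse (fact k) * (C\<^sup>2) ^ k) < e1) sequentially"
    using e1 by (intro order_tendstoD) auto
  then obtain k where k0: "C * (inverse (fact k) * (C\<^sup>2) ^ k) < e1"
    using eventually_happens trivial_limit_sequentially by blast
  have k: "C * (C ^ (2 * k) / fact k) \<le> e1" using k0 by (simp add: power_mult[symmetric] field_simps)
  have "eventually (\<lambda>D. (real D + 2) ^ (2 * k + 3) * exp (4 * C - real D) < e1) sequentially"
    using tendsto_power_exp_shift e1 by (intro order_tendstoD) auto
  then obtain D where "(real D + 2) ^ (2 * k + 3) * exp (4 * C - real D) < e1"
    using eventually_happens trivial_limit_sequentially by blast
  then have D: "ball_const D k * exp (4 * C - real D) \<le> e1" by (simp add: ball_const_def)
  let ?c = "flip_const D k" and ?b = "ball_const D k"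
  have c: "0 < ?c" and b: "0 < ?b" by (auto simp: flip_const_def ball_const_def)
  define \<theta> where "\<theta> = min (1 / ?c) (z / (2 * ?c\<^sup>2 * C))"
  define y where "y = z / (2 * ?b)"
  define \<theta>' where "\<theta>' = min (1 / 2) (y / (8 * C))"
  have y: "0 < y" using z b by (simp add: y_def)
  have th: "0 < \<theta>" "\<theta> * ?c \<le> 1" "\<theta> * ?c\<^sup>2 * C \<le> z / 2"
  proof -
    show "0 < \<theta>" using c z C1 by (simp add: \<theta>_def)
    have "\<theta> \<le> 1 / ?c" by (simp add: \<theta>_def)
    then show "\<theta> * ?c \<le> 1" using c by (simp add: pos_le_divide_eq)
    have "\<theta> \<le> z / (2 * ?c\<^sup>2 * C)" by (simp add: \<theta>_def)
    then have "\<theta> * (2 * ?c\<^sup>2 * C) \<le> z" using c C1 by (subst (asm) pos_le_divide_eq) auto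
    then show "\<theta> * ?c\<^sup>2 * C \<le> z / 2" by (simp add: algebra_simps)
  qed
  have th': "0 < \<theta>'" "\<theta>' * 2 \<le> 1" "\<theta>' * 4 * C \<le> y / 2"
  proof -
    show "0 < \<theta>'" using y C1 by (simp add: \<theta>'_def)
    show "\<theta>' * 2 \<le> 1" by (simp add: \<theta>'_def)
    have "\<theta>' \<le> y / (8 * C)" by (simp add: \<theta>'_def)
    then have "\<theta>' * (8 * C) \<le> y" using C1 by (subst (asm) pos_le_divide_eq) auto
    then show "\<theta>' * 4 * C \<le> y / 2" by (simp add: algebra_simps)
  qed
  define \<gamma> where "\<gamma> = min (\<theta> * z / 2) (\<theta>' * y / 2)"
  have \<gamma>: "0 < \<gamma>" using th th' z y by (simp add: \<gamma>_def)
  define \<delta> where "\<delta> = min e1 1"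
  have \<delta>: "0 < \<delta>" using e1 by (simp add: \<delta>_def)
  have "eventually (\<lambda>n. (C + C * rem_const C k 2) / real n \<le> e1 \<and> C / real n \<le> e1 \<and> lam\<^sup>2 / real n \<le> e1 \<and>
      2 * C * ?c / real n \<le> e1 \<and> 2 * ?c * exp C / sqrt (real n) \<le> e1 \<and> 2 * lam / real n \<le> e1 \<and>
      nat \<lceil>lam\<rceil> + 1 \<le> n) sequentially"
    by (intro eventually_conj eventually_div_le e1 eventually_ge_at_top)
  then obtain n0 where n0: "\<forall>n\<ge>n0. (C + C * rem_const C k 2) / real n \<le> e1 \<and> C / real n \<le> e1 \<and> lam\<^sup>2 / real n \<le> e1 \<and>
      2 * C * ?c / real n \<le> e1 \<and> 2 * ?c * exp C / sqrt (real n) \<le> e1 \<and> 2 * lam / real n \<le> e1 \<and>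
      nat \<lceil>lam\<rceil> + 1 \<le> n" unfolding eventually_sequentially by blast
  have "measure_pmf.prob (bit_net n bt p q)
      {G. \<bar>real (card (greedy_matching S n G)) / real n - (1 - free_limit lam)\<bar> > eps} \<le> 4 * exp (- \<gamma> * real n)"
    if n: "n \<ge> n0" and S: "valid_rule S" and bt: "bit_ok n bt" and q: "0 \<le> q" "q \<le> p" "p \<le> 1"
      and p: "\<bar>real n * p - lam\<bar> < \<delta>" for n S p q and bt :: "nat \<times> nat \<Rightarrow> 'e"
  proof -
    have N: "(C + C * rem_const C k 2) / real n \<le> e1" "C / real n \<le> e1" "lam\<^sup>2 / real n \<le> e1"
      "2 * C * ?c / real n \<le> e1" "2 * ?c * exp C / sqrt (real n) \<le> e1" "2 * lam / real n \<le> e1"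
      "nat \<lceil>lam\<rceil> + 1 \<le> n" using n0 n by auto
    have npos: "0 < n" using N(7) by simp
    have lamn: "lam \<le> real n" using N(7) lam by linarith
    have "real n * p \<le> C" using p unfolding C_def \<delta>_def by linarith
    then interpret R: rbits n "vert S n" "snd S" bt p q C
      using q bits_rule[OF S bt] by (intro rbits.intro rbits_axioms.intro) auto
    have beta: "R.beta k \<le> 2 * e1"
    proof -
      have "R.beta k = (C + C * rem_const C k 2) / real n + C * (C ^ (2 * k) / fact k)"
        by (simp add: R.beta_def algebra_simps add_divide_distrib)
      then show ?thesis using N(1) k by simp
    qed
    have eps0: "R.eps0 D k \<le> 3 * e1" using beta D by (simp add: R.eps0_def)
    have "lam * (2 * R.eps0 D k + 2 * C * ?c / real n + 2 * ?c * exp C / sqrt (real n)) \<le> lam * (8 * e1)"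
      using eps0 N by (intro mult_left_mono lam) linarith
    moreover have "\<bar>real n * p - lam\<bar> \<le> e1" using p unfolding \<delta>_def by linarith
    ultimately have "R.step_err lam D k \<le> 5 * e1 + lam * (8 * e1)"
      unfolding R.step_err_def using beta N by linarith
    moreover have "0 \<le> e1 * lam" using e1 lam by simp
    moreover have "e1 * (10 + 10 * lam) = 10 * e1 + 10 * (e1 * lam)" "lam * (8 * e1) = 8 * (e1 * lam)"
      by (auto simp: algebra_simps)
    ultimately have se: "R.step_err lam D k + 2 * lam / real n \<le> e1 * (10 + 10 * lam)"
      using N(6) e1(1) by linarith
    have mean: "\<bar>R.Ev (\<lambda>x. real (R.U (R.net x) n)) / real n - free_limit lam\<bar> \<le> eps / 2"
    proof -
      have "exp lam * (R.step_err lam D k + 2 * lam / real n) \<le> exp lam * (e1 * (10 + 10 * lam))"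
        by (rule mult_left_mono[OF se]) simp
      then show ?thesis using R.Ev_U_limit[OF npos lam lamn, of D k] e1' by linarith
    qed
    have "eps0 \<le> z" if "eps0 \<le> 3 * e1" for eps0 using that e1 by linarith
    then have tail: "R.Pb (\<lambda>x. \<bar>real (R.U (R.net x) n) - R.Ev (\<lambda>x. real (R.U (R.net x) n))\<bar> \<ge> 6 * z * real n) \<le>
        3 * exp (- (\<theta> * z / 2) * real n) + exp (- (\<theta>' * (z / (2 * ?b)) / 2) * real n)"
      using eps0 z th th' by (intro R.U_tail) (auto simp: y_def)
    have "measure_pmf.prob (bit_net n bt p q)
        {G. \<bar>real (card (greedy_matching S n G)) / real n - (1 - free_limit lam)\<bar> > eps} =
        R.Pb (\<lambda>x. \<bar>real (card (greedy_matching S n (R.net x))) / real n - (1 - free_limit lam)\<bar> > eps)"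
      unfolding bit_net_def R.net_def R.EE_def R.pr_def by (simp add: vimage_def)
    also have "\<dots> \<le> R.Pb (\<lambda>x. \<bar>real (R.U (R.net x) n) - R.Ev (\<lambda>x. real (R.U (R.net x) n))\<bar> \<ge> 6 * z * real n)"
    proof (rule prob_imp_le)
      fix x
      assume "\<bar>real (card (greedy_matching S n (R.net x))) / real n - (1 - free_limit lam)\<bar> > eps"
      moreover have "card (greedy_matching S n (R.net x)) + R.U (R.net x) n = n"
        by (rule card_greedy_matching[OF S R.net_subset])
      then have "real (card (greedy_matching S n (R.net x))) = real n - real (R.U (R.net x) n)" by linarith
      then have "real (card (greedy_matching S n (R.net x))) / real n = 1 - real (R.U (R.net x) n) / real n"
        using npos by (simp add: field_simps)
      ultimately have "\<bar>real (R.U (R.net x) n) / real n - free_limit lam\<bar> > eps" by linarith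
      then have "\<bar>real (R.U (R.net x) n) / real n - R.Ev (\<lambda>x. real (R.U (R.net x) n)) / real n\<bar> > eps / 2"
        using mean by linarith
      then have "\<bar>(real (R.U (R.net x) n) - R.Ev (\<lambda>x. real (R.U (R.net x) n))) / real n\<bar> > 6 * z"
        using eps unfolding z_def diff_divide_distrib by linarith
      then show "\<bar>real (R.U (R.net x) n) - R.Ev (\<lambda>x. real (R.U (R.net x) n))\<bar> \<ge> 6 * z * real n"
        using npos by (simp add: field_simps)
    qed
    also have "\<dots> \<le> 3 * exp (- (\<theta> * z / 2) * real n) + exp (- (\<theta>' * y / 2) * real n)"
      using tail by (simp add: y_def)
    also have "\<dots> \<le> 3 * exp (- \<gamma> * real n) + exp (- \<gamma> * real n)"
    proof -
      have "\<gamma> * real n \<le> \<theta> * z / 2 * real n" "\<gamma> * real n \<le> \<theta>' * y / 2 * real n"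
        by (intro mult_right_mono; simp add: \<gamma>_def)+
      then show ?thesis by (intro add_mono mult_left_mono) auto
    qed
    finally show ?thesis by simp
  qed
  then show ?thesis using \<delta> \<gamma> by blast
qed

text \<open>
  The Greedy matching is maximal, so the unmatched vertices form a large pair of sets without
  edges in between.
\<close>
theorem bit_net_greedy_dense:
  fixes bt :: "nat \<times> nat \<Rightarrow> 'e" and eps :: real
  assumes S: "valid_rule S" and bt: "bit_ok n bt" and q: "0 \<le> q" "q \<le> p" "p \<le> 1" and eps: "0 < eps" and n: "0 < n"
    and h: "0 \<le> h" "1 - p \<le> exp (- h)"
  shows "measure_pmf.prob (bit_net n bt p q)
      {G. \<bar>real (card (greedy_matching S n G)) / real n - 1\<bar> > eps} \<le>
    4 ^ n * exp (- (h * (eps\<^sup>2 * (real n)\<^sup>2 - real n) / 2))"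
proof -
  interpret R: rbits n "vert S n" "snd S" bt p q "real n * p"
    using q bits_rule[OF S bt] by (intro rbits.intro rbits_axioms.intro) auto
  \<comment> \<open>The subtracted \<open>real n\<close> pays for the diagonal pairs, whose bits may
    be off with probability 1.\<close>
  define a where "a = eps\<^sup>2 * (real n)\<^sup>2 - real n"
  define I where "I = {(A, B). A \<subseteq> V n \<and> B \<subseteq> V n \<and> eps * real n < real (card A) \<and> eps * real n < real (card B)}"
  have finI: "finite I" by (rule finite_subset[of _ "Pow (V n) \<times> Pow (V n)"]) (auto simp: I_def)
  have cardI: "card I \<le> 4 ^ n"
  proof -
    have "card I \<le> card (Pow (V n) \<times> Pow (V n))" by (rule card_mono) (auto simp: I_def)
    also have "\<dots> = 2 ^ n * 2 ^ n" by (simp add: card_cartesian_product card_Pow)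
    also have "\<dots> = 4 ^ n" by (simp add: power_mult_distrib[symmetric])
    finally show ?thesis .
  qed
  define W where "W = (\<lambda>(A, B). {(i, j :: nat). i \<in> A \<and> j \<in> B \<and> i \<noteq> j})"
  have single: "R.Pb (\<lambda>x. \<forall>e\<in>bt ` W P. \<not> x e) \<le> exp (- (h * a / 2))" if "P \<in> I" for P
  proof -
    obtain A B where P: "P = (A, B)" by (cases P)
    have AB: "A \<subseteq> V n" "B \<subseteq> V n" "eps * real n < real (card A)" "eps * real n < real (card B)"
      using that by (auto simp: P I_def)
    have fin: "finite A" "finite B" using AB finite_subset R.finite_V by blast+
    have finW: "finite (W P)" by (rule finite_subset[of _ "A \<times> B"]) (use fin in \<open>auto simp: W_def P\<close>)
    have "card (A \<times> B) \<le> card (W P \<union> (\<lambda>i. (i, i)) ` V n)"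
      by (rule card_mono) (use finW AB in \<open>auto simp: W_def P\<close>)
    also have "\<dots> \<le> card (W P) + card ((\<lambda>i. (i, i)) ` V n)" by (rule card_Un_le)
    also have "card ((\<lambda>i. (i, i)) ` V n) \<le> n" using card_image_le[OF R.finite_V, of "\<lambda>i. (i, i)"] by simp
    finally have c1: "real (card A) * real (card B) \<le> real (card (W P)) + real n"
      by (simp add: card_cartesian_product flip: of_nat_mult of_nat_add)
    have "eps * real n * (eps * real n) \<le> real (card A) * real (card B)"
      using AB eps by (intro mult_mono) auto
    then have aW: "a \<le> real (card (W P))" using c1 by (simp add: a_def power2_eq_square mult_ac)
    \<comment> \<open>A bit belongs to at most two ordered pairs, so at least half as many bits as
      pairs have to be off.\<close>
    have "W P \<subseteq> (\<Union>e\<in>bt ` W P. {w \<in> W P. bt w = e})" by auto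
    then have "card (W P) \<le> card (\<Union>e\<in>bt ` W P. {w \<in> W P. bt w = e})"
      by (rule card_mono[rotated]) (use finW in auto)
    also have "\<dots> \<le> (\<Sum>e\<in>bt ` W P. card {w \<in> W P. bt w = e})" using finW by (intro card_UN_le) auto
    also have "\<dots> \<le> (\<Sum>e\<in>bt ` W P. 2)"
    proof (rule sum_mono)
      fix e assume "e \<in> bt ` W P"
      then obtain i j where ij: "(i, j) \<in> W P" "e = bt (i, j)" by auto
      have "{w \<in> W P. bt w = e} \<subseteq> {(i, j), (j, i)}"
      proof
        fix w assume w: "w \<in> {w \<in> W P. bt w = e}"
        obtain k l where kl: "w = (k, l)" by (cases w)
        have "{k, l} = {i, j}" by (rule R.bit_inj) (use w kl ij AB in \<open>auto simp: W_def P\<close>)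
        then show "w \<in> {(i, j), (j, i)}" using kl by (auto simp: doubleton_eq_iff)
      qed
      then have "card {w \<in> W P. bt w = e} \<le> card {(i, j), (j, i)}" by (rule card_mono[rotated]) simp
      also have "\<dots> \<le> 2"
        using card_length[of "[(i, j), (j, i)]"]
        by (simp only: list.set list.size numeral_2_eq_2 plus_nat.simps)
      finally show "card {w \<in> W P. bt w = e} \<le> 2" .
    qed
    finally have "real (card (W P)) \<le> real (card (bt ` W P) * 2)" by (intro of_nat_mono) simp
    then have half: "a / 2 \<le> real (card (bt ` W P))" using aW by simp
    have "R.Pb (\<lambda>x. \<forall>e\<in>bt ` W P. \<not> x e) = R.Pb (\<lambda>x. (\<forall>e\<in>bt ` W P. \<not> x e) \<and> True)" by simp
    also have "\<dots> = (\<Prod>e\<in>bt ` W P. 1 - R.pr e) * R.Pb (\<lambda>x. True)"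
    proof (rule prob_bits_off)
      show "bt ` W P \<subseteq> R.EE" using AB unfolding R.EE_def W_def P by blast
    qed (use R.pr_bounds in auto)
    also have "(\<Prod>e\<in>bt ` W P. 1 - R.pr e) = (\<Prod>e\<in>bt ` W P. 1 - p)"
      by (intro prod.cong refl) (use AB R.pr_bit in \<open>auto simp: W_def P\<close>)
    also have "\<dots> * R.Pb (\<lambda>x. True) = (1 - p) ^ card (bt ` W P)" by simp
    also have "\<dots> \<le> exp (- h) ^ card (bt ` W P)"
      using q h by (intro power_mono) auto
    also have "\<dots> = exp (- (h * real (card (bt ` W P))))" by (simp add: exp_of_nat_mult[symmetric] mult.commute)
    also have "\<dots> \<le> exp (- (h * (a / 2)))" using mult_left_mono[OF half h(1)] by simp
    finally show ?thesis by simp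
  qed
  have "measure_pmf.prob (bit_net n bt p q) {G. \<bar>real (card (greedy_matching S n G)) / real n - 1\<bar> > eps} =
      R.Pb (\<lambda>x. \<bar>real (card (greedy_matching S n (R.net x))) / real n - 1\<bar> > eps)"
    unfolding bit_net_def R.net_def R.EE_def R.pr_def by (simp add: vimage_def)
  also have "\<dots> \<le> R.Pb (\<lambda>x. \<exists>P\<in>I. \<forall>e\<in>bt ` W P. \<not> x e)"
  proof (rule prob_imp_le)
    fix x
    assume big: "\<bar>real (card (greedy_matching S n (R.net x))) / real n - 1\<bar> > eps"
    let ?U = "R.U (R.net x) n"
    have "card (greedy_matching S n (R.net x)) + ?U = n"
      by (rule card_greedy_matching[OF S R.net_subset])
    then have "real (card (greedy_matching S n (R.net x))) = real n - real ?U" by linarith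
    then have "real (card (greedy_matching S n (R.net x))) / real n - 1 = - (real ?U / real n)"
      using n by (simp add: diff_divide_distrib)
    then have "eps < real ?U / real n" using big by simp
    then have U: "eps * real n < real ?U" using n by (simp add: field_simps)
    \<comment> \<open>A left vertex free at the end was free at all times, so it has no arc to a
      right vertex that stayed unmatched. Both sets have the size of \<open>U\<close>.\<close>
    define A where "A = R.avail (R.net x) n"
    define B where "B = vert S n ` {t. t < n \<and> R.unm (R.net x) t}"
    have "card A = ?U" using R.card_avail[of "R.net x" n] by (simp add: A_def)
    moreover have "card B = ?U" unfolding B_def R.U_def
      by (rule card_image) (use R.v_eq_iff in \<open>auto simp: inj_on_def\<close>)
    moreover have BV: "B \<subseteq> V n" using R.v_in by (auto simp: B_def)
    ultimately have "(A, B) \<in> I" using U R.avail_subset by (auto simp: I_def A_def)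
    moreover have mono: "R.avail (R.net x) n \<subseteq> R.avail (R.net x) t" if "t \<le> n" for t
      using that by (induction rule: inc_induct) (auto simp: Let_def split: if_splits)
    have "\<not> x e" if "e \<in> bt ` W (A, B)" for e
    proof -
      obtain i t where it: "i \<in> A" "t < n" "R.unm (R.net x) t" "e = bt (i, vert S n t)"
        using \<open>e \<in> bt ` W (A, B)\<close> by (auto simp: W_def B_def)
      have "(i, vert S n t) \<notin> R.net x" using it mono[of t] by (auto simp: R.unm_def A_def)
      moreover have "i \<in> V n" using it R.avail_subset by (auto simp: A_def)
      ultimately show ?thesis using it R.v_in by (auto simp: R.net_def)
    qed
    ultimately show "\<exists>P\<in>I. \<forall>e\<in>bt ` W P. \<not> x e" by blast
  qed
  also have "\<dots> \<le> (\<Sum>P\<in>I. exp (- (h * a / 2)))" by (intro order_trans[OF prob_bex_le[OF finI]] sum_mono single)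
  also have "\<dots> = real (card I) * exp (- (h * a / 2))" by simp
  also have "\<dots> \<le> real (4 ^ n) * exp (- (h * a / 2))" by (intro mult_right_mono of_nat_mono cardI) simp
  finally show ?thesis by (simp add: a_def)
qed

section \<open>Almost sure convergence\<close>

definition greedy_dev :: "rule \<Rightarrow> nat \<Rightarrow> real \<Rightarrow> real \<Rightarrow> network set" where
  "greedy_dev S n c eps = {G. \<bar>real (card (greedy_matching S n G)) / real n - c\<bar> > eps}"

text \<open>Complete convergence, with the same summable bound for all fixed rules.\<close>

definition greedy_cc :: "(nat \<Rightarrow> network pmf) \<Rightarrow> real \<Rightarrow> bool" where
  "greedy_cc law c \<longleftrightarrow> (\<forall>eps>0. \<exists>f. summable f \<and> (\<forall>\<^sub>F n in sequentially. \<forall>S. valid_rule S \<longrightarrow>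
     measure_pmf.prob (law n) (greedy_dev S n c eps) \<le> f n))"

text \<open>
  Networks with different \<open>n\<close> may be coupled arbitrarily, so almost sure convergence needs
  summable deviation probabilities. A rule that is independent of the network does no better than
  the worst fixed rule.
\<close>
lemma AE_greedy:
  fixes Om :: "'a measure" and G :: "nat \<Rightarrow> 'a \<Rightarrow> network" and S :: "nat \<Rightarrow> 'a \<Rightarrow> rule"
  assumes "prob_space Om"
    and G: "\<And>n. G n \<in> measurable Om (count_space UNIV)"
      "\<And>n. distr Om (count_space UNIV) (G n) = measure_pmf (law n)"
    and S: "\<And>n \<omega>. \<omega> \<in> space Om \<Longrightarrow> valid_rule (S n \<omega>)"
      "\<And>n. prob_space.indep_set Om (range (\<lambda>A. S n -` A \<inter> space Om)) (range (\<lambda>B. G n -` B \<inter> space Om))"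
    and fin: "\<And>n. finite (set_pmf (law n))"
    and cc: "greedy_cc law c"
  shows "AE \<omega> in Om. (\<lambda>n. real (card (greedy_matching (S n \<omega>) n (G n \<omega>))) / real n) \<longlonglongrightarrow> c"
proof -
  interpret prob_space Om by fact
  let ?X = "\<lambda>n \<omega>. real (card (greedy_matching (S n \<omega>) n (G n \<omega>))) / real n"
  have Gm: "G n -` B \<inter> space Om \<in> events" for n B using measurable_sets[OF G(1)[of n], of B] by simp
  have Gp: "prob (G n -` B \<inter> space Om) = measure_pmf.prob (law n) B" for n B
    using measure_distr[OF G(1)[of n], of B] by (simp add: G(2))
  have Sm: "S n -` A \<inter> space Om \<in> events" for n A
    using indep_setD_ev1[OF S(2)[of n]] by auto
  have ev: "AE \<omega> in Om. eventually (\<lambda>n. \<bar>?X n \<omega> - c\<bar> \<le> eps) sequentially" if eps: "0 < eps" for eps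
  proof -
    obtain f N where f: "summable f"
      and N: "\<And>n S. n \<ge> N \<Longrightarrow> valid_rule S \<Longrightarrow> measure_pmf.prob (law n) (greedy_dev S n c eps) \<le> f n"
      using cc eps unfolding greedy_cc_def eventually_sequentially by meson
    \<comment> \<open>The bad event as a finite union of products of a rule event and a network
      event, which makes it measurable and amenable to independence. The last part is the null event
      that the network leaves the support of its law.\<close>
    define A where "A = (\<lambda>n. (\<Union>g\<in>set_pmf (law n). (S n -` {s. g \<in> greedy_dev s n c eps} \<inter> space Om) \<inter>
        (G n -` {g} \<inter> space Om)) \<union> (G n -` (- set_pmf (law n)) \<inter> space Om))"
    have Am: "A n \<in> events" for n unfolding A_def by (intro sets.Un sets.finite_UN fin sets.Int[OF Sm Gm] Gm)
    have Ap: "prob (A n) \<le> f n" if n: "n \<ge> N" for n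
    proof -
      let ?Sg = "\<lambda>g. S n -` {s. g \<in> greedy_dev s n c eps} \<inter> space Om"
      have int: "integrable Om (\<lambda>\<omega>. indicator (?Sg g) \<omega> * pmf (law n) g)" for g
        by (intro integrable_mult_left integrable_real_indicator Sm) (simp add: less_top[symmetric])
      have "prob (A n) \<le> prob (\<Union>g\<in>set_pmf (law n). ?Sg g \<inter> (G n -` {g} \<inter> space Om)) +
          prob (G n -` (- set_pmf (law n)) \<inter> space Om)"
        unfolding A_def by (intro measure_Un_le sets.finite_UN fin sets.Int[OF Sm Gm] Gm)
      also have "prob (G n -` (- set_pmf (law n)) \<inter> space Om) = 0"
        unfolding Gp by (simp add: measure_pmf.prob_eq_0 AE_measure_pmf_iff)
      also have "prob (\<Union>g\<in>set_pmf (law n). ?Sg g \<inter> (G n -` {g} \<inter> space Om)) \<le>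
          (\<Sum>g\<in>set_pmf (law n). prob (?Sg g \<inter> (G n -` {g} \<inter> space Om)))"
        using fin[of n] sets.Int[OF Sm Gm] by (intro finite_measure_subadditive_finite) blast+
      also have "\<dots> = (\<Sum>g\<in>set_pmf (law n). prob (?Sg g) * pmf (law n) g)"
      proof (rule sum.cong[OF refl])
        fix g
        have "prob (?Sg g \<inter> (G n -` {g} \<inter> space Om)) = prob (?Sg g) * prob (G n -` {g} \<inter> space Om)"
          by (rule indep_setD[OF S(2)]; rule rangeI)
        then show "prob (?Sg g \<inter> (G n -` {g} \<inter> space Om)) = prob (?Sg g) * pmf (law n) g"
          by (simp add: Gp measure_pmf_single)
      qed
      \<comment> \<open>The sum over networks moves inside the expectation over the rule; for each
        value of the rule it is the deviation probability of a fixed rule.\<close>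
      also have "\<dots> = expectation (\<lambda>\<omega>. \<Sum>g\<in>set_pmf (law n). indicator (?Sg g) \<omega> * pmf (law n) g)"
        by (subst Bochner_Integration.integral_sum[OF int]) simp
      also have "\<dots> \<le> expectation (\<lambda>\<omega>. f n)"
      proof (rule integral_mono)
        show "integrable Om (\<lambda>\<omega>. \<Sum>g\<in>set_pmf (law n). indicator (?Sg g) \<omega> * pmf (law n) g)"
          by (intro Bochner_Integration.integrable_sum int)
        fix \<omega> assume w: "\<omega> \<in> space Om"
        have "(\<Sum>g\<in>set_pmf (law n). indicator (?Sg g) \<omega> * pmf (law n) g) =
            (\<Sum>g\<in>set_pmf (law n). if g \<in> greedy_dev (S n \<omega>) n c eps then pmf (law n) g else 0)"
          using w by (intro sum.cong) (auto simp: indicator_def)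
        also have "\<dots> = (\<Sum>g\<in>set_pmf (law n) \<inter> greedy_dev (S n \<omega>) n c eps. pmf (law n) g)"
          using fin[of n] by (simp add: sum.inter_restrict)
        also have "\<dots> = measure_pmf.prob (law n) (set_pmf (law n) \<inter> greedy_dev (S n \<omega>) n c eps)"
          using fin[of n] by (simp add: measure_measure_pmf_finite)
        also have "\<dots> = measure_pmf.prob (law n) (greedy_dev (S n \<omega>) n c eps)"
          by (subst Int_commute) (rule measure_Int_set_pmf)
        also have "\<dots> \<le> f n" using N[OF n S(1)[OF w]] .
        finally show "(\<Sum>g\<in>set_pmf (law n). indicator (?Sg g) \<omega> * pmf (law n) g) \<le> f n" .
      qed auto
      finally show ?thesis by (simp add: prob_space)
    qed
    have "summable (\<lambda>n. prob (A n))"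
      by (rule summable_comparison_test'[OF f, of N]) (use Ap in auto)
    then have "AE \<omega> in Om. eventually (\<lambda>n. \<omega> \<in> space Om - A n) sequentially"
      by (intro borel_cantelli_AE1 Am) (auto simp: less_top[symmetric])
    then show ?thesis
    proof (rule AE_mp, intro AE_I2 impI)
      fix \<omega> assume w: "\<omega> \<in> space Om" and out: "eventually (\<lambda>n. \<omega> \<in> space Om - A n) sequentially"
      from out show "eventually (\<lambda>n. \<bar>?X n \<omega> - c\<bar> \<le> eps) sequentially"
      proof eventually_elim
        case (elim n)
        then have "G n \<omega> \<in> set_pmf (law n)" "G n \<omega> \<notin> greedy_dev (S n \<omega>) n c eps"
          using w by (auto simp: A_def)
        then show ?case by (simp add: greedy_dev_def not_less)
      qed
    qed
  qed
  have "AE \<omega> in Om. \<forall>m. eventually (\<lambda>n. \<bar>?X n \<omega> - c\<bar> \<le> 1 / real (Suc m)) sequentially"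
    by (subst AE_all_countable) (intro allI ev, simp)
  then show ?thesis
  proof (rule AE_mp, intro AE_I2 impI)
    fix \<omega> assume *: "\<forall>m. eventually (\<lambda>n. \<bar>?X n \<omega> - c\<bar> \<le> 1 / real (Suc m)) sequentially"
    show "(\<lambda>n. ?X n \<omega>) \<longlonglongrightarrow> c"
    proof (rule tendstoI)
      fix e :: real assume "0 < e"
      then obtain m where m: "1 / real (Suc m) < e" using nat_approx_posE by blast
      from *[rule_format, of m] show "eventually (\<lambda>n. dist (?X n \<omega>) c < e) sequentially"
        by eventually_elim (use m in \<open>simp add: dist_real_def\<close>)
    qed
  qed
qed

lemma summable_poly_exp:
  assumes "0 < \<gamma>"
  shows "summable (\<lambda>n. (real n ^ 2 + 1) * (K * exp (- \<gamma> * real n)))"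
proof -
  have "summable (\<lambda>n. exp (- \<gamma> / 2) ^ n)" using assms by (intro summable_geometric) simp
  then have s: "summable (\<lambda>n. ((8 / \<gamma>\<^sup>2 + 1) * \<bar>K\<bar>) * exp (- \<gamma> / 2) ^ n)" by (rule summable_mult)
  show ?thesis
  proof (rule summable_comparison_test'[OF s, of 0])
    fix n :: nat
    define y where "y = \<gamma> / 2 * real n"
    have y: "0 \<le> y" using assms by (simp add: y_def)
    have "y\<^sup>2 / 2 \<le> exp y" using exp_lower_Taylor_quadratic[OF y] y by simp
    then have "real n ^ 2 \<le> 8 / \<gamma>\<^sup>2 * exp y"
      using assms by (simp add: y_def power_mult_distrib power_divide field_simps)
    moreover have "1 \<le> exp y" using y by simp
    moreover have "(8 / \<gamma>\<^sup>2 + 1) * exp y = 8 / \<gamma>\<^sup>2 * exp y + exp y" by (simp add: distrib_right)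
    ultimately have "real n ^ 2 + 1 \<le> (8 / \<gamma>\<^sup>2 + 1) * exp y" by linarith
    then have "(real n ^ 2 + 1) * (\<bar>K\<bar> * exp (- \<gamma> * real n)) \<le> (8 / \<gamma>\<^sup>2 + 1) * exp y * (\<bar>K\<bar> * exp (- \<gamma> * real n))"
      by (rule mult_right_mono) simp
    also have "exp y * exp (- \<gamma> * real n) = exp (- \<gamma> / 2) ^ n"
      by (simp add: y_def exp_add[symmetric] exp_of_nat_mult[symmetric] field_simps)
    then have "(8 / \<gamma>\<^sup>2 + 1) * exp y * (\<bar>K\<bar> * exp (- \<gamma> * real n)) = ((8 / \<gamma>\<^sup>2 + 1) * \<bar>K\<bar>) * exp (- \<gamma> / 2) ^ n"
      by (metis mult.assoc mult.left_commute)
    finally show "norm ((real n ^ 2 + 1) * (K * exp (- \<gamma> * real n))) \<le> ((8 / \<gamma>\<^sup>2 + 1) * \<bar>K\<bar>) * exp (- \<gamma> / 2) ^ n"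
      by (simp add: abs_mult)
  qed
qed

lemma four_power_le: "(4::real) ^ n \<le> exp (2 * real n)"
proof -
  have "(2::real) \<le> exp 1" using exp_ge_add_one_self[of 1] by simp
  then have "(2::real) * 2 \<le> exp 1 * exp 1" by (intro mult_mono) auto
  also have "\<dots> = exp (2::real)" by (simp add: exp_add[symmetric])
  finally have "(4::real) ^ n \<le> exp 2 ^ n" by (intro power_mono) auto
  then show ?thesis by (simp add: exp_of_nat_mult[symmetric] mult.commute)
qed

text \<open>The law needs only to be dominated by that of independent bits. The factor
  \<open>real n ^ 2 + 1\<close> exceeds the number of possible edges plus 1, which is the cost of
  fixing the number of edges.\<close>

lemma greedy_cc_finite:
  fixes bt :: "nat \<times> nat \<Rightarrow> 'e"
  assumes lam: "0 \<le> lam" and lim: "(\<lambda>n. real n * p n) \<longlonglongrightarrow> lam"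
    and ok: "\<forall>\<^sub>F n in sequentially. bit_ok n bt \<and> 0 \<le> q n \<and> q n \<le> p n \<and> p n \<le> 1 \<and>
      (\<forall>B. measure_pmf.prob (law n) B \<le> (real n ^ 2 + 1) * measure_pmf.prob (bit_net n bt (p n) (q n)) B)"
  shows "greedy_cc law (1 - free_limit lam)"
  unfolding greedy_cc_def
proof (intro allI impI)
  fix eps :: real assume eps: "0 < eps"
  obtain \<delta> \<gamma> n0 where d: "0 < \<delta>" "0 < \<gamma>" and b: "\<forall>n\<ge>n0. \<forall>S p q (bt :: nat \<times> nat \<Rightarrow> 'e).
    valid_rule S \<longrightarrow> bit_ok n bt \<longrightarrow> 0 \<le> q \<longrightarrow> q \<le> p \<longrightarrow> p \<le> 1 \<longrightarrow> \<bar>real n * p - lam\<bar> < \<delta> \<longrightarrow>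
    measure_pmf.prob (bit_net n bt p q) (greedy_dev S n (1 - free_limit lam) eps) \<le> 4 * exp (- \<gamma> * real n)"
    using bit_net_greedy[OF lam eps, where 'e = 'e] unfolding greedy_dev_def by blast
  have cl: "\<forall>\<^sub>F n in sequentially. \<bar>real n * p n - lam\<bar> < \<delta>"
    using tendstoD[OF lim d(1)] by (simp add: dist_real_def)
  show "\<exists>f. summable f \<and> (\<forall>\<^sub>F n in sequentially. \<forall>S. valid_rule S \<longrightarrow>
     measure_pmf.prob (law n) (greedy_dev S n (1 - free_limit lam) eps) \<le> f n)"
  proof (intro exI conjI)
    show "summable (\<lambda>n. (real n ^ 2 + 1) * (4 * exp (- \<gamma> * real n)))" by (rule summable_poly_exp[OF d(2)])
    show "\<forall>\<^sub>F n in sequentially. \<forall>S. valid_rule S \<longrightarrow> measure_pmf.prob (law n)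
        (greedy_dev S n (1 - free_limit lam) eps) \<le> (real n ^ 2 + 1) * (4 * exp (- \<gamma> * real n))"
      using ok cl eventually_ge_at_top[of n0]
    proof eventually_elim
      case (elim n)
      show ?case
      proof (intro allI impI)
        fix S assume S: "valid_rule S"
        have "measure_pmf.prob (law n) (greedy_dev S n (1 - free_limit lam) eps) \<le>
            (real n ^ 2 + 1) * measure_pmf.prob (bit_net n bt (p n) (q n)) (greedy_dev S n (1 - free_limit lam) eps)"
          using elim by blast
        also have "\<dots> \<le> (real n ^ 2 + 1) * (4 * exp (- \<gamma> * real n))"
          using elim S by (intro mult_left_mono b[rule_format]) auto
        finally show "measure_pmf.prob (law n) (greedy_dev S n (1 - free_limit lam) eps) \<le>
          (real n ^ 2 + 1) * (4 * exp (- \<gamma> * real n))" .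
      qed
    qed
  qed
qed

lemma greedy_cc_infinite:
  fixes bt :: "nat \<times> nat \<Rightarrow> 'e"
  assumes lim: "filterlim (\<lambda>n. real n * p n) at_top sequentially"
    and ok: "\<forall>\<^sub>F n in sequentially. bit_ok n bt \<and> 0 \<le> q n \<and> q n \<le> p n \<and> p n \<le> 1 \<and>
      (\<forall>B. measure_pmf.prob (law n) B \<le> (real n ^ 2 + 1) * measure_pmf.prob (bit_net n bt (p n) (q n)) B)"
  shows "greedy_cc law 1"
  unfolding greedy_cc_def
proof (intro allI impI)
  fix eps :: real assume eps: "0 < eps"
  \<comment> \<open>This makes the exponent in the union bound at least \<open>4 * real n\<close>.
    It beats the number \<open>4 ^ n\<close> \<le> \<open>exp (2 * real n)\<close> of pairs of sets
    and leaves \<open>exp (- 2 * real n)\<close>.\<close>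
  have cl: "\<forall>\<^sub>F n in sequentially. 16 / eps\<^sup>2 \<le> real n * p n" using lim by (simp add: filterlim_at_top)
  show "\<exists>f. summable f \<and> (\<forall>\<^sub>F n in sequentially. \<forall>S. valid_rule S \<longrightarrow>
     measure_pmf.prob (law n) (greedy_dev S n 1 eps) \<le> f n)"
  proof (intro exI conjI)
    show "summable (\<lambda>n. (real n ^ 2 + 1) * (1 * exp (- 2 * real n)))" by (rule summable_poly_exp) simp
    show "\<forall>\<^sub>F n in sequentially. \<forall>S. valid_rule S \<longrightarrow> measure_pmf.prob (law n)
        (greedy_dev S n 1 eps) \<le> (real n ^ 2 + 1) * (1 * exp (- 2 * real n))"
      using ok cl eventually_ge_at_top[of "nat \<lceil>2 / eps\<^sup>2\<rceil> + 1"]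
    proof eventually_elim
      case (elim n)
      have n: "0 < n" "2 / eps\<^sup>2 \<le> real n" using elim by linarith+
      have e2: "2 \<le> eps\<^sup>2 * real n" using n eps by (simp add: divide_le_eq mult.commute)
      have "2 * real n \<le> eps\<^sup>2 * real n * real n" using e2 by (intro mult_right_mono) auto
      then have a: "eps\<^sup>2 * (real n)\<^sup>2 / 2 \<le> eps\<^sup>2 * (real n)\<^sup>2 - real n"
        by (simp add: power2_eq_square algebra_simps)
      have "p n * (eps\<^sup>2 * (real n)\<^sup>2 / 2) \<le> p n * (eps\<^sup>2 * (real n)\<^sup>2 - real n)"
        using elim by (intro mult_left_mono a) auto
      moreover have "p n * (eps\<^sup>2 * (real n)\<^sup>2 / 2) = (real n * p n) * (eps\<^sup>2 * real n / 2)"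
        by (simp add: power2_eq_square)
      moreover have "16 / eps\<^sup>2 * (eps\<^sup>2 * real n / 2) \<le> (real n * p n) * (eps\<^sup>2 * real n / 2)"
        using elim by (intro mult_right_mono) auto
      moreover have "16 / eps\<^sup>2 * (eps\<^sup>2 * real n / 2) = 8 * real n" using eps by simp
      ultimately have ex: "4 * real n \<le> p n * (eps\<^sup>2 * (real n)\<^sup>2 - real n) / 2" by linarith
      show ?case
      proof (intro allI impI)
        fix S assume S: "valid_rule S"
        have "measure_pmf.prob (bit_net n bt (p n) (q n)) (greedy_dev S n 1 eps) \<le>
            4 ^ n * exp (- (p n * (eps\<^sup>2 * (real n)\<^sup>2 - real n) / 2))"
          unfolding greedy_dev_def
          by (rule bit_net_greedy_dense) (use elim S eps n exp_ge_add_one_self[of "- p n"] in auto)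
        also have "\<dots> \<le> exp (2 * real n) * exp (- (4 * real n))"
          using ex by (intro mult_mono four_power_le) auto
        also have "\<dots> = exp (- 2 * real n)" by (simp add: exp_add[symmetric])
        finally have "(real n ^ 2 + 1) * measure_pmf.prob (bit_net n bt (p n) (q n)) (greedy_dev S n 1 eps) \<le>
            (real n ^ 2 + 1) * exp (- 2 * real n)" by (intro mult_left_mono) auto
        moreover have "measure_pmf.prob (law n) (greedy_dev S n 1 eps) \<le>
            (real n ^ 2 + 1) * measure_pmf.prob (bit_net n bt (p n) (q n)) (greedy_dev S n 1 eps)"
          using elim by blast
        ultimately show "measure_pmf.prob (law n) (greedy_dev S n 1 eps) \<le> (real n ^ 2 + 1) * (1 * exp (- 2 * real n))"
          by simp
      qed
    qed
  qed
qed

definition greedy_limit :: "ennreal \<Rightarrow> real" where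
  "greedy_limit lam = (if lam = \<infinity> then 1 else 1 - free_limit (enn2real lam))"

lemma greedy_cc_ennreal:
  fixes bt :: "nat \<times> nat \<Rightarrow> 'e"
  assumes lim: "(\<lambda>n. ennreal (real n * p n)) \<longlonglongrightarrow> lam"
    and ok: "\<forall>\<^sub>F n in sequentially. bit_ok n bt \<and> 0 \<le> q n \<and> q n \<le> p n \<and> p n \<le> 1 \<and>
      (\<forall>B. measure_pmf.prob (law n) B \<le> (real n ^ 2 + 1) * measure_pmf.prob (bit_net n bt (p n) (q n)) B)"
  shows "greedy_cc law (greedy_limit lam)"
proof (cases "lam = \<infinity>")
  case True
  then have "filterlim (\<lambda>n. real n * p n) at_top sequentially"
    using lim by (simp add: ennreal_tendsto_top_eq_at_top infinity_ennreal_def)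
  then show ?thesis using greedy_cc_infinite[OF _ ok] True by (simp add: greedy_limit_def)
next
  case False
  then have lam: "lam = ennreal (enn2real lam)" by (simp add: less_top infinity_ennreal_def)
  have "\<forall>\<^sub>F n in sequentially. 0 \<le> real n * p n" using ok by eventually_elim auto
  then have "(\<lambda>n. real n * p n) \<longlonglongrightarrow> enn2real lam"
    using lim lam by (intro tendsto_ennrealD) auto
  then show ?thesis using greedy_cc_finite[OF _ _ ok, of "enn2real lam"] False by (simp add: greedy_limit_def)
qed

section \<open>Erdos-Renyi networks and networks with a fixed number of edges\<close>

definition bit_dir :: "nat \<times> nat \<Rightarrow> nat \<times> nat" where
  "bit_dir = (\<lambda>a. a)"

definition bit_und :: "nat \<times> nat \<Rightarrow> nat set" where
  "bit_und = (\<lambda>(i, j). {i, j})"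

lemma bit_ok_dir: "bit_ok n bit_dir" and bit_ok_und: "bit_ok n bit_und"
  by (auto simp: bit_ok_def bit_dir_def bit_und_def)

lemma finite_Vn [simp]: "finite (V n)" and card_Vn [simp]: "card (V n) = n"
  by (auto simp: V_def)

lemma bernoulli_pmf_zero: "bernoulli_pmf 0 = return_pmf False"
  by (rule pmf_eqI) (auto simp: pmf_eq_0_set_pmf split: split_indicator bool.splits)

lemma bit_net_no_loops:
  "bit_net n bt p 0 = map_pmf (\<lambda>F. {(i, j). i \<in> V n \<and> j \<in> V n \<and> bt (i, j) \<in> F})
     (random_subset {e \<in> bt ` (V n \<times> V n). \<not> (\<exists>i\<in>V n. e = bt (i, i))} p)"
proof -
  let ?E = "bt ` (V n \<times> V n)" and ?d = "\<lambda>e. \<exists>i\<in>V n. e = bt (i, i)"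
  have "bprod ?E (\<lambda>e. if ?d e then 0 else p) =
      Pi_pmf ?E False (\<lambda>e. if ?d e then return_pmf False else bernoulli_pmf p)"
    unfolding bprod_def by (intro Pi_pmf_cong) (auto simp: bernoulli_pmf_zero)
  also have "\<dots> = Pi_pmf {e \<in> ?E. \<not> ?d e} False (\<lambda>_. bernoulli_pmf p)"
    by (rule Pi_pmf_if_set') simp
  finally have E: "bprod ?E (\<lambda>e. if ?d e then 0 else p) = \<dots>" .
  show ?thesis unfolding bit_net_def E random_subset_def pmf.map_comp
  proof (intro map_pmf_cong refl)
    fix x assume "x \<in> set_pmf (Pi_pmf {e \<in> ?E. \<not> ?d e} False (\<lambda>_. bernoulli_pmf p))"
    then have "x e \<Longrightarrow> e \<in> ?E \<and> \<not> ?d e" for e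
      using set_Pi_pmf_subset[of "{e \<in> ?E. \<not> ?d e}" False "\<lambda>_. bernoulli_pmf p"] by auto
    then show "{(i, j). i \<in> V n \<and> j \<in> V n \<and> x (bt (i, j))} = ((\<lambda>F. {(i, j). i \<in> V n \<and> j \<in> V n \<and> bt (i, j) \<in> F}) \<circ>
      (\<lambda>f. {x \<in> {e \<in> ?E. \<not> ?d e}. f x})) x" by (auto simp: o_def)
  qed
qed

lemma random_subset_subset: "finite A \<Longrightarrow> F \<in> set_pmf (random_subset A p) \<Longrightarrow> F \<subseteq> A"
  by (auto simp: random_subset_def)

lemma bit_net_dir: "bit_net n bit_dir p 0 = random_subset (possible_arcs n) p"
proof -
  have A: "{e \<in> bit_dir ` (V n \<times> V n). \<not> (\<exists>i\<in>V n. e = bit_dir (i, i))} = possible_arcs n"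
    by (auto simp: bit_dir_def possible_arcs_def)
  have "finite (possible_arcs n)" by (rule finite_subset[of _ "V n \<times> V n"]) (auto simp: possible_arcs_def)
  then have "map_pmf (\<lambda>F. {(i, j). i \<in> V n \<and> j \<in> V n \<and> bit_dir (i, j) \<in> F}) (random_subset (possible_arcs n) p) =
      map_pmf (\<lambda>F. F) (random_subset (possible_arcs n) p)"
    by (intro map_pmf_cong refl) (auto simp: bit_dir_def possible_arcs_def dest: random_subset_subset)
  then show ?thesis unfolding bit_net_no_loops A by (simp add: map_pmf_ident)
qed

lemma possible_edges_eq: "possible_edges n = {e \<in> bit_und ` (V n \<times> V n). \<not> (\<exists>i\<in>V n. e = bit_und (i, i))}"
proof (intro equalityI subsetI)
  fix e assume "e \<in> possible_edges n"
  then obtain i j where "e = {i, j}" "i \<noteq> j" "i \<in> V n" "j \<in> V n"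
    by (auto simp: possible_edges_def card_2_iff)
  then show "e \<in> {e \<in> bit_und ` (V n \<times> V n). \<not> (\<exists>i\<in>V n. e = bit_und (i, i))}"
    by (auto simp: bit_und_def doubleton_eq_iff intro!: image_eqI[of _ _ "(i, j)"])
next
  fix e assume "e \<in> {e \<in> bit_und ` (V n \<times> V n). \<not> (\<exists>i\<in>V n. e = bit_und (i, i))}"
  then obtain i j where "e = {i, j}" "i \<in> V n" "j \<in> V n" "e \<noteq> {i}" by (auto simp: bit_und_def)
  then show "e \<in> possible_edges n" by (auto simp: possible_edges_def card_insert_if)
qed

lemma finite_possible: "finite (possible_arcs n)" "finite (possible_edges n)"
proof -
  show "finite (possible_arcs n)" by (rule finite_subset[of _ "V n \<times> V n"]) (auto simp: possible_arcs_def)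
  show "finite (possible_edges n)" by (rule finite_subset[of _ "Pow (V n)"]) (auto simp: possible_edges_def)
qed

lemma arcs_of_und:
  assumes "F \<subseteq> Pow (V n)"
  shows "{(i, j). i \<in> V n \<and> j \<in> V n \<and> bit_und (i, j) \<in> F} = arcs_of F"
  using assms by (auto simp: bit_und_def arcs_of_def)

lemma bit_net_und: "bit_net n bit_und p 0 = map_pmf arcs_of (random_subset (possible_edges n) p)"
  unfolding bit_net_no_loops possible_edges_eq[symmetric]
  by (intro map_pmf_cong refl arcs_of_und)
     (use random_subset_subset[OF finite_possible(2)] in \<open>fastforce simp: possible_edges_def\<close>)

section \<open>Uniform subsets of a given size\<close>

lemma pmf_random_subset:
  assumes "finite A" "X \<subseteq> A" "0 \<le> p" "p \<le> 1"
  shows "pmf (random_subset A p) X = p ^ card X * (1 - p) ^ (card A - card X)"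
proof -
  have "(\<lambda>f. {x \<in> A. f x}) -` {X} = Pi A (\<lambda>x. {x \<in> X})" using assms(2) by auto
  then have "pmf (random_subset A p) X = (\<Prod>x\<in>A. measure_pmf.prob (bernoulli_pmf p) {x \<in> X})"
    unfolding random_subset_def pmf_map using measure_Pi_pmf_Pi[OF assms(1)] by simp
  also have "\<dots> = (\<Prod>x\<in>A. if x \<in> X then p else 1 - p)"
    using assms by (intro prod.cong) (auto simp: measure_pmf_single)
  also have "\<dots> = p ^ card (A \<inter> X) * (1 - p) ^ card (A - X)"
    using assms by (simp add: prod.If_cases Diff_eq)
  finally show ?thesis using assms by (simp add: Int_absorb1 card_Diff_subset finite_subset)
qed

text \<open>\<open>b\<close> is the binomial distribution with success probability
  \<open>k / N\<close>, scaled by \<open>N ^ N\<close> so that everything stays in the natural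
  numbers. The ratio of consecutive terms shows that it increases up to \<open>k\<close> and
  decreases afterwards.\<close>

lemma binomial_mode:
  assumes k: "k \<le> N" and j: "j \<le> N"
  defines "b \<equiv> \<lambda>j. (N choose j) * k ^ j * (N - k) ^ (N - j)"
  shows "b j \<le> b k"
proof -
  have step: "Suc i * (N - k) * b (Suc i) = (N - i) * k * b i" if "i < N" for i
  proof -
    have "N - i = Suc (N - Suc i)" using that by simp
    then have p: "(N - k) ^ (N - i) = (N - k) * (N - k) ^ (N - Suc i)" by (metis power_Suc)
    have e: "Suc i * (N choose Suc i) = (N - i) * (N choose i)"
      by (simp only: binomial_absorption binomial_absorb_comp)
    have "Suc i * (N - k) * b (Suc i) = (Suc i * (N choose Suc i)) * ((N - k) * (k * k ^ i) * (N - k) ^ (N - Suc i))"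
      unfolding b_def power_Suc by (simp only: mult_ac)
    also have "\<dots> = (N - i) * k * b i"
      unfolding e b_def p by (simp only: mult_ac)
    finally show ?thesis .
  qed
  have up: "b i \<le> b (Suc i)" if "i < k" for i
  proof -
    have "(N - i) * k * b i = Suc i * (N - k) * b (Suc i)" using step[of i] that k by simp
    also have "\<dots> \<le> k * (N - i) * b (Suc i)" using that by (intro mult_right_mono mult_mono) auto
    finally show ?thesis using that k by (simp add: mult.commute[of k])
  qed
  have down: "b (Suc i) \<le> b i" if "k \<le> i" "i < N" for i
  proof -
    have "Suc i * (N - k) * b (Suc i) = (N - i) * k * b i" using step[of i] that k by simp
    also have "\<dots> \<le> (N - k) * Suc i * b i" using that by (intro mult_right_mono mult_mono) auto
    finally show ?thesis using that k by (simp add: mult.commute[of "N - k"])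
  qed
  show ?thesis
  proof (cases "j \<le> k")
    case True
    then show ?thesis by (induction rule: inc_induct) (use up in \<open>auto intro: order_trans\<close>)
  next
    case False
    then have "k \<le> j" by simp
    then show ?thesis using j
    proof (induction rule: dec_induct)
      case (step i)
      then show ?case using down[of i] by simp
    qed simp
  qed
qed

text \<open>The most likely of the \<open>N + 1\<close> values has probability at least
  \<open>1 / (N + 1)\<close>.\<close>

lemma binomial_mode_prob:
  assumes k: "k \<le> N" and N: "0 < N"
  defines "p \<equiv> real k / real N"
  shows "1 \<le> (real N + 1) * (real (N choose k) * p ^ k * (1 - p) ^ (N - k))"
proof -
  define b where "b = (\<lambda>j. (N choose j) * k ^ j * (N - k) ^ (N - j))"
  have "N ^ N = (k + (N - k)) ^ N" using k by simp
  also have "\<dots> = (\<Sum>j\<le>N. b j)" unfolding b_def by (subst binomial_ring) simp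
  also have "\<dots> \<le> (\<Sum>j\<le>N. b k)" unfolding b_def using binomial_mode[OF k] by (intro sum_mono) auto
  also have "\<dots> = (N + 1) * b k" by simp
  finally have "real (N ^ N) \<le> real ((N + 1) * b k)" by (rule of_nat_mono)
  then have "1 \<le> (real N + 1) * (real (b k) / real N ^ N)" using N by (simp add: field_simps)
  also have "real (b k) / real N ^ N = real (N choose k) * p ^ k * (1 - p) ^ (N - k)"
  proof -
    have "1 - p = real (N - k) / real N" using k N by (simp add: p_def of_nat_diff field_simps)
    moreover have "real N ^ N = real N ^ k * real N ^ (N - k)" using k by (simp add: power_add[symmetric])
    ultimately show ?thesis by (simp add: b_def p_def power_divide)
  qed
  finally show ?thesis .
qed

text \<open>A uniform subset of size \<open>k\<close> is a binomial random subset conditioned on its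
  size, and with density \<open>k / card A\<close> the size \<open>k\<close> is the most likely
  one.\<close>

lemma uniform_subset_le:
  assumes A: "finite A" and k: "k \<le> card A" and N: "0 < card A"
  shows "measure_pmf.prob (pmf_of_set {X. X \<subseteq> A \<and> card X = k}) B \<le>
    (real (card A) + 1) * measure_pmf.prob (random_subset A (real k / real (card A))) B"
proof -
  let ?X = "{X. X \<subseteq> A \<and> card X = k}" and ?N = "card A"
  define p where "p = real k / real (card A)"
  have p: "0 \<le> p" "p \<le> 1" using k N by (auto simp: p_def)
  have fin: "finite ?X" using A by simp
  have cX: "card ?X = ?N choose k" using n_subsets[OF A] by simp
  have pos: "0 < ?N choose k" using k by simp
  then have ne: "?X \<noteq> {}" using cX by (metis card.empty less_irrefl)
  have "measure_pmf.prob (pmf_of_set ?X) B = real (card (?X \<inter> B)) / real (?N choose k)"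
    using measure_pmf_of_set[OF ne fin] cX by simp
  also have "\<dots> \<le> real (card (?X \<inter> B)) / real (?N choose k) *
      ((real ?N + 1) * (real (?N choose k) * p ^ k * (1 - p) ^ (?N - k)))"
  proof -
    have "real (card (?X \<inter> B)) / real (?N choose k) * 1 \<le> real (card (?X \<inter> B)) / real (?N choose k) *
        ((real ?N + 1) * (real (?N choose k) * p ^ k * (1 - p) ^ (?N - k)))"
      unfolding p_def by (rule mult_left_mono[OF binomial_mode_prob[OF k N]]) simp
    then show ?thesis by simp
  qed
  also have "\<dots> = (real ?N + 1) * (real (card (?X \<inter> B)) * (p ^ k * (1 - p) ^ (?N - k)))"
    using pos by simp
  also have "real (card (?X \<inter> B)) * (p ^ k * (1 - p) ^ (?N - k)) = (\<Sum>X\<in>?X \<inter> B. pmf (random_subset A p) X)"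
    using A p by (simp add: pmf_random_subset)
  also have "\<dots> = measure_pmf.prob (random_subset A p) (?X \<inter> B)"
    using fin by (simp add: measure_measure_pmf_finite)
  also have "\<dots> \<le> measure_pmf.prob (random_subset A p) B" by (intro measure_pmf.finite_measure_mono) auto
  finally show ?thesis by (simp add: p_def mult_left_mono)
qed

lemma card_possible_arcs: "card (possible_arcs n) = n * (n - 1)"
proof -
  have "possible_arcs n = V n \<times> V n - (\<lambda>i. (i, i)) ` V n" by (auto simp: possible_arcs_def)
  moreover have "card ((\<lambda>i. (i, i)) ` V n) = n" by (subst card_image) (auto simp: inj_on_def)
  ultimately show ?thesis
    by (subst \<open>possible_arcs n = _\<close>, subst card_Diff_subset) (auto simp: card_cartesian_product diff_mult_distrib2)
qed

lemma card_possible_edges: "card (possible_edges n) = n * (n - 1) div 2"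
  using n_subsets[of "V n" 2] by (simp add: possible_edges_def choose_two)

lemma greedy_cc_ER_directed: "ER_directed lam law \<Longrightarrow> greedy_cc law (greedy_limit lam)"
proof -
  assume "ER_directed lam law"
  then obtain p where p: "\<forall>n. 0 \<le> p n \<and> p n \<le> 1" "(\<lambda>n. ennreal (real n * p n)) \<longlonglongrightarrow> lam"
    "\<forall>n. law n = random_subset (possible_arcs n) (p n)" by (auto simp: ER_directed_def)
  show ?thesis
  proof (rule greedy_cc_ennreal[OF p(2), of bit_dir "\<lambda>_. 0"], intro always_eventually allI conjI)
    fix n B
    show "measure_pmf.prob (law n) B \<le> (real n ^ 2 + 1) * measure_pmf.prob (bit_net n bit_dir (p n) 0) B"
      using p(3) by (simp add: bit_net_dir mult_le_cancel_right1)
  qed (use p bit_ok_dir in auto)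
qed

lemma greedy_cc_ER_undirected: "ER_undirected lam law \<Longrightarrow> greedy_cc law (greedy_limit lam)"
proof -
  assume "ER_undirected lam law"
  then obtain p where p: "\<forall>n. 0 \<le> p n \<and> p n \<le> 1" "(\<lambda>n. ennreal (real n * p n)) \<longlonglongrightarrow> lam"
    "\<forall>n. law n = map_pmf arcs_of (random_subset (possible_edges n) (p n))" by (auto simp: ER_undirected_def)
  show ?thesis
  proof (rule greedy_cc_ennreal[OF p(2), of bit_und "\<lambda>_. 0"], intro always_eventually allI conjI)
    fix n B
    show "measure_pmf.prob (law n) B \<le> (real n ^ 2 + 1) * measure_pmf.prob (bit_net n bit_und (p n) 0) B"
      using p(3) by (simp add: bit_net_und mult_le_cancel_right1 del: measure_map_pmf)
  qed (use p bit_ok_und in auto)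
qed

text \<open>A vertex has \<open>n - 1\<close> possible partners instead of \<open>n\<close>, so the
  edge density times \<open>n\<close> differs from the average degree by this factor.\<close>

lemma tendsto_n_over_pred:
  assumes "(\<lambda>n. ennreal (f n)) \<longlonglongrightarrow> lam"
  shows "(\<lambda>n. ennreal (real n / (real n - 1) * f n)) \<longlonglongrightarrow> lam"
proof -
  have "(\<lambda>n. real n / (real n - 1)) \<longlonglongrightarrow> 1"
    by (rule LIMSEQ_imp_Suc) (use LIMSEQ_Suc_n_over_n[where 'a = real] in simp)
  then have "(\<lambda>n. ennreal (real n / (real n - 1))) \<longlonglongrightarrow> ennreal 1" by (rule tendsto_ennrealI)
  then have "(\<lambda>n. ennreal (real n / (real n - 1)) * ennreal (f n)) \<longlonglongrightarrow> ennreal 1 * lam"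
    by (intro tendsto_mult_ennreal assms) auto
  then have "(\<lambda>n. ennreal (real n / (real n - 1)) * ennreal (f n)) \<longlonglongrightarrow> lam" by simp
  moreover have "\<forall>\<^sub>F n in sequentially. ennreal (real n / (real n - 1)) * ennreal (f n) = ennreal (real n / (real n - 1) * f n)"
    using eventually_ge_at_top[of 2] by eventually_elim (rule ennreal_mult'[symmetric], simp)
  ultimately show ?thesis by (rule Lim_transform_eventually)
qed

lemma greedy_cc_UFS_directed: "UFS_directed lam law \<Longrightarrow> greedy_cc law (greedy_limit lam)"
proof -
  assume "UFS_directed lam law"
  then obtain k where k: "\<forall>n. k n \<le> card (possible_arcs n)" "(\<lambda>n. ennreal (real (k n) / real n)) \<longlonglongrightarrow> lam"
    "\<forall>n. law n = pmf_of_set {G. G \<subseteq> possible_arcs n \<and> card G = k n}" by (auto simp: UFS_directed_def)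
  define p where "p = (\<lambda>n. real (k n) / real (card (possible_arcs n)))"
  have "(\<lambda>n. ennreal (real n / (real n - 1) * (real (k n) / real n))) \<longlonglongrightarrow> lam" by (rule tendsto_n_over_pred[OF k(2)])
  moreover have "\<forall>\<^sub>F n in sequentially. ennreal (real n / (real n - 1) * (real (k n) / real n)) = ennreal (real n * p n)"
    using eventually_ge_at_top[of 2]
    by eventually_elim (simp add: p_def card_possible_arcs of_nat_diff field_simps)
  ultimately have lim: "(\<lambda>n. ennreal (real n * p n)) \<longlonglongrightarrow> lam" by (rule Lim_transform_eventually)
  show ?thesis
  proof (rule greedy_cc_ennreal[OF lim, of bit_dir "\<lambda>_. 0"])
    show "\<forall>\<^sub>F n in sequentially. bit_ok n bit_dir \<and> 0 \<le> (0::real) \<and> 0 \<le> p n \<and> p n \<le> 1 \<and>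
      (\<forall>B. measure_pmf.prob (law n) B \<le> (real n ^ 2 + 1) * measure_pmf.prob (bit_net n bit_dir (p n) 0) B)"
      using eventually_ge_at_top[of 2]
    proof eventually_elim
      case (elim n)
      have c: "0 < card (possible_arcs n)" using elim by (simp add: card_possible_arcs)
      have "measure_pmf.prob (law n) B \<le> (real n ^ 2 + 1) * measure_pmf.prob (bit_net n bit_dir (p n) 0) B" for B
      proof -
        have "measure_pmf.prob (law n) B \<le> (real (card (possible_arcs n)) + 1) * measure_pmf.prob (bit_net n bit_dir (p n) 0) B"
          using uniform_subset_le[OF finite_possible(1) k(1)[rule_format, of n] c] k(3) by (simp add: bit_net_dir p_def)
        also have "\<dots> \<le> (real n ^ 2 + 1) * measure_pmf.prob (bit_net n bit_dir (p n) 0) B"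
        proof (intro mult_right_mono add_right_mono)
          have "n * (n - 1) \<le> n ^ 2" by (simp add: power2_eq_square)
          then show "real (card (possible_arcs n)) \<le> real n ^ 2" unfolding card_possible_arcs by (metis of_nat_mono of_nat_power)
        qed simp
        finally show ?thesis .
      qed
      then show ?case using k(1) c bit_ok_dir by (simp add: p_def)
    qed
  qed
qed

lemma greedy_cc_UFS_undirected: "UFS_undirected lam law \<Longrightarrow> greedy_cc law (greedy_limit lam)"
proof -
  assume "UFS_undirected lam law"
  then obtain k where k: "\<forall>n. k n \<le> card (possible_edges n)" "(\<lambda>n. ennreal (2 * real (k n) / real n)) \<longlonglongrightarrow> lam"
    "\<forall>n. law n = map_pmf arcs_of (pmf_of_set {G. G \<subseteq> possible_edges n \<and> card G = k n})" by (auto simp: UFS_undirected_def)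
  define p where "p = (\<lambda>n. real (k n) / real (card (possible_edges n)))"
  have ce: "real (card (possible_edges n)) = real n * (real n - 1) / 2" if "n \<ge> 2" for n
    using that by (simp add: card_possible_edges real_of_nat_div of_nat_diff)
  have "(\<lambda>n. ennreal (real n / (real n - 1) * (2 * real (k n) / real n))) \<longlonglongrightarrow> lam" by (rule tendsto_n_over_pred[OF k(2)])
  moreover have "\<forall>\<^sub>F n in sequentially. ennreal (real n / (real n - 1) * (2 * real (k n) / real n)) = ennreal (real n * p n)"
    using eventually_ge_at_top[of 2]
    by eventually_elim (simp add: p_def ce field_simps)
  ultimately have lim: "(\<lambda>n. ennreal (real n * p n)) \<longlonglongrightarrow> lam" by (rule Lim_transform_eventually)
  show ?thesis
  proof (rule greedy_cc_ennreal[OF lim, of bit_und "\<lambda>_. 0"])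
    show "\<forall>\<^sub>F n in sequentially. bit_ok n bit_und \<and> 0 \<le> (0::real) \<and> 0 \<le> p n \<and> p n \<le> 1 \<and>
      (\<forall>B. measure_pmf.prob (law n) B \<le> (real n ^ 2 + 1) * measure_pmf.prob (bit_net n bit_und (p n) 0) B)"
      using eventually_ge_at_top[of 2]
    proof eventually_elim
      case (elim n)
      have "0 < real (card (possible_edges n))" using elim by (simp add: ce)
      then have c: "0 < card (possible_edges n)" by simp
      have "measure_pmf.prob (law n) B \<le> (real n ^ 2 + 1) * measure_pmf.prob (bit_net n bit_und (p n) 0) B" for B
      proof -
        have "measure_pmf.prob (law n) B \<le> (real (card (possible_edges n)) + 1) * measure_pmf.prob (bit_net n bit_und (p n) 0) B"
          using uniform_subset_le[OF finite_possible(2) k(1)[rule_format, of n] c] k(3) by (simp add: bit_net_und p_def)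
        also have "\<dots> \<le> (real n ^ 2 + 1) * measure_pmf.prob (bit_net n bit_und (p n) 0) B"
        proof (intro mult_right_mono add_right_mono)
          show "real (card (possible_edges n)) \<le> real n ^ 2" using elim by (simp add: ce power2_eq_square algebra_simps)
        qed simp
        finally show ?thesis .
      qed
      then show ?case using k(1) c bit_ok_und by (simp add: p_def)
    qed
  qed
qed

section \<open>Poissonization\<close>

lemma pmf_Poisson:
  assumes "0 \<le> r"
  shows "pmf (Poisson r) k = r ^ k / fact k * exp (- r)"
  using assms by (cases "r = 0") (auto simp: Poisson_def indicator_def)

lemma prob_dominated:
  assumes "0 \<le> c" "\<And>x. x \<in> B \<Longrightarrow> pmf M x \<le> c * pmf N x"
  shows "measure_pmf.prob M B \<le> c * measure_pmf.prob N B"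
proof -
  have "infsetsum (pmf M) B \<le> infsetsum (\<lambda>x. c * pmf N x) B"
    by (rule infsetsum_mono) (auto intro!: pmf_abs_summable abs_summable_on_cmult_right assms)
  also have "\<dots> = c * infsetsum (pmf N) B" by (rule infsetsum_cmult_right) (simp add: pmf_abs_summable)
  finally show ?thesis by (simp add: measure_pmf_conv_infsetsum)
qed

text \<open>An exponential change of measure: on the event, \<open>Poisson mu\<close> is pointwise
  dominated by a multiple of \<open>Poisson (mu * exp \<tau>)\<close>. The sign of
  \<open>\<tau>\<close> selects the upper or the lower tail.\<close>

lemma Poisson_tail:
  assumes mu: "0 \<le> mu" and t: "\<bar>\<tau>\<bar> \<le> 1"
  shows "measure_pmf.prob (Poisson mu) {k. s \<le> \<tau> * (real k - mu)} \<le> exp (mu * \<tau>\<^sup>2 - s)"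
proof -
  have "measure_pmf.prob (Poisson mu) {k. s \<le> \<tau> * (real k - mu)} \<le>
      exp (mu * \<tau>\<^sup>2 - s) * measure_pmf.prob (Poisson (mu * exp \<tau>)) {k. s \<le> \<tau> * (real k - mu)}"
  proof (rule prob_dominated)
    fix k assume "k \<in> {k. s \<le> \<tau> * (real k - mu)}"
    then have k: "s \<le> \<tau> * (real k - mu)" by simp
    have "mu * (exp \<tau> - 1) \<le> mu * (\<tau> + \<tau>\<^sup>2)"
      using exp_le_quadratic[OF t] mu by (intro mult_left_mono) auto
    then have e: "- mu \<le> mu * \<tau>\<^sup>2 - s + (\<tau> * real k - mu * exp \<tau>)" using k by (simp add: algebra_simps)
    have "mu ^ k / fact k * exp (- mu) \<le> mu ^ k / fact k * exp (mu * \<tau>\<^sup>2 - s + (\<tau> * real k - mu * exp \<tau>))"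
      using e mu by (intro mult_left_mono) auto
    also have "\<dots> = exp (mu * \<tau>\<^sup>2 - s) * ((mu * exp \<tau>) ^ k / fact k * exp (- (mu * exp \<tau>)))"
    proof -
      have "exp (\<tau> * real k) = exp \<tau> ^ k" by (simp add: exp_of_nat_mult[symmetric] mult.commute)
      then show ?thesis by (simp add: exp_add exp_diff exp_minus power_mult_distrib field_simps)
    qed
    finally show "pmf (Poisson mu) k \<le> exp (mu * \<tau>\<^sup>2 - s) * pmf (Poisson (mu * exp \<tau>)) k"
      using mu by (simp add: pmf_Poisson)
  qed simp
  also have "\<dots> \<le> exp (mu * \<tau>\<^sup>2 - s) * 1" by (intro mult_left_mono) auto
  finally show ?thesis by simp
qed

lemma integrable_prob [simp]: "integrable (measure_pmf N) (\<lambda>x. measure_pmf.prob (f x) B)"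
  by (rule measure_pmf.integrable_const_bound[of _ 1]) auto

lemma prob_bind: "measure_pmf.prob (bind_pmf N f) B = measure_pmf.expectation N (\<lambda>x. measure_pmf.prob (f x) B)"
proof -
  have "ennreal (measure_pmf.prob (bind_pmf N f) B) = (\<integral>\<^sup>+x. ennreal (measure_pmf.prob (f x) B) \<partial>measure_pmf N)"
    by (simp add: measure_pmf.emeasure_eq_measure[symmetric])
  also have "\<dots> = ennreal (measure_pmf.expectation N (\<lambda>x. measure_pmf.prob (f x) B))"
    by (rule nn_integral_eq_integral[OF integrable_prob]) simp
  finally show ?thesis by (simp add: integral_nonneg_AE)
qed

lemma prob_bind_ge: "pmf N a * measure_pmf.prob (f a) B \<le> measure_pmf.prob (bind_pmf N f) B"
proof -
  have "pmf N a * measure_pmf.prob (f a) B = measure_pmf.expectation N (\<lambda>x. indicator {a} x * measure_pmf.prob (f a) B)"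
    by (simp add: measure_pmf_single)
  also have "\<dots> \<le> measure_pmf.expectation N (\<lambda>x. measure_pmf.prob (f x) B)"
    by (rule integral_mono) (auto simp: indicator_def intro!: measure_pmf.integrable_const_bound[of _ 1])
  finally show ?thesis by (simp add: prob_bind)
qed

lemma prob_bind_le:
  assumes "\<And>x. x \<in> W \<Longrightarrow> measure_pmf.prob (f x) B \<le> c" "0 \<le> c"
  shows "measure_pmf.prob (bind_pmf N f) B \<le> measure_pmf.prob N (- W) + c"
proof -
  have "measure_pmf.expectation N (\<lambda>x. measure_pmf.prob (f x) B) \<le> measure_pmf.expectation N (\<lambda>x. indicator (- W) x + c)"
  proof (rule integral_mono)
    fix x
    show "measure_pmf.prob (f x) B \<le> indicator (- W) x + c"
    proof (cases "x \<in> W")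
      case False
      have "measure_pmf.prob (f x) B \<le> 1" by simp
      moreover have "indicator (- W) x = (1::real)" using False by simp
      ultimately show ?thesis using assms(2) by linarith
    qed (use assms in simp)
  qed (auto intro!: measure_pmf.integrable_const_bound[of _ "1 + c"] simp: indicator_def assms)
  also have "\<dots> = measure_pmf.prob N (- W) + c"
    by (subst Bochner_Integration.integral_add) (auto intro!: measure_pmf.integrable_const_bound[of _ 1] simp: indicator_def)
  finally show ?thesis by (simp add: prob_bind)
qed

section \<open>Poisson numbers of independent draws\<close>

text \<open>The multinomial distribution, by induction on the number of draws. A draw with value
  \<open>y\<close> lowers \<open>c y\<close> by one and contributes the weight \<open>c y\<close>;
  these weights sum to the number of draws and complete the factorial.\<close>

lemma prob_counts:
  assumes A: "finite A" and W: "set_pmf W \<subseteq> A" and J: "finite J" and c: "(\<Sum>e\<in>A. c e) = card J"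
  shows "measure_pmf.prob (Pi_pmf J d (\<lambda>_. W)) {h. \<forall>e\<in>A. card {j \<in> J. h j = e} = c e} =
    fact (card J) * (\<Prod>e\<in>A. pmf W e ^ c e / fact (c e))"
  using J c
proof (induction J arbitrary: c)
  case empty
  then have "\<forall>e\<in>A. c e = 0" using A by simp
  then show ?case by simp
next
  case (insert j J)
  let ?M = "Pi_pmf J d (\<lambda>_. W)" and ?P = "\<lambda>c. \<Prod>e\<in>A. pmf W e ^ c e / fact (c e)"
  have fW: "finite (set_pmf W)" using W A finite_subset by blast
  have fM: "finite (set_pmf ?M)"
    by (rule finite_subset[OF set_Pi_pmf_subset'[OF insert.hyps(1)]]) (use insert.hyps fW in auto)
  have "measure_pmf.prob (Pi_pmf (insert j J) d (\<lambda>_. W)) {h. \<forall>e\<in>A. card {i \<in> insert j J. h i = e} = c e} =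
      (\<Sum>y\<in>A. pmf W y * measure_pmf.prob ?M {h. \<forall>e\<in>A. card {i \<in> insert j J. (h(j := y)) i = e} = c e})"
  proof -
    have "Pi_pmf (insert j J) d (\<lambda>_. W) = bind_pmf W (\<lambda>y. map_pmf (\<lambda>h. h(j := y)) ?M)"
      using insert.hyps by (subst Pi_pmf_insert') (auto simp: map_pmf_def)
    then show ?thesis unfolding prob_eq_expectation
      by (simp add: pmf_expectation_bind[OF A _ W] fM del: fun_upd_apply)
  qed
  also have "\<dots> = (\<Sum>y\<in>A. fact (card J) * real (c y) * ?P c)"
  proof (rule sum.cong[OF refl])
    fix y assume y: "y \<in> A"
    have cnt: "card {i \<in> insert j J. (h(j := y)) i = e} = card {i \<in> J. h i = e} + (if e = y then 1 else 0)" for h e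
    proof -
      have "{i \<in> insert j J. (h(j := y)) i = e} = {i \<in> J. h i = e} \<union> (if e = y then {j} else {})"
        using insert.hyps by auto
      then show ?thesis using insert.hyps by simp
    qed
    show "pmf W y * measure_pmf.prob ?M {h. \<forall>e\<in>A. card {i \<in> insert j J. (h(j := y)) i = e} = c e} =
        fact (card J) * real (c y) * ?P c"
    proof (cases "c y")
      case 0
      then have emp: "{h. \<forall>e\<in>A. card {i \<in> insert j J. (h(j := y)) i = e} = c e} = {}"
        using y unfolding cnt by (auto intro!: bexI[of _ y])
      show ?thesis unfolding emp using 0 by simp
    next
      case (Suc k)
      define c' where "c' = c(y := k)"
      have "{h. \<forall>e\<in>A. card {i \<in> insert j J. (h(j := y)) i = e} = c e} = {h. \<forall>e\<in>A. card {i \<in> J. h i = e} = c' e}"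
        unfolding cnt c'_def using Suc by (auto split: if_splits)
      moreover have "(\<Sum>e\<in>A. c' e) = card J"
      proof -
        have "(\<Sum>e\<in>A. c e) = c y + (\<Sum>e\<in>A - {y}. c e)" using A y by (simp add: sum.remove)
        moreover have "(\<Sum>e\<in>A. c' e) = c' y + (\<Sum>e\<in>A - {y}. c' e)" using A y by (simp add: sum.remove)
        moreover have "(\<Sum>e\<in>A - {y}. c' e) = (\<Sum>e\<in>A - {y}. c e)" by (intro sum.cong) (auto simp: c'_def)
        ultimately show ?thesis using insert Suc by (simp add: c'_def)
      qed
      ultimately have "measure_pmf.prob ?M {h. \<forall>e\<in>A. card {i \<in> insert j J. (h(j := y)) i = e} = c e} =
          fact (card J) * ?P c'" using insert.IH by simp
      moreover have "pmf W y * ?P c' = real (c y) * ?P c"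
      proof -
        let ?R = "\<Prod>e\<in>A - {y}. pmf W e ^ c e / fact (c e)"
        have "?P c' = pmf W y ^ k / fact k * (\<Prod>e\<in>A - {y}. pmf W e ^ c' e / fact (c' e))"
          using A y by (simp add: prod.remove c'_def)
        also have "(\<Prod>e\<in>A - {y}. pmf W e ^ c' e / fact (c' e)) = ?R" by (intro prod.cong) (auto simp: c'_def)
        finally have 1: "?P c' = pmf W y ^ k / fact k * ?R" .
        have 2: "?P c = pmf W y ^ Suc k / fact (Suc k) * ?R" using A y Suc by (simp add: prod.remove)
        show ?thesis unfolding 1 2 Suc by simp
      qed
      ultimately show ?thesis by (simp add: mult_ac)
    qed
  qed
  also have "\<dots> = fact (card J) * real (\<Sum>y\<in>A. c y) * ?P c"
    by (simp add: sum_distrib_left sum_distrib_right)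
  also have "\<dots> = fact (card (insert j J)) * ?P c" using insert by (simp add: mult.commute)
  finally show ?case .
qed

text \<open>Given the counts \<open>D\<close>, only the total number of draws \<open>T0\<close>
  contributes. Its Poisson weight cancels the factorial of the multinomial probability, and what
  remains is a product over \<open>A\<close>.\<close>

lemma Poisson_thinning:
  fixes d :: 'a
  assumes A: "finite A" and W: "set_pmf W \<subseteq> A" and mu: "0 \<le> mu"
  shows "Pi_pmf A 0 (\<lambda>e. Poisson (mu * pmf W e)) = bind_pmf (Poisson mu) (\<lambda>T.
    map_pmf (\<lambda>h e. if e \<in> A then card {j \<in> {..<T}. h j = e} else 0) (Pi_pmf {..<T} d (\<lambda>_. W)))"
    (is "?L = bind_pmf _ ?f")
proof (rule pmf_eqI)
  fix D :: "'a \<Rightarrow> nat"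
  show "pmf ?L D = pmf (bind_pmf (Poisson mu) ?f) D"
  proof (cases "\<exists>e. e \<notin> A \<and> D e \<noteq> 0")
    case True
    then have "D \<notin> set_pmf (?f T)" for T by auto
    then have "pmf (?f T) D = 0" for T by (simp add: set_pmf_eq)
    then show ?thesis using True A by (simp add: pmf_Pi_outside pmf_bind)
  next
    case False
    define T0 where "T0 = (\<Sum>e\<in>A. D e)"
    define K where "K = fact T0 * (\<Prod>e\<in>A. pmf W e ^ D e / fact (D e))"
    have f: "pmf (?f T) D = indicator {T0} T * K" for T
    proof -
      have "(\<lambda>h e. if e \<in> A then card {j \<in> {..<T}. h j = e} else 0) -` {D} =
          {h. \<forall>e\<in>A. card {j \<in> {..<T}. h j = e} = D e}" using False by (auto simp: fun_eq_iff)
      then have p: "pmf (?f T) D = measure_pmf.prob (Pi_pmf {..<T} d (\<lambda>_. W)) {h. \<forall>e\<in>A. card {j \<in> {..<T}. h j = e} = D e}"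
        by (simp add: pmf_map)
      show ?thesis
      proof (cases "T = T0")
        case True
        have "pmf (?f T) D = fact (card {..<T}) * (\<Prod>e\<in>A. pmf W e ^ D e / fact (D e))"
          unfolding p by (rule prob_counts[OF A W]) (simp_all add: True T0_def)
        then show ?thesis by (simp add: True K_def)
      next
        case False
        have "measure_pmf.prob (Pi_pmf {..<T} d (\<lambda>_. W)) {h. \<forall>e\<in>A. card {j \<in> {..<T}. h j = e} = D e} = 0"
          unfolding measure_pmf_zero_iff
        proof (rule equals0I, elim IntE)
          fix h assume h: "h \<in> set_pmf (Pi_pmf {..<T} d (\<lambda>_. W))" "h \<in> {h. \<forall>e\<in>A. card {j \<in> {..<T}. h j = e} = D e}"
          have "h ` {..<T} \<subseteq> A" using h(1) W by (auto simp: set_Pi_pmf PiE_dflt_def)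
          then have "T = card (\<Union>e\<in>A. {j \<in> {..<T}. h j = e})"
          proof -
            have "(\<Union>e\<in>A. {j \<in> {..<T}. h j = e}) = {..<T}" using \<open>h ` {..<T} \<subseteq> A\<close> by auto
            then show ?thesis by simp
          qed
          also have "\<dots> = (\<Sum>e\<in>A. card {j \<in> {..<T}. h j = e})" by (rule card_UN_disjoint) (use A in auto)
          also have "\<dots> = T0" using h(2) by (simp add: T0_def)
          finally show False using False by simp
        qed
        then show ?thesis unfolding p using False by simp
      qed
    qed
    have "pmf (bind_pmf (Poisson mu) ?f) D = pmf (Poisson mu) T0 * K"
      unfolding pmf_bind f by (simp add: measure_pmf_single)
    also have "\<dots> = mu ^ T0 * exp (- mu) * (\<Prod>e\<in>A. pmf W e ^ D e / fact (D e))"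
      using mu by (simp add: pmf_Poisson K_def)
    also have "mu ^ T0 = (\<Prod>e\<in>A. mu ^ D e)" unfolding T0_def by (rule power_sum)
    also have "exp (- mu) = (\<Prod>e\<in>A. exp (- (mu * pmf W e)))"
    proof -
      have "(\<Sum>e\<in>A. - (mu * pmf W e)) = - mu"
        using sum_pmf_eq_1[OF A W] by (simp add: sum_negf sum_distrib_left[symmetric])
      then show ?thesis using A by (simp add: exp_sum[symmetric])
    qed
    also have "(\<Prod>e\<in>A. mu ^ D e) * (\<Prod>e\<in>A. exp (- (mu * pmf W e))) * (\<Prod>e\<in>A. pmf W e ^ D e / fact (D e)) =
        (\<Prod>e\<in>A. (mu * pmf W e) ^ D e / fact (D e) * exp (- (mu * pmf W e)))"
      unfolding prod.distrib[symmetric] by (intro prod.cong refl) (simp add: power_mult_distrib)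
    also have "\<dots> = pmf ?L D" using A False mu by (subst pmf_Pi') (auto simp: pmf_Poisson)
    finally show ?thesis by simp
  qed
qed

lemma map_Poisson_nonzero:
  assumes "0 \<le> r"
  shows "map_pmf (\<lambda>k. k \<noteq> 0) (Poisson r) = bernoulli_pmf (1 - exp (- r))"
proof -
  have p: "0 \<le> 1 - exp (- r)" "1 - exp (- r) \<le> 1" using assms by auto
  define M where "M = map_pmf (\<lambda>k. k \<noteq> 0) (Poisson r)"
  have F: "pmf M False = exp (- r)"
  proof -
    have "(\<lambda>k::nat. k \<noteq> 0) -` {False} = {0}" by auto
    then show ?thesis unfolding M_def pmf_map using assms by (simp only: measure_pmf_single pmf_Poisson) simp
  qed
  have "(\<Sum>b\<in>UNIV. pmf M b) = 1" by (rule sum_pmf_eq_1) auto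
  then have "pmf M True + pmf M False = 1" by (simp add: UNIV_bool)
  then have "pmf M b = pmf (bernoulli_pmf (1 - exp (- r))) b" for b
    using p F by (cases b) auto
  then show ?thesis unfolding M_def by (rule pmf_eqI)
qed

text \<open>A bit records that an edge has been drawn at least once; multiple edges
  collapse.\<close>

lemma bprod_Poisson:
  assumes "finite A" "\<And>e. e \<in> A \<Longrightarrow> 0 \<le> r e"
  shows "bprod A (\<lambda>e. 1 - exp (- r e)) = map_pmf (\<lambda>D e. D e \<noteq> 0) (Pi_pmf A 0 (\<lambda>e. Poisson (r e)))"
proof -
  have "bprod A (\<lambda>e. 1 - exp (- r e)) = Pi_pmf A False (\<lambda>e. map_pmf (\<lambda>k. k \<noteq> 0) (Poisson (r e)))"
    unfolding bprod_def by (intro Pi_pmf_cong refl map_Poisson_nonzero[symmetric] assms(2))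
  also have "\<dots> = map_pmf (\<lambda>h. (\<lambda>k. k \<noteq> 0) \<circ> h) (Pi_pmf A 0 (\<lambda>e. Poisson (r e)))"
    by (rule Pi_pmf_map) (use assms in auto)
  finally show ?thesis by (simp add: o_def)
qed

text \<open>A weak form of Stirling's formula. The induction step is \<open>exp 1\<close> \<le>
  \<open>(1 + 1 / m) ^ (m + 1)\<close>.\<close>

lemma fact_exp_le:
  assumes "0 < m"
  shows "fact m * exp (real m) \<le> exp 1 * real m * real m ^ m"
  using assms
proof (induction m rule: nat_induct_non_zero)
  case (Suc m)
  have "exp (- (1 / (real m + 1))) \<ge> real m / (real m + 1)"
  proof -
    have "1 + - (1 / (real m + 1)) \<le> exp (- (1 / (real m + 1)))" by (rule exp_ge_add_one_self)
    moreover have "1 + - (1 / (real m + 1)) = real m / (real m + 1)" by (simp add: field_simps)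
    ultimately show ?thesis by simp
  qed
  then have "(real m / (real m + 1)) ^ Suc m \<le> exp (- (1 / (real m + 1))) ^ Suc m" by (intro power_mono) auto
  also have "\<dots> = exp (real (Suc m) * - (1 / (real m + 1)))" by (rule exp_of_nat_mult[symmetric])
  also have "\<dots> = exp (- 1)" by (simp add: field_simps)
  finally have "real m ^ Suc m / (real m + 1) ^ Suc m \<le> 1 / exp 1"
    by (simp only: power_divide exp_minus inverse_eq_divide)
  then have "real m ^ Suc m \<le> 1 / exp 1 * (real m + 1) ^ Suc m" by (subst (asm) pos_divide_le_eq) simp_all
  then have "exp 1 * real m ^ Suc m \<le> exp 1 * (1 / exp 1 * (real m + 1) ^ Suc m)" by (rule mult_left_mono) simp
  then have le: "exp 1 * real m ^ Suc m \<le> (real m + 1) ^ Suc m" by simp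
  have "fact (Suc m) * exp (real (Suc m)) = (real m + 1) * exp 1 * (fact m * exp (real m))"
    by (simp add: exp_add algebra_simps)
  also have "\<dots> \<le> (real m + 1) * exp 1 * (exp 1 * real m * real m ^ m)" by (intro mult_left_mono Suc) auto
  also have "\<dots> = (real m + 1) * exp 1 * (exp 1 * real m ^ Suc m)" by simp
  also have "\<dots> \<le> (real m + 1) * exp 1 * (real m + 1) ^ Suc m" by (intro mult_left_mono le) auto
  finally show ?case by (simp add: algebra_simps)
qed simp

lemma pmf_Poisson_mode: "1 \<le> exp 1 * (real m + 1) * pmf (Poisson (real m)) m"
proof (cases "m = 0")
  case True
  then show ?thesis by (simp add: Poisson_def)
next
  case False
  have "fact m * exp (real m) \<le> exp 1 * real m * real m ^ m" using False by (intro fact_exp_le) simp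
  also have "\<dots> \<le> exp 1 * (real m + 1) * real m ^ m" by (intro mult_right_mono) auto
  finally show ?thesis by (simp add: pmf_Poisson exp_minus field_simps)
qed

text \<open>A fixed number \<open>m\<close> of draws is a Poisson number with mean \<open>m\<close>,
  conditioned on its value, which costs the inverse of the probability of that value. The event
  \<open>R\<close> sees only the set of drawn edges, and with a Poisson number of draws that set
  consists of independent bits.\<close>

lemma poissonization:
  assumes A: "finite A" and W: "set_pmf W \<subseteq> A" and J: "finite J"
  shows "measure_pmf.prob (Pi_pmf J d (\<lambda>_. W)) {h. R (h ` J)} \<le> exp 1 * (real (card J) + 1) *
    measure_pmf.prob (bprod A (\<lambda>e. 1 - exp (- (real (card J) * pmf W e)))) {x. R {e \<in> A. x e}}"
proof -
  define m where "m = card J"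
  obtain g where g: "bij_betw g J {..<m}"
    using ex_bij_betw_finite_nat[OF J] by (auto simp: m_def lessThan_atLeast0)
  \<comment> \<open>Indices outside \<open>J\<close> are sent to \<open>m\<close>, outside the range
    of the labels, so that the composed function takes the default value there.\<close>
  define g' where "g' = (\<lambda>x. if x \<in> J then g x else m)"
  have g': "bij_betw g' J {..<m}" using g by (simp add: g'_def cong: bij_betw_cong)
  let ?H = "Pi_pmf {..<m} d (\<lambda>_. W)"
  have "Pi_pmf J d (\<lambda>_. W) = map_pmf (\<lambda>f. f \<circ> g') ?H"
    by (rule Pi_pmf_bij_betw[OF J g']) (simp add: g'_def)
  moreover have "(f \<circ> g') ` J = f ` {..<m}" for f :: "nat \<Rightarrow> 'a"
    using image_comp[of f g' J] bij_betw_imp_surj_on[OF g'] by metis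
  ultimately have J': "measure_pmf.prob (Pi_pmf J d (\<lambda>_. W)) {h. R (h ` J)} = measure_pmf.prob ?H {h. R (h ` {..<m})}"
    by (simp add: vimage_def)
  let ?f = "\<lambda>T. map_pmf (\<lambda>h e. if e \<in> A then card {j \<in> {..<T}. h j = e} else 0) (Pi_pmf {..<T} d (\<lambda>_. W))"
  let ?B = "{D. R {e \<in> A. D e \<noteq> (0::nat)}}"
  have "measure_pmf.prob ?H {h. R (h ` {..<m})} = measure_pmf.prob (?f m) ?B"
  proof -
    have eq: "{e \<in> A. (if e \<in> A then card {j \<in> {..<m}. h j = e} else 0) \<noteq> 0} = h ` {..<m}"
      if "h \<in> set_pmf ?H" for h
    proof -
      have sub: "h ` {..<m} \<subseteq> A" using that W by (auto simp: set_Pi_pmf PiE_dflt_def)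
      have *: "card {j \<in> {..<m}. h j = e} \<noteq> 0 \<longleftrightarrow> e \<in> h ` {..<m}" for e
        by (subst card_eq_0_iff) auto
      show ?thesis
      proof (rule set_eqI)
        fix e
        show "e \<in> {e \<in> A. (if e \<in> A then card {j \<in> {..<m}. h j = e} else 0) \<noteq> 0} \<longleftrightarrow> e \<in> h ` {..<m}"
        proof (cases "e \<in> A")
          case True
          then show ?thesis using *[of e] by (simp only: mem_Collect_eq if_True simp_thms)
        qed (use sub in auto)
      qed
    qed
    show ?thesis unfolding measure_map_pmf
    proof (intro measure_pmf.finite_measure_eq_AE AE_pmfI)
      fix h assume h: "h \<in> set_pmf ?H"
      show "h \<in> {h. R (h ` {..<m})} \<longleftrightarrow> h \<in> (\<lambda>h e. if e \<in> A then card {j \<in> {..<m}. h j = e} else 0) -` ?B"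
        by (simp only: vimage_eq mem_Collect_eq eq[OF h])
    qed simp_all
  qed
  also have "\<dots> \<le> (exp 1 * (real m + 1) * pmf (Poisson (real m)) m) * measure_pmf.prob (?f m) ?B"
    using mult_right_mono[OF pmf_Poisson_mode, of "measure_pmf.prob (?f m) ?B" m] by simp
  also have "\<dots> \<le> exp 1 * (real m + 1) * measure_pmf.prob (bind_pmf (Poisson (real m)) ?f) ?B"
    using mult_left_mono[OF prob_bind_ge[of "Poisson (real m)" m ?f ?B], of "exp 1 * (real m + 1)"]
    by (simp add: mult.assoc)
  also have "bind_pmf (Poisson (real m)) ?f = Pi_pmf A 0 (\<lambda>e. Poisson (real m * pmf W e))"
    by (rule Poisson_thinning[OF A W, symmetric]) simp
  also have "measure_pmf.prob \<dots> ?B = measure_pmf.prob (bprod A (\<lambda>e. 1 - exp (- (real m * pmf W e)))) {x. R {e \<in> A. x e}}"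
    using A by (subst bprod_Poisson) (auto simp: vimage_def)
  finally show ?thesis using J' by (simp add: m_def)
qed

text \<open>By injectivity each \<open>q\<close> reads one coordinate of \<open>f\<close> and one of
  \<open>g\<close> that no other element of \<open>Q\<close> reads. Redrawing these two coordinates
  splits off an independent pair.\<close>

lemma pairs_law:
  assumes "finite I" "finite J" "finite Q" "a ` Q \<subseteq> I" "b ` Q \<subseteq> J" "inj_on a Q" "inj_on b Q"
  shows "map_pmf (\<lambda>(f, g) q. if q \<in> Q then (f (a q), g (b q)) else z)
      (pair_pmf (Pi_pmf I d (\<lambda>_. U)) (Pi_pmf J d' (\<lambda>_. U'))) = Pi_pmf Q z (\<lambda>_. pair_pmf U U')"
  using assms(3-)
proof (induction Q)
  case empty
  then show ?case by (simp add: case_prod_unfold)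
next
  case (insert q Q)
  let ?F = "Pi_pmf I d (\<lambda>_. U)" and ?G = "Pi_pmf J d' (\<lambda>_. U')"
  have F: "?F = bind_pmf U (\<lambda>x. map_pmf (\<lambda>f. f(a q := x)) ?F)"
    by (rule Pi_pmf_resample) (use assms insert.prems in auto)
  have G: "?G = bind_pmf U' (\<lambda>y. map_pmf (\<lambda>g. g(b q := y)) ?G)"
    by (rule Pi_pmf_resample) (use assms insert.prems in auto)
  have upd: "(\<lambda>r. if r \<in> insert q Q then ((f(a q := x)) (a r), (g(b q := y)) (b r)) else z) =
      (\<lambda>r. if r \<in> Q then (f (a r), g (b r)) else z)(q := (x, y))" for f g x y
    using insert.prems insert.hyps by (auto simp: fun_eq_iff inj_on_def)
  have "map_pmf (\<lambda>(f, g) r. if r \<in> insert q Q then (f (a r), g (b r)) else z) (pair_pmf ?F ?G) =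
      bind_pmf U (\<lambda>x. bind_pmf ?F (\<lambda>f. bind_pmf U' (\<lambda>y. bind_pmf ?G (\<lambda>g.
        return_pmf ((\<lambda>r. if r \<in> Q then (f (a r), g (b r)) else z)(q := (x, y)))))))"
    unfolding pair_pmf_def
    by (subst F, subst G) (simp add: map_pmf_def bind_assoc_pmf bind_return_pmf upd del: fun_upd_apply insert_iff)
  also have "\<dots> = bind_pmf U (\<lambda>x. bind_pmf U' (\<lambda>y. bind_pmf ?F (\<lambda>f. bind_pmf ?G (\<lambda>g.
        return_pmf ((\<lambda>r. if r \<in> Q then (f (a r), g (b r)) else z)(q := (x, y)))))))"
    by (intro bind_pmf_cong refl) (rule bind_commute_pmf)
  also have "\<dots> = bind_pmf (pair_pmf U U') (\<lambda>w. map_pmf (\<lambda>k. k(q := w))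
      (map_pmf (\<lambda>(f, g) r. if r \<in> Q then (f (a r), g (b r)) else z) (pair_pmf ?F ?G)))"
    unfolding pair_pmf_def by (simp add: map_pmf_def bind_assoc_pmf bind_return_pmf del: fun_upd_apply)
  also have "map_pmf (\<lambda>(f, g) r. if r \<in> Q then (f (a r), g (b r)) else z) (pair_pmf ?F ?G) =
      Pi_pmf Q z (\<lambda>_. pair_pmf U U')"
    by (rule insert.IH) (use insert.prems in auto)
  also have "bind_pmf (pair_pmf U U') (\<lambda>w. map_pmf (\<lambda>k. k(q := w)) (Pi_pmf Q z (\<lambda>_. pair_pmf U U'))) =
      Pi_pmf (insert q Q) z (\<lambda>_. pair_pmf U U')"
    using insert.hyps by (subst Pi_pmf_insert') (auto simp: map_pmf_def)
  finally show ?case .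
qed

section \<open>Networks with Poisson degrees\<close>

lemma pairings_image:
  assumes "bij_betw \<phi> I H" "P \<in> pairings I"
  shows "(\<lambda>e. \<phi> ` e) ` P \<in> pairings H"
proof -
  have P: "\<And>e. e \<in> P \<Longrightarrow> e \<subseteq> I \<and> card e = 2" "pairwise disjnt P" "card P = card I div 2"
    using assms(2) by (auto simp: pairings_def)
  have inj: "inj_on \<phi> I" and im: "\<phi> ` I = H" using assms(1) by (auto simp: bij_betw_def)
  have "card (\<phi> ` e) = 2" "\<phi> ` e \<subseteq> H" if "e \<in> P" for e
    using P(1)[OF that] inj im by (auto simp: card_image inj_on_subset)
  moreover have "pairwise disjnt ((\<lambda>e. \<phi> ` e) ` P)"
  proof (rule pairwise_imageI)
    fix e e' assume "e \<in> P" "e' \<in> P" "e \<noteq> e'"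
    then have "disjnt e e'" "e \<subseteq> I" "e' \<subseteq> I" using P by (auto simp: pairwise_def)
    then show "disjnt (\<phi> ` e) (\<phi> ` e')"
      using inj_on_image_Int[OF inj, of e e'] by (auto simp: disjnt_def)
  qed
  moreover have "card ((\<lambda>e. \<phi> ` e) ` P) = card H div 2"
  proof -
    have "inj_on (\<lambda>e. \<phi> ` e) P"
      by (rule inj_on_subset[OF inj_on_image_Pow[OF inj]]) (use P in auto)
    then show ?thesis using P(3) bij_betw_same_card[OF assms(1)] by (simp add: card_image)
  qed
  ultimately show ?thesis by (auto simp: pairings_def)
qed

text \<open>Transports the uniform pairing along a relabelling, so that half-edges may be replaced
  by the numbers below \<open>T\<close>.\<close>

lemma bij_betw_pairings:
  assumes "bij_betw \<phi> I H"
  shows "bij_betw (\<lambda>P. (\<lambda>e. \<phi> ` e) ` P) (pairings I) (pairings H)"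
proof (rule bij_betw_byWitness)
  let ?g = "the_inv_into I \<phi>"
  have g: "bij_betw ?g H I" by (rule bij_betw_the_inv_into[OF assms])
  have inj: "inj_on \<phi> I" and im: "\<phi> ` I = H" using assms by (auto simp: bij_betw_def)
  have gf: "?g ` \<phi> ` e = e" if "e \<subseteq> I" for e
    using that inj by (auto simp: image_image the_inv_into_f_f subset_iff image_iff intro!: bexI)
  have fg: "\<phi> ` ?g ` e = e" if "e \<subseteq> H" for e
    using that inj im by (auto simp: image_image f_the_inv_into_f subset_iff image_iff intro!: bexI)
  show "\<forall>P\<in>pairings I. (\<lambda>e. ?g ` e) ` (\<lambda>e. \<phi> ` e) ` P = P"
  proof
    fix P assume "P \<in> pairings I"
    then have "?g ` \<phi> ` e = e" if "e \<in> P" for e using that gf by (auto simp: pairings_def)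
    then show "(\<lambda>e. ?g ` e) ` (\<lambda>e. \<phi> ` e) ` P = P" by (simp add: image_image cong: image_cong)
  qed
  show "\<forall>P\<in>pairings H. (\<lambda>e. \<phi> ` e) ` (\<lambda>e. ?g ` e) ` P = P"
  proof
    fix P assume "P \<in> pairings H"
    then have "\<phi> ` ?g ` e = e" if "e \<in> P" for e using that fg by (auto simp: pairings_def)
    then show "(\<lambda>e. \<phi> ` e) ` (\<lambda>e. ?g ` e) ` P = P" by (simp add: image_image cong: image_cong)
  qed
  show "(\<lambda>P. (\<lambda>e. \<phi> ` e) ` P) ` pairings I \<subseteq> pairings H" using pairings_image[OF assms] by blast
  show "(\<lambda>P. (\<lambda>e. ?g ` e) ` P) ` pairings H \<subseteq> pairings I" using pairings_image[OF g] by blast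
qed

lemma directed_pairings_image:
  assumes f: "bij_betw \<phi> I H" and g: "bij_betw \<psi> J K" and P: "P \<in> directed_pairings I J"
  shows "map_prod \<phi> \<psi> ` P \<in> directed_pairings H K"
proof -
  have PIJ: "P \<subseteq> I \<times> J" and i: "inj_on fst P" "inj_on snd P" and c: "card P = min (card I) (card J)"
    using P by (auto simp: directed_pairings_def)
  have inj: "inj_on \<phi> I" "inj_on \<psi> J" and im: "\<phi> ` I = H" "\<psi> ` J = K" using f g by (auto simp: bij_betw_def)
  have "inj_on (map_prod \<phi> \<psi>) P" by (rule inj_on_subset[OF map_prod_inj_on[OF inj] PIJ])
  then have "card (map_prod \<phi> \<psi> ` P) = min (card H) (card K)"
    using c bij_betw_same_card[OF f] bij_betw_same_card[OF g] by (simp add: card_image)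
  moreover have "inj_on fst (map_prod \<phi> \<psi> ` P)"
  proof (rule inj_onI, elim imageE)
    fix x y p q assume "fst x = fst y" "x = map_prod \<phi> \<psi> p" "y = map_prod \<phi> \<psi> q" "p \<in> P" "q \<in> P"
    moreover then have "fst p = fst q" using inj(1) by (cases p; cases q) (auto simp: inj_on_def dest!: subsetD[OF PIJ])
    ultimately show "x = y" using i(1) by (auto simp: inj_on_def)
  qed
  moreover have "inj_on snd (map_prod \<phi> \<psi> ` P)"
  proof (rule inj_onI, elim imageE)
    fix x y p q assume "snd x = snd y" "x = map_prod \<phi> \<psi> p" "y = map_prod \<phi> \<psi> q" "p \<in> P" "q \<in> P"
    moreover then have "snd p = snd q" using inj(2) by (cases p; cases q) (auto simp: inj_on_def dest!: subsetD[OF PIJ])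
    ultimately show "x = y" using i(2) by (auto simp: inj_on_def)
  qed
  ultimately show ?thesis using PIJ im by (auto simp: directed_pairings_def)
qed

lemma bij_betw_directed_pairings:
  assumes f: "bij_betw \<phi> I H" and g: "bij_betw \<psi> J K"
  shows "bij_betw (\<lambda>P. map_prod \<phi> \<psi> ` P) (directed_pairings I J) (directed_pairings H K)"
proof (rule bij_betw_byWitness)
  let ?f = "the_inv_into I \<phi>" and ?g = "the_inv_into J \<psi>"
  have f': "bij_betw ?f H I" and g': "bij_betw ?g K J" using f g by (auto intro: bij_betw_the_inv_into)
  have inj: "inj_on \<phi> I" "inj_on \<psi> J" and im: "\<phi> ` I = H" "\<psi> ` J = K" using f g by (auto simp: bij_betw_def)
  show "\<forall>P\<in>directed_pairings I J. map_prod ?f ?g ` map_prod \<phi> \<psi> ` P = P"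
  proof
    fix P assume "P \<in> directed_pairings I J"
    then have "map_prod ?f ?g (map_prod \<phi> \<psi> x) = x" if "x \<in> P" for x
      using that inj by (cases x) (auto simp: directed_pairings_def the_inv_into_f_f subset_iff)
    then show "map_prod ?f ?g ` map_prod \<phi> \<psi> ` P = P" by (simp add: image_image cong: image_cong)
  qed
  show "\<forall>P\<in>directed_pairings H K. map_prod \<phi> \<psi> ` map_prod ?f ?g ` P = P"
  proof
    fix P assume "P \<in> directed_pairings H K"
    then have "map_prod \<phi> \<psi> (map_prod ?f ?g x) = x" if "x \<in> P" for x
      using that inj im by (cases x) (auto simp: directed_pairings_def f_the_inv_into_f subset_iff)
    then show "map_prod \<phi> \<psi> ` map_prod ?f ?g ` P = P" by (simp add: image_image cong: image_cong)
  qed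
  show "(\<lambda>P. map_prod \<phi> \<psi> ` P) ` directed_pairings I J \<subseteq> directed_pairings H K"
    using directed_pairings_image[OF f g] by blast
  show "(\<lambda>P. map_prod ?f ?g ` P) ` directed_pairings H K \<subseteq> directed_pairings I J"
    using directed_pairings_image[OF f' g'] by blast
qed

text \<open>The draws with value \<open>i\<close> are numbered and identified with the half-edges at
  \<open>i\<close>; draw \<open>j\<close> thus becomes a half-edge at vertex
  \<open>h j\<close>.\<close>

lemma half_edges_bij:
  fixes T n :: nat
  assumes h: "h ` {..<T} \<subseteq> V n"
  defines "D \<equiv> \<lambda>i. if i \<in> V n then card {j \<in> {..<T}. h j = i} else 0"
  obtains \<phi> where "bij_betw \<phi> {..<T} (half_edges n D)" "\<And>j. j < T \<Longrightarrow> fst (\<phi> j) = h j"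
proof -
  have fin: "finite {j \<in> {..<T}. h j = i}" for i by (rule finite_subset[of _ "{..<T}"]) auto
  have "\<exists>f. bij_betw f {j \<in> {..<T}. h j = i} {..<card {j \<in> {..<T}. h j = i}}" for i
    by (rule finite_same_card_bij[OF fin]) (simp_all only: finite_lessThan card_lessThan)
  then obtain f where f: "\<And>i. bij_betw (f i) {j \<in> {..<T}. h j = i} {..<card {j \<in> {..<T}. h j = i}}" by metis
  define \<phi> where "\<phi> = (\<lambda>j. (h j, f (h j) j))"
  have "bij_betw \<phi> {..<T} (half_edges n D)"
  proof (rule bij_betw_imageI)
    show "inj_on \<phi> {..<T}"
    proof (rule inj_onI)
      fix i j assume "i \<in> {..<T}" "j \<in> {..<T}" "\<phi> i = \<phi> j"
      moreover have "inj_on (f (h i)) {k \<in> {..<T}. h k = h i}" using f by (auto simp: bij_betw_def)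
      ultimately show "i = j" by (auto simp: \<phi>_def inj_on_def)
    qed
    show "\<phi> ` {..<T} = half_edges n D"
    proof (intro equalityI subsetI)
      fix y assume "y \<in> \<phi> ` {..<T}"
      then obtain j where j: "j < T" "y = (h j, f (h j) j)" by (auto simp: \<phi>_def)
      have "f (h j) j \<in> {..<card {k \<in> {..<T}. h k = h j}}" using f[of "h j"] j by (auto simp: bij_betw_def)
      then show "y \<in> half_edges n D" using h j by (auto simp: half_edges_def D_def)
    next
      fix y assume "y \<in> half_edges n D"
      then obtain i k where ik: "y = (i, k)" "i \<in> V n" "k \<in> {..<card {j \<in> {..<T}. h j = i}}"
        by (auto simp: half_edges_def D_def)
      then have "k \<in> f i ` {j \<in> {..<T}. h j = i}" using f[of i] by (simp add: bij_betw_def)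
      then show "y \<in> \<phi> ` {..<T}" using ik by (auto simp: \<phi>_def)
    qed
  qed
  then show ?thesis by (rule that) (simp add: \<phi>_def)
qed

abbreviation unif :: "nat \<Rightarrow> nat pmf" where
  "unif n \<equiv> pmf_of_set (V n)"

abbreviation labels :: "nat \<Rightarrow> nat \<Rightarrow> (nat \<Rightarrow> nat) pmf" where
  "labels n T \<equiv> Pi_pmf {..<T} 0 (\<lambda>_. unif n)"

lemma V_nonempty: "0 < n \<Longrightarrow> V n \<noteq> {}"
  by (auto simp: V_def)

lemma labels_in_V: "0 < n \<Longrightarrow> h \<in> set_pmf (labels n T) \<Longrightarrow> h ` {..<T} \<subseteq> V n"
  using V_nonempty by (auto simp: set_Pi_pmf PiE_dflt_def)

lemma Poisson_degrees:
  assumes "0 < n" "0 \<le> r"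
  shows "Pi_pmf (V n) 0 (\<lambda>_. Poisson r) = bind_pmf (Poisson (real n * r)) (\<lambda>T.
    map_pmf (\<lambda>h i. if i \<in> V n then card {j \<in> {..<T}. h j = i} else 0) (labels n T))"
proof -
  have "Pi_pmf (V n) 0 (\<lambda>_. Poisson r) = Pi_pmf (V n) 0 (\<lambda>i. Poisson (real n * r * pmf (unif n) i))"
    using assms V_nonempty[OF assms(1)] by (intro Pi_pmf_cong) (auto simp: pmf_of_set)
  also have "\<dots> = bind_pmf (Poisson (real n * r)) (\<lambda>T.
    map_pmf (\<lambda>h i. if i \<in> V n then card {j \<in> {..<T}. h j = i} else 0) (labels n T))"
    by (rule Poisson_thinning) (use assms V_nonempty in auto)
  finally show ?thesis .
qed

text \<open>Once the degrees arise from \<open>T\<close> uniform labels, the half-edges are the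
  numbers below \<open>T\<close> and the pairing no longer depends on the labels. The order of the
  draws may then be exchanged: first the pairing, then independent uniform end points.\<close>

lemma DD_undirected_eq:
  assumes "0 < n" "0 \<le> r"
  shows "DD_undirected (Poisson r) n = bind_pmf (Poisson (real n * r)) (\<lambda>T.
    bind_pmf (pmf_of_set (pairings {..<T})) (\<lambda>Q. map_pmf (\<lambda>h. arcs_of ((\<lambda>e. h ` e) ` Q)) (labels n T)))"
proof -
  let ?D = "\<lambda>T h i. if i \<in> V n then card {j \<in> {..<T}. h j = i} else 0"
  have inner: "map_pmf (\<lambda>P. arcs_of ((\<lambda>e. fst ` e) ` P)) (pmf_of_set (pairings (half_edges n (?D T h)))) =
      map_pmf (\<lambda>Q. arcs_of ((\<lambda>e. h ` e) ` Q)) (pmf_of_set (pairings {..<T}))"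
    if hT: "h \<in> set_pmf (labels n T)" for h T
  proof -
    obtain \<phi> where \<phi>: "bij_betw \<phi> {..<T} (half_edges n (?D T h))" "\<And>j. j < T \<Longrightarrow> fst (\<phi> j) = h j"
      using half_edges_bij[OF labels_in_V[OF assms(1) hT]] by blast
    have "pmf_of_set (pairings (half_edges n (?D T h))) =
        map_pmf (\<lambda>P. (\<lambda>e. \<phi> ` e) ` P) (pmf_of_set (pairings {..<T}))"
      by (rule map_pmf_of_set_bij_betw[symmetric]) (simp_all add: bij_betw_pairings[OF \<phi>(1)] pairings_nonempty finite_pairings)
    moreover have "(\<lambda>e. fst ` e) ` (\<lambda>e. \<phi> ` e) ` Q = (\<lambda>e. h ` e) ` Q" if Q: "Q \<in> set_pmf (pmf_of_set (pairings {..<T}))" for Q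
    proof -
      have "Q \<in> pairings {..<T}" using Q by (simp add: set_pmf_of_set pairings_nonempty finite_pairings)
      then have "fst ` \<phi> ` e = h ` e" if "e \<in> Q" for e
        using that \<phi>(2) by (force simp: pairings_def image_image intro!: image_cong)
      then show ?thesis by (simp add: image_image cong: image_cong)
    qed
    ultimately show ?thesis by (simp add: pmf.map_comp o_def cong: map_pmf_cong)
  qed
  have "DD_undirected (Poisson r) n = bind_pmf (Poisson (real n * r)) (\<lambda>T. bind_pmf (labels n T) (\<lambda>h.
      map_pmf (\<lambda>P. arcs_of ((\<lambda>e. fst ` e) ` P)) (pmf_of_set (pairings (half_edges n (?D T h))))))"
    unfolding DD_undirected_def Poisson_degrees[OF assms] by (simp add: bind_assoc_pmf bind_map_pmf)
  also have "\<dots> = bind_pmf (Poisson (real n * r)) (\<lambda>T. bind_pmf (labels n T) (\<lambda>h.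
      map_pmf (\<lambda>Q. arcs_of ((\<lambda>e. h ` e) ` Q)) (pmf_of_set (pairings {..<T}))))"
    by (intro bind_pmf_cong refl inner)
  also have "\<dots> = bind_pmf (Poisson (real n * r)) (\<lambda>T. bind_pmf (pmf_of_set (pairings {..<T})) (\<lambda>Q.
      map_pmf (\<lambda>h. arcs_of ((\<lambda>e. h ` e) ` Q)) (labels n T)))"
    unfolding map_pmf_def by (intro bind_pmf_cong refl) (rule bind_commute_pmf)
  finally show ?thesis .
qed

text \<open>As in the undirected case, with two independent families of labels. \<open>T\<close> is
  the total in-degree and \<open>T'\<close> the total out-degree, so arcs lead from labels
  \<open>f\<close> below \<open>T'\<close> to labels \<open>g\<close> below
  \<open>T\<close>.\<close>

lemma DD_directed_eq:
  assumes "0 < n" "0 \<le> r"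
  shows "DD_directed (Poisson r) (Poisson r) n =
    bind_pmf (pair_pmf (Poisson (real n * r)) (Poisson (real n * r))) (\<lambda>(T, T').
      bind_pmf (pmf_of_set (directed_pairings {..<T'} {..<T})) (\<lambda>Q.
        map_pmf (\<lambda>(f, g). (\<lambda>(x, y). (f x, g y)) ` Q) (pair_pmf (labels n T') (labels n T))))"
proof -
  let ?D = "\<lambda>T h i. if i \<in> V n then card {j \<in> {..<T}. h j = i} else 0"
  have inner: "map_pmf (\<lambda>P. (\<lambda>(x, y). (fst x, fst y)) ` P)
      (pmf_of_set (directed_pairings (half_edges n (?D T' f)) (half_edges n (?D T g)))) =
      map_pmf (\<lambda>Q. (\<lambda>(x, y). (f x, g y)) ` Q) (pmf_of_set (directed_pairings {..<T'} {..<T}))"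
    if fT: "f \<in> set_pmf (labels n T')" and gT: "g \<in> set_pmf (labels n T)" for f g T T'
  proof -
    obtain \<phi> where \<phi>: "bij_betw \<phi> {..<T'} (half_edges n (?D T' f))" "\<And>j. j < T' \<Longrightarrow> fst (\<phi> j) = f j"
      using half_edges_bij[OF labels_in_V[OF assms(1) fT]] by blast
    obtain \<psi> where \<psi>: "bij_betw \<psi> {..<T} (half_edges n (?D T g))" "\<And>j. j < T \<Longrightarrow> fst (\<psi> j) = g j"
      using half_edges_bij[OF labels_in_V[OF assms(1) gT]] by blast
    have "pmf_of_set (directed_pairings (half_edges n (?D T' f)) (half_edges n (?D T g))) =
        map_pmf (\<lambda>P. map_prod \<phi> \<psi> ` P) (pmf_of_set (directed_pairings {..<T'} {..<T}))"
      by (rule map_pmf_of_set_bij_betw[symmetric])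
         (simp_all add: bij_betw_directed_pairings[OF \<phi>(1) \<psi>(1)] directed_pairings_nonempty finite_directed_pairings)
    moreover have "(\<lambda>(x, y). (fst x, fst y)) ` map_prod \<phi> \<psi> ` Q = (\<lambda>(x, y). (f x, g y)) ` Q"
      if Q: "Q \<in> set_pmf (pmf_of_set (directed_pairings {..<T'} {..<T}))" for Q
    proof -
      have "Q \<in> directed_pairings {..<T'} {..<T}"
        using Q by (simp add: set_pmf_of_set directed_pairings_nonempty finite_directed_pairings)
      then have "(\<lambda>(x, y). (fst x, fst y)) (map_prod \<phi> \<psi> w) = (\<lambda>(x, y). (f x, g y)) w" if "w \<in> Q" for w
        using that \<phi>(2) \<psi>(2) by (auto simp: directed_pairings_def)
      then show ?thesis unfolding image_image by (rule image_cong[OF refl])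
    qed
    ultimately show ?thesis by (simp add: pmf.map_comp o_def cong: map_pmf_cong)
  qed
  have "DD_directed (Poisson r) (Poisson r) n = bind_pmf (Poisson (real n * r)) (\<lambda>T. bind_pmf (labels n T) (\<lambda>g.
      bind_pmf (Poisson (real n * r)) (\<lambda>T'. bind_pmf (labels n T') (\<lambda>f.
      map_pmf (\<lambda>P. (\<lambda>(x, y). (fst x, fst y)) ` P)
      (pmf_of_set (directed_pairings (half_edges n (?D T' f)) (half_edges n (?D T g))))))))"
    unfolding DD_directed_def Poisson_degrees[OF assms] by (simp add: bind_assoc_pmf bind_map_pmf)
  also have "\<dots> = bind_pmf (Poisson (real n * r)) (\<lambda>T. bind_pmf (labels n T) (\<lambda>g.
      bind_pmf (Poisson (real n * r)) (\<lambda>T'. bind_pmf (labels n T') (\<lambda>f.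
      map_pmf (\<lambda>Q. (\<lambda>(x, y). (f x, g y)) ` Q) (pmf_of_set (directed_pairings {..<T'} {..<T}))))))"
    by (intro bind_pmf_cong refl inner)
  also have "\<dots> = bind_pmf (Poisson (real n * r)) (\<lambda>T. bind_pmf (Poisson (real n * r)) (\<lambda>T'.
      bind_pmf (labels n T) (\<lambda>g. bind_pmf (labels n T') (\<lambda>f.
      map_pmf (\<lambda>Q. (\<lambda>(x, y). (f x, g y)) ` Q) (pmf_of_set (directed_pairings {..<T'} {..<T}))))))"
    by (rule bind_pmf_cong[OF refl], rule bind_commute_pmf)
  also have "\<dots> = bind_pmf (Poisson (real n * r)) (\<lambda>T. bind_pmf (Poisson (real n * r)) (\<lambda>T'.
      bind_pmf (labels n T') (\<lambda>f. bind_pmf (labels n T) (\<lambda>g.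
      bind_pmf (pmf_of_set (directed_pairings {..<T'} {..<T})) (\<lambda>Q. return_pmf ((\<lambda>(x, y). (f x, g y)) ` Q))))))"
    unfolding map_pmf_def by (rule bind_pmf_cong[OF refl], rule bind_pmf_cong[OF refl], rule bind_commute_pmf)
  also have "\<dots> = bind_pmf (Poisson (real n * r)) (\<lambda>T. bind_pmf (Poisson (real n * r)) (\<lambda>T'.
      bind_pmf (labels n T') (\<lambda>f. bind_pmf (pmf_of_set (directed_pairings {..<T'} {..<T})) (\<lambda>Q.
      bind_pmf (labels n T) (\<lambda>g. return_pmf ((\<lambda>(x, y). (f x, g y)) ` Q))))))"
    by (rule bind_pmf_cong[OF refl], rule bind_pmf_cong[OF refl], rule bind_pmf_cong[OF refl], rule bind_commute_pmf)
  also have "\<dots> = bind_pmf (Poisson (real n * r)) (\<lambda>T. bind_pmf (Poisson (real n * r)) (\<lambda>T'.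
      bind_pmf (pmf_of_set (directed_pairings {..<T'} {..<T})) (\<lambda>Q. bind_pmf (labels n T') (\<lambda>f.
      bind_pmf (labels n T) (\<lambda>g. return_pmf ((\<lambda>(x, y). (f x, g y)) ` Q))))))"
    by (rule bind_pmf_cong[OF refl], rule bind_pmf_cong[OF refl], rule bind_commute_pmf)
  finally show ?thesis
    by (simp add: pair_pmf_def map_pmf_def bind_assoc_pmf bind_return_pmf)
qed

lemma pair_unif: "0 < n \<Longrightarrow> pair_pmf (unif n) (unif n) = pmf_of_set (V n \<times> V n)"
  using V_nonempty by (rule_tac pmf_eqI) (auto simp: pmf_pair pmf_of_set card_cartesian_product indicator_def)

text \<open>The \<open>m\<close> arcs are independent and uniform among \<open>n ^ 2\<close> ordered
  pairs, so each pair, including the loops, receives Poisson rate \<open>m / n ^ 2\<close>.\<close>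

lemma directed_le_bit_net:
  assumes n: "0 < n" and Q: "Q \<in> directed_pairings {..<T'} {..<T}"
  defines "m \<equiv> min T T'"
  defines "p \<equiv> 1 - exp (- (real m / (real n)\<^sup>2))"
  shows "measure_pmf.prob (map_pmf (\<lambda>(f, g). (\<lambda>(x, y). (f x, g y)) ` Q) (pair_pmf (labels n T') (labels n T))) B \<le>
    exp 1 * (real m + 1) * measure_pmf.prob (bit_net n bit_dir p p) B"
proof -
  have QI: "Q \<subseteq> {..<T'} \<times> {..<T}" and inj: "inj_on fst Q" "inj_on snd Q" and c: "card Q = m"
    using Q by (auto simp: directed_pairings_def m_def)
  have fQ: "finite Q" by (rule finite_subset[OF QI]) simp
  let ?W = "pair_pmf (unif n) (unif n)"
  have "Pi_pmf Q (0, 0) (\<lambda>_. ?W) = map_pmf (\<lambda>(f, g) q. if q \<in> Q then (f (fst q), g (snd q)) else (0, 0))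
      (pair_pmf (labels n T') (labels n T))"
    by (rule pairs_law[symmetric]) (use QI inj fQ in auto)
  then have "measure_pmf.prob (Pi_pmf Q (0, 0) (\<lambda>_. ?W)) {h. h ` Q \<in> B} =
      measure_pmf.prob (map_pmf (\<lambda>(f, g). (\<lambda>(x, y). (f x, g y)) ` Q) (pair_pmf (labels n T') (labels n T))) B"
  proof -
    have "(\<lambda>q. if q \<in> Q then (f (fst q), g (snd q)) else (0, 0)) ` Q = (\<lambda>(x, y). (f x, g y)) ` Q" for f g :: "nat \<Rightarrow> nat"
      by (rule image_cong[OF refl]) (auto split: prod.splits)
    then show ?thesis
      unfolding \<open>Pi_pmf Q (0, 0) (\<lambda>_. ?W) = _\<close> by (simp add: vimage_def case_prod_unfold)
  qed
  moreover have "measure_pmf.prob (Pi_pmf Q (0, 0) (\<lambda>_. ?W)) {h. h ` Q \<in> B} \<le> exp 1 * (real (card Q) + 1) *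
      measure_pmf.prob (bprod (V n \<times> V n) (\<lambda>e. 1 - exp (- (real (card Q) * pmf ?W e)))) {x. {e \<in> V n \<times> V n. x e} \<in> B}"
    by (rule poissonization) (use n V_nonempty fQ in auto)
  moreover have "bprod (V n \<times> V n) (\<lambda>e. 1 - exp (- (real (card Q) * pmf ?W e))) = bprod (V n \<times> V n) (\<lambda>_. p)"
    unfolding bprod_def
  proof (rule Pi_pmf_cong[OF refl refl])
    fix e assume "e \<in> V n \<times> V n"
    then have "pmf ?W e = 1 / (real n)\<^sup>2"
      unfolding pair_unif[OF n] using V_nonempty[OF n] by (simp add: pmf_of_set card_cartesian_product power2_eq_square)
    then show "bernoulli_pmf (1 - exp (- (real (card Q) * pmf ?W e))) = bernoulli_pmf p" by (simp add: p_def c)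
  qed
  moreover have "measure_pmf.prob (bprod (V n \<times> V n) (\<lambda>_. p)) {x. {e \<in> V n \<times> V n. x e} \<in> B} =
      measure_pmf.prob (bit_net n bit_dir p p) B"
  proof -
    have "{(i, j). i \<in> V n \<and> j \<in> V n \<and> x (i, j)} = {e \<in> V n \<times> V n. x e}" for x by auto
    then show ?thesis by (simp add: bit_net_def bit_dir_def vimage_def)
  qed
  ultimately show ?thesis using c by simp
qed

text \<open>An edge between distinct vertices arises from two ordered pairs of labels, a loop from
  one; hence the rates \<open>2 * m / n ^ 2\<close> and \<open>m / n ^ 2\<close>.\<close>

lemma undirected_le_bit_net:
  assumes n: "0 < n" and Q: "Q \<in> pairings {..<T}"
  defines "m \<equiv> T div 2"
  shows "measure_pmf.prob (map_pmf (\<lambda>h. arcs_of ((\<lambda>e. h ` e) ` Q)) (labels n T)) B \<le> exp 1 * (real m + 1) *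
    measure_pmf.prob (bit_net n bit_und (1 - exp (- (2 * real m / (real n)\<^sup>2))) (1 - exp (- (real m / (real n)\<^sup>2)))) B"
proof -
  have Qe: "\<And>e. e \<in> Q \<Longrightarrow> e \<subseteq> {..<T} \<and> card e = 2" and dis: "pairwise disjnt Q" and c: "card Q = m"
    using Q by (auto simp: pairings_def m_def)
  have fQ: "finite Q" by (rule finite_subset[of _ "Pow {..<T}"]) (use Qe in auto)
  have mm: "Min e \<in> e" "Max e \<in> e" "e = {Min e, Max e}" "Min e \<noteq> Max e" if eQ: "e \<in> Q" for e
  proof -
    obtain x y where xy: "e = {x, y}" "x \<noteq> y" using Qe[OF eQ] by (auto simp: card_2_iff)
    then show "Min e \<in> e" "Max e \<in> e" by (auto intro: Min_in Max_in)
    show "e = {Min e, Max e}" "Min e \<noteq> Max e" using xy by (auto simp: min_def max_def)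
  qed
  have same: "e = e'" if "e \<in> Q" "e' \<in> Q" "x \<in> e" "x \<in> e'" for e e' x
    using dis that by (auto simp: pairwise_def disjnt_def)
  have inj: "inj_on Min Q" "inj_on Max Q" using same mm by (auto simp: inj_on_def) metis+
  have disj: "Min e \<noteq> Max e'" if "e \<in> Q" "e' \<in> Q" for e e'
    using same[OF that, of "Min e"] mm[OF that(1)] mm[OF that(2)] by metis
  \<comment> \<open>Ordering the ends of each pair as minimum and maximum splits the labels into two
    independent families, as \<open>pairs_law\<close> demands. \<open>J\<close> is everything else
    and contains the unpaired half-edge if there is one.\<close>
  define I where "I = Min ` Q"
  define J where "J = {..<T} - I"
  have I: "I \<subseteq> {..<T}" using mm Qe by (force simp: I_def)
  have fin: "finite I" "finite J" using fQ by (auto simp: I_def J_def)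
  let ?P = "pair_pmf (unif n) (unif n)"
  let ?W = "map_pmf bit_und ?P"
  have "labels n T = Pi_pmf (I \<union> J) 0 (\<lambda>_. unif n)" using I by (simp add: J_def Un_absorb1)
  also have "\<dots> = map_pmf (\<lambda>(f, g) x. if x \<in> I then f x else g x) (pair_pmf (Pi_pmf I 0 (\<lambda>_. unif n)) (Pi_pmf J 0 (\<lambda>_. unif n)))"
    by (rule Pi_pmf_union) (use fin in \<open>auto simp: J_def\<close>)
  finally have lab: "labels n T = \<dots>" .
  have law: "Pi_pmf Q (0, 0) (\<lambda>_. ?P) = map_pmf (\<lambda>(f, g) e. if e \<in> Q then (f (Min e), g (Max e)) else (0, 0))
      (pair_pmf (Pi_pmf I 0 (\<lambda>_. unif n)) (Pi_pmf J 0 (\<lambda>_. unif n)))"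
  proof (rule pairs_law[symmetric])
    show "Max ` Q \<subseteq> J" using mm Qe disj by (force simp: J_def I_def)
  qed (use fin fQ inj in \<open>auto simp: I_def\<close>)
  have map: "Pi_pmf Q (bit_und (0, 0)) (\<lambda>_. ?W) = map_pmf (\<lambda>h. bit_und \<circ> h) (Pi_pmf Q (0, 0) (\<lambda>_. ?P))"
    by (rule Pi_pmf_map[OF fQ refl])
  have im: "(bit_und \<circ> (\<lambda>e. if e \<in> Q then (f (Min e), g (Max e)) else (0, 0))) ` Q =
      (\<lambda>e. (\<lambda>x. if x \<in> I then f x else g x) ` e) ` Q" for f g
  proof (rule image_cong[OF refl])
    fix e assume e: "e \<in> Q"
    have "(\<lambda>x. if x \<in> I then f x else g x) ` e = {if Min e \<in> I then f (Min e) else g (Min e), if Max e \<in> I then f (Max e) else g (Max e)}"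
      by (subst (1) mm(3)[OF e]) simp
    also have "\<dots> = {f (Min e), g (Max e)}" using e disj by (force simp: I_def)
    finally show "(bit_und \<circ> (\<lambda>e. if e \<in> Q then (f (Min e), g (Max e)) else (0, 0))) e = (\<lambda>x. if x \<in> I then f x else g x) ` e"
      using e by (simp add: bit_und_def)
  qed
  have "map_pmf (\<lambda>h. arcs_of ((\<lambda>e. h ` e) ` Q)) (labels n T) =
      map_pmf (\<lambda>h. arcs_of (h ` Q)) (Pi_pmf Q (bit_und (0, 0)) (\<lambda>_. ?W))"
    unfolding map law lab pmf.map_comp
  proof (rule map_pmf_cong[OF refl])
    fix w
    show "((\<lambda>h. arcs_of ((\<lambda>e. h ` e) ` Q)) \<circ> (\<lambda>(f, g) x. if x \<in> I then f x else g x)) w =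
      ((\<lambda>h. arcs_of (h ` Q)) \<circ> ((\<lambda>h. bit_und \<circ> h) \<circ> (\<lambda>(f, g) e. if e \<in> Q then (f (Min e), g (Max e)) else (0, 0)))) w"
      by (cases w) (simp only: o_apply prod.case im)
  qed
  then have "measure_pmf.prob (map_pmf (\<lambda>h. arcs_of ((\<lambda>e. h ` e) ` Q)) (labels n T)) B =
      measure_pmf.prob (Pi_pmf Q (bit_und (0, 0)) (\<lambda>_. ?W)) {h. arcs_of (h ` Q) \<in> B}"
    by (simp add: vimage_def)
  also have "\<dots> \<le> exp 1 * (real (card Q) + 1) * measure_pmf.prob (bprod (bit_und ` (V n \<times> V n))
      (\<lambda>e. 1 - exp (- (real (card Q) * pmf ?W e)))) {x. arcs_of {e \<in> bit_und ` (V n \<times> V n). x e} \<in> B}"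
    by (rule poissonization) (use n V_nonempty fQ in auto)
  also have "bprod (bit_und ` (V n \<times> V n)) (\<lambda>e. 1 - exp (- (real (card Q) * pmf ?W e))) =
      bprod (bit_und ` (V n \<times> V n)) (\<lambda>e. if \<exists>i\<in>V n. e = bit_und (i, i)
        then 1 - exp (- (real m / (real n)\<^sup>2)) else 1 - exp (- (2 * real m / (real n)\<^sup>2)))"
    unfolding bprod_def
  proof (rule Pi_pmf_cong[OF refl refl])
    fix e assume "e \<in> bit_und ` (V n \<times> V n)"
    then obtain i j where ij: "i \<in> V n" "j \<in> V n" "e = {i, j}" by (auto simp: bit_und_def)
    have "pmf ?W e = real (card ((V n \<times> V n) \<inter> (bit_und -` {e}))) / real (card (V n \<times> V n))"
      unfolding pmf_map pair_unif[OF n] using V_nonempty[OF n] by (simp add: measure_pmf_of_set)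
    also have "(V n \<times> V n) \<inter> (bit_und -` {e}) = {(i, j), (j, i)}"
    proof (rule set_eqI)
      fix w :: "nat \<times> nat"
      obtain a b where w: "w = (a, b)" by (cases w)
      show "w \<in> (V n \<times> V n) \<inter> (bit_und -` {e}) \<longleftrightarrow> w \<in> {(i, j), (j, i)}"
        using ij(1,2) unfolding w ij(3)
        by (simp only: Int_iff mem_Sigma_iff vimage_eq bit_und_def prod.case singleton_iff doubleton_eq_iff
            insert_iff empty_iff prod.inject) blast
    qed
    also have "card {(i, j), (j, i)} = (if i = j then 1 else 2)"
    proof (cases "i = j")
      case False
      then have "(i, j) \<noteq> (j, i)" by blast
      then have "card {(i, j), (j, i)} = 2" using card_2_iff[of "{(i, j), (j, i)}"] by blast
      then show ?thesis using False by (simp only: if_False)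
    qed simp
    finally have W: "pmf ?W e = (if i = j then 1 else 2) / (real n)\<^sup>2"
      by (simp add: card_cartesian_product power2_eq_square)
    have d: "(\<exists>i\<in>V n. e = bit_und (i, i)) \<longleftrightarrow> i = j" using ij by (auto simp: bit_und_def doubleton_eq_iff)
    show "bernoulli_pmf (1 - exp (- (real (card Q) * pmf ?W e))) = bernoulli_pmf (if \<exists>i\<in>V n. e = bit_und (i, i)
        then 1 - exp (- (real m / (real n)\<^sup>2)) else 1 - exp (- (2 * real m / (real n)\<^sup>2)))"
      unfolding d W c by (simp add: mult.commute)
  qed
  also have "measure_pmf.prob (bprod (bit_und ` (V n \<times> V n)) (\<lambda>e. if \<exists>i\<in>V n. e = bit_und (i, i)
        then 1 - exp (- (real m / (real n)\<^sup>2)) else 1 - exp (- (2 * real m / (real n)\<^sup>2))))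
        {x. arcs_of {e \<in> bit_und ` (V n \<times> V n). x e} \<in> B} =
      measure_pmf.prob (bit_net n bit_und (1 - exp (- (2 * real m / (real n)\<^sup>2))) (1 - exp (- (real m / (real n)\<^sup>2)))) B"
  proof -
    have "arcs_of {e \<in> bit_und ` (V n \<times> V n). x e} = {(i, j). i \<in> V n \<and> j \<in> V n \<and> x (bit_und (i, j))}" for x
      by (subst arcs_of_und[of _ n, symmetric]) (auto simp: bit_und_def)
    then show ?thesis by (simp add: bit_net_def vimage_def)
  qed
  finally show ?thesis by (simp add: c)
qed

section \<open>Mixtures over the number of edges\<close>

lemma prob_bind_le_support:
  assumes "\<And>x. x \<in> set_pmf N \<Longrightarrow> measure_pmf.prob (f x) B \<le> c" "0 \<le> c"
  shows "measure_pmf.prob (bind_pmf N f) B \<le> c"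
proof -
  have "measure_pmf.prob N (- set_pmf N) = 0" by (simp add: measure_pmf_zero_iff)
  then show ?thesis using prob_bind_le[of "set_pmf N" f B c N] assms by simp
qed

text \<open>Given \<open>t\<close> there are \<open>m t\<close> edges; \<open>w\<close> is 2 in the
  undirected and 1 in the directed model. If \<open>m t\<close> is close to its typical value, the
  bound for independent bits applies, and the factor \<open>m t + 1\<close> of poissonization is
  linear in \<open>n\<close>. Other values of \<open>t\<close> are exponentially unlikely.\<close>

lemma greedy_cc_mixture_finite:
  fixes bt :: "nat \<times> nat \<Rightarrow> 'e" and m :: "'t \<Rightarrow> nat"
  assumes lam: "0 \<le> lam" and w: "1 \<le> w" and ok: "\<And>n. bit_ok n bt"
    and law: "\<And>n. 0 < n \<Longrightarrow> law n = bind_pmf (N n) (f n)"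
    and dom: "\<And>n t B. 0 < n \<Longrightarrow> measure_pmf.prob (f n t) B \<le> exp 1 * (real (m t) + 1) *
      measure_pmf.prob (bit_net n bt (1 - exp (- (w * real (m t) / (real n)\<^sup>2))) (1 - exp (- (real (m t) / (real n)\<^sup>2)))) B"
    and tail: "\<And>\<eta>. 0 < \<eta> \<Longrightarrow> \<exists>c>0. \<exists>K\<ge>0. \<forall>\<^sub>F n in sequentially.
      measure_pmf.prob (N n) {t. \<eta> < \<bar>w * real (m t) / real n - lam\<bar>} \<le> K * exp (- c * real n)"
  shows "greedy_cc law (1 - free_limit lam)"
  unfolding greedy_cc_def
proof (intro allI impI)
  fix eps :: real assume eps: "0 < eps"
  obtain \<delta> \<gamma> n0 where d: "0 < \<delta>" "0 < \<gamma>" and b: "\<forall>n\<ge>n0. \<forall>S p q (bt :: nat \<times> nat \<Rightarrow> 'e).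
    valid_rule S \<longrightarrow> bit_ok n bt \<longrightarrow> 0 \<le> q \<longrightarrow> q \<le> p \<longrightarrow> p \<le> 1 \<longrightarrow> \<bar>real n * p - lam\<bar> < \<delta> \<longrightarrow>
    measure_pmf.prob (bit_net n bt p q) (greedy_dev S n (1 - free_limit lam) eps) \<le> 4 * exp (- \<gamma> * real n)"
    using bit_net_greedy[OF lam eps, where 'e = 'e] unfolding greedy_dev_def by blast
  define \<eta> where "\<eta> = min (\<delta> / 4) 1"
  have \<eta>: "0 < \<eta>" "\<eta> \<le> \<delta> / 4" "\<eta> \<le> 1" using d by (auto simp: \<eta>_def)
  obtain c K where c: "0 < c" "0 \<le> K" and tl: "\<forall>\<^sub>F n in sequentially.
      measure_pmf.prob (N n) {t. \<eta> < \<bar>w * real (m t) / real n - lam\<bar>} \<le> K * exp (- c * real n)"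
    using tail[OF \<eta>(1)] by blast
  define X where "X = lam + 1"
  have X: "1 \<le> X" using lam by (simp add: X_def)
  define g where "g = min c \<gamma>"
  have g: "0 < g" "g \<le> c" "g \<le> \<gamma>" using c d by (auto simp: g_def)
  define K' where "K' = K + exp 1 * (X + 1) * 4"
  \<comment> \<open>Bounds \<open>n\<close> times the difference between
    \<open>1 - exp (- y)\<close> and \<open>y\<close>, where \<open>y\<close> is at most
    \<open>X / n\<close>.\<close>
  have "\<forall>\<^sub>F n in sequentially. X\<^sup>2 / real n \<le> \<delta> / 4" using d by (intro eventually_div_le) simp
  then have "\<forall>\<^sub>F n in sequentially. \<forall>S. valid_rule S \<longrightarrow> measure_pmf.prob (law n)
      (greedy_dev S n (1 - free_limit lam) eps) \<le> (real n ^ 2 + 1) * (K' * exp (- g * real n))"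
    using tl eventually_ge_at_top[of "max n0 (nat \<lceil>X\<rceil> + 1)"]
  proof eventually_elim
    case (elim n)
    have n: "0 < n" "n0 \<le> n" "X \<le> real n" using elim(3) by (auto simp: max_def split: if_splits) linarith+
    show ?case
    proof (intro allI impI)
      fix S assume S: "valid_rule S"
      let ?B = "greedy_dev S n (1 - free_limit lam) eps"
      let ?W = "{t. \<bar>w * real (m t) / real n - lam\<bar> \<le> \<eta>}"
      have "measure_pmf.prob (f n t) ?B \<le> exp 1 * (X * real n + 1) * (4 * exp (- \<gamma> * real n))" if t: "t \<in> ?W" for t
      proof -
        define x where "x = w * real (m t) / real n"
        define p where "p = 1 - exp (- (w * real (m t) / (real n)\<^sup>2))"
        define q where "q = 1 - exp (- (real (m t) / (real n)\<^sup>2))"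
        have x: "\<bar>x - lam\<bar> \<le> \<eta>" "0 \<le> x" using t w by (auto simp: x_def)
        have xX: "x \<le> X" using x \<eta> by (simp add: X_def)
        define y where "y = x / real n"
        have y: "0 \<le> y" "y \<le> 1" using x xX n by (auto simp: y_def)
        have yw: "y = w * real (m t) / (real n)\<^sup>2" by (simp add: y_def x_def power2_eq_square)
        have p: "p = 1 - exp (- y)" by (simp add: p_def yw)
        have "exp (- y) \<le> 1 + - y + (- y)\<^sup>2" using y by (intro exp_le_quadratic) simp
        moreover have "1 + - y \<le> exp (- y)" by (rule exp_ge_add_one_self)
        ultimately have "\<bar>p - y\<bar> \<le> y\<^sup>2" using p by simp
        then have "real n * \<bar>p - y\<bar> \<le> real n * y\<^sup>2" by (intro mult_left_mono) auto
        also have "real n * y\<^sup>2 = x\<^sup>2 / real n" using n by (simp add: y_def power_divide power2_eq_square)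
        also have "\<dots> \<le> X\<^sup>2 / real n" using x xX by (intro divide_right_mono power_mono) auto
        also have "\<dots> \<le> \<delta> / 4" by (rule elim(1))
        also have "real n * \<bar>p - y\<bar> = \<bar>real n * p - x\<bar>"
        proof -
          have "real n * p - x = real n * (p - y)" using n by (simp add: y_def algebra_simps)
          then show ?thesis by (simp add: abs_mult)
        qed
        finally have np: "\<bar>real n * p - lam\<bar> < \<delta>" using x(1) \<eta> d by linarith
        have "real (m t) \<le> w * real (m t)" using w mult_right_mono[of 1 w "real (m t)"] by simp
        then have "q \<le> p" unfolding p_def q_def by (simp add: divide_right_mono)
        then have "measure_pmf.prob (bit_net n bt p q) ?B \<le> 4 * exp (- \<gamma> * real n)"
          using np n S ok[of n] by (intro b[rule_format]) (auto simp: p_def q_def)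
        moreover have "real (m t) \<le> X * real n"
        proof -
          have "w * real (m t) \<le> X * real n" using xX n by (simp add: x_def field_simps)
          then show ?thesis using \<open>real (m t) \<le> w * real (m t)\<close> by simp
        qed
        ultimately have "exp 1 * (real (m t) + 1) * measure_pmf.prob (bit_net n bt p q) ?B \<le>
            exp 1 * (X * real n + 1) * (4 * exp (- \<gamma> * real n))"
          using X by (intro mult_mono) auto
        then show ?thesis using dom[OF n(1), of t ?B] unfolding p_def q_def by linarith
      qed
      then have "measure_pmf.prob (law n) ?B \<le> measure_pmf.prob (N n) (- ?W) + exp 1 * (X * real n + 1) * (4 * exp (- \<gamma> * real n))"
        unfolding law[OF n(1)] using X by (intro prob_bind_le) auto
      also have "- ?W = {t. \<eta> < \<bar>w * real (m t) / real n - lam\<bar>}" by auto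
      also have "measure_pmf.prob (N n) \<dots> \<le> K * exp (- c * real n)" by (rule elim(2))
      also have "K * exp (- c * real n) \<le> (real n ^ 2 + 1) * (K * exp (- g * real n))"
      proof -
        have "K * exp (- c * real n) \<le> K * exp (- g * real n)" using c g by (intro mult_left_mono) (auto simp: mult_right_mono)
        also have "\<dots> \<le> (real n ^ 2 + 1) * (K * exp (- g * real n))"
          using c mult_right_mono[of 1 "real n ^ 2 + 1" "K * exp (- g * real n)"] by simp
        finally show ?thesis .
      qed
      also have "exp 1 * (X * real n + 1) * (4 * exp (- \<gamma> * real n)) \<le> (real n ^ 2 + 1) * (exp 1 * (X + 1) * 4 * exp (- g * real n))"
      proof -
        have nn: "real n \<le> real n ^ 2" using n by (simp add: power2_eq_square)
        then have "X * real n \<le> X * real n ^ 2" using X by (intro mult_left_mono) auto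
        moreover have "(X + 1) * (real n ^ 2 + 1) = X * real n ^ 2 + X + real n ^ 2 + 1" by (simp add: algebra_simps)
        ultimately have "X * real n + 1 \<le> (X + 1) * (real n ^ 2 + 1)" using X zero_le_power2[of "real n"] by linarith
        then have "exp 1 * (X * real n + 1) * (4 * exp (- \<gamma> * real n)) \<le> exp 1 * ((X + 1) * (real n ^ 2 + 1)) * (4 * exp (- g * real n))"
          using X g by (intro mult_mono mult_left_mono) (auto simp: mult_right_mono)
        then show ?thesis by (simp only: mult_ac)
      qed
      finally show "measure_pmf.prob (law n) ?B \<le> (real n ^ 2 + 1) * (K' * exp (- g * real n))"
        by (simp add: K'_def algebra_simps)
    qed
  qed
  then show "\<exists>f. summable f \<and> (\<forall>\<^sub>F n in sequentially. \<forall>S. valid_rule S \<longrightarrow>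
     measure_pmf.prob (law n) (greedy_dev S n (1 - free_limit lam) eps) \<le> f n)"
    using summable_poly_exp[OF g(1), of K'] by blast
qed

text \<open>Only a lower bound on the number of edges is available. The factor
  \<open>m t + 1\<close> is therefore unbounded for fixed \<open>n\<close> and has to be absorbed by
  the exponential.\<close>

lemma greedy_cc_mixture_infinite:
  fixes bt :: "nat \<times> nat \<Rightarrow> 'e" and m :: "'t \<Rightarrow> nat"
  assumes w: "1 \<le> w" and ok: "\<And>n. bit_ok n bt"
    and law: "\<And>n. 0 < n \<Longrightarrow> law n = bind_pmf (N n) (f n)"
    and dom: "\<And>n t B. 0 < n \<Longrightarrow> measure_pmf.prob (f n t) B \<le> exp 1 * (real (m t) + 1) *
      measure_pmf.prob (bit_net n bt (1 - exp (- (w * real (m t) / (real n)\<^sup>2))) (1 - exp (- (real (m t) / (real n)\<^sup>2)))) B"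
    and tail: "\<And>K. \<forall>\<^sub>F n in sequentially. measure_pmf.prob (N n) {t. real (m t) < K * real n} \<le> 2 * exp (- 2 * real n)"
  shows "greedy_cc law 1"
  unfolding greedy_cc_def
proof (intro allI impI)
  fix eps :: real assume eps: "0 < eps"
  \<comment> \<open>With \<open>m t\<close> \<ge> \<open>K * n\<close> the quantity \<open>k\<close>
    below is at least \<open>4 * n\<close>.\<close>
  define K where "K = 32 / eps\<^sup>2"
  define L where "L = exp 1 * (1 + 8 / eps\<^sup>2)"
  have L0: "0 \<le> L" by (simp add: L_def)
  have "\<forall>\<^sub>F n in sequentially. \<forall>S. valid_rule S \<longrightarrow> measure_pmf.prob (law n) (greedy_dev S n 1 eps) \<le>
      (real n ^ 2 + 1) * ((2 + L) * exp (- 2 * real n))"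
    using tail[of K] eventually_ge_at_top[of "nat \<lceil>2 / eps\<^sup>2\<rceil> + 1"]
  proof eventually_elim
    case (elim n)
    have n: "0 < n" "2 / eps\<^sup>2 \<le> real n" using elim(2) by linarith+
    have e2: "2 \<le> eps\<^sup>2 * real n" using n eps by (simp add: divide_le_eq mult.commute)
    have "2 * real n \<le> eps\<^sup>2 * real n * real n" using e2 by (intro mult_right_mono) auto
    then have a: "eps\<^sup>2 * (real n)\<^sup>2 / 2 \<le> eps\<^sup>2 * (real n)\<^sup>2 - real n"
      by (simp add: power2_eq_square algebra_simps)
    show ?case
    proof (intro allI impI)
      fix S assume S: "valid_rule S"
      let ?B = "greedy_dev S n 1 eps"
      let ?W = "{t. K * real n \<le> real (m t)}"
      have "measure_pmf.prob (f n t) ?B \<le> L * exp (- 2 * real n)" if t: "t \<in> ?W" for t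
      proof -
        define p where "p = 1 - exp (- (w * real (m t) / (real n)\<^sup>2))"
        define q where "q = 1 - exp (- (real (m t) / (real n)\<^sup>2))"
        define h where "h = real (m t) / (real n)\<^sup>2"
        \<comment> \<open>A quarter of the exponent available before the pairs on the diagonal are
          deducted is \<open>2 * k\<close>, when that exponent is written as \<open>8 * k\<close>.
          One factor \<open>exp (- k)\<close> absorbs \<open>m t + 1\<close>, the other one beats
          the number of pairs of sets.\<close>
        define k where "k = eps\<^sup>2 / 8 * real (m t)"
        have mw: "real (m t) \<le> w * real (m t)" using w mult_right_mono[of 1 w "real (m t)"] by simp
        then have hw: "h \<le> w * real (m t) / (real n)\<^sup>2" unfolding h_def by (rule divide_right_mono) simp
        then have qp: "q \<le> p" unfolding p_def q_def h_def by simp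
        have "measure_pmf.prob (bit_net n bt p q) ?B \<le> 4 ^ n * exp (- (h * (eps\<^sup>2 * (real n)\<^sup>2 - real n) / 2))"
          unfolding greedy_dev_def
        proof (rule bit_net_greedy_dense)
          show "1 - p \<le> exp (- h)" using hw by (simp add: p_def)
        qed (use S ok qp eps n in \<open>auto simp: p_def q_def h_def\<close>)
        also have "\<dots> \<le> exp (2 * real n) * exp (- (2 * k))"
        proof (intro mult_mono four_power_le)
          have "h * (eps\<^sup>2 * (real n)\<^sup>2 / 2) \<le> h * (eps\<^sup>2 * (real n)\<^sup>2 - real n)"
            by (rule mult_left_mono[OF a]) (simp add: h_def)
          moreover have "h * (eps\<^sup>2 * (real n)\<^sup>2 / 2) = 4 * k" using n by (simp add: h_def k_def)
          ultimately show "exp (- (h * (eps\<^sup>2 * (real n)\<^sup>2 - real n) / 2)) \<le> exp (- (2 * k))" by simp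
        qed auto
        finally have "exp 1 * (real (m t) + 1) * measure_pmf.prob (bit_net n bt p q) ?B \<le>
            exp 1 * (real (m t) + 1) * (exp (2 * real n) * exp (- (2 * k)))" by (intro mult_left_mono) auto
        also have "\<dots> = exp 1 * ((real (m t) + 1) * exp (- k)) * (exp (2 * real n) * exp (- k))"
          by (simp add: mult_exp_exp mult_ac)
        also have "\<dots> \<le> exp 1 * (1 + 8 / eps\<^sup>2) * exp (- 2 * real n)"
        proof (intro mult_mono mult_left_mono)
          have "k \<le> exp k" using exp_ge_add_one_self[of k] by linarith
          then have "real (m t) \<le> 8 / eps\<^sup>2 * exp k" using eps by (simp add: k_def field_simps)
          moreover have "1 \<le> exp k" by (simp add: k_def)
          moreover have "(1 + 8 / eps\<^sup>2) * exp k = exp k + 8 / eps\<^sup>2 * exp k" by (simp add: distrib_right)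
          ultimately have "real (m t) + 1 \<le> (1 + 8 / eps\<^sup>2) * exp k" by linarith
          then show "(real (m t) + 1) * exp (- k) \<le> 1 + 8 / eps\<^sup>2" by (simp add: exp_minus field_simps)
          have "eps\<^sup>2 / 8 * (K * real n) \<le> k" unfolding k_def using t by (intro mult_left_mono) auto
          moreover have "eps\<^sup>2 / 8 * (K * real n) = 4 * real n" using eps by (simp add: K_def)
          ultimately have "4 * real n \<le> k" by linarith
          then show "exp (2 * real n) * exp (- k) \<le> exp (- 2 * real n)" by (simp add: mult_exp_exp)
        qed auto
        finally show ?thesis using dom[OF n(1), of t ?B] unfolding p_def q_def L_def by linarith
      qed
      then have "measure_pmf.prob (law n) ?B \<le> measure_pmf.prob (N n) (- ?W) + L * exp (- 2 * real n)"
        unfolding law[OF n(1)] using L0 by (intro prob_bind_le) auto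
      also have "- ?W = {t. real (m t) < K * real n}" by auto
      also have "measure_pmf.prob (N n) \<dots> \<le> 2 * exp (- 2 * real n)" by (rule elim(1))
      also have "2 * exp (- 2 * real n) + L * exp (- 2 * real n) \<le> (real n ^ 2 + 1) * ((2 + L) * exp (- 2 * real n))"
        using L0 mult_right_mono[of 1 "real n ^ 2 + 1" "(2 + L) * exp (- 2 * real n)"] by (simp add: distrib_right)
      finally show "measure_pmf.prob (law n) ?B \<le> (real n ^ 2 + 1) * ((2 + L) * exp (- 2 * real n))" by simp
    qed
  qed
  moreover have "summable (\<lambda>n. (real n ^ 2 + 1) * ((2 + L) * exp (- 2 * real n)))"
    by (rule summable_poly_exp) simp
  ultimately show "\<exists>f. summable f \<and> (\<forall>\<^sub>F n in sequentially. \<forall>S. valid_rule S \<longrightarrow>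
     measure_pmf.prob (law n) (greedy_dev S n 1 eps) \<le> f n)" by blast
qed

section \<open>Tails of the number of half-edges and the degree models\<close>

text \<open>\<open>\<theta>\<close> is chosen so small that the quadratic term in
  \<open>Poisson_tail\<close> is at most half of the linear one; adding 1 to \<open>lam\<close> in
  its denominator covers \<open>lam = 0\<close>.\<close>

lemma Poisson_window:
  assumes "0 \<le> lam" "0 < \<eta>"
  shows "\<exists>c>0. \<forall>n. measure_pmf.prob (Poisson (real n * lam)) {T. \<eta> * real n \<le> \<bar>real T - real n * lam\<bar>} \<le> 2 * exp (- c * real n)"
proof -
  define \<theta> where "\<theta> = min 1 (\<eta> / (2 * (lam + 1)))"
  have \<theta>: "0 < \<theta>" "\<theta> \<le> 1" using assms by (auto simp: \<theta>_def)
  have "\<theta> \<le> \<eta> / (2 * (lam + 1))" by (simp add: \<theta>_def)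
  then have "\<theta> * (2 * (lam + 1)) \<le> \<eta>" using assms by (simp add: pos_le_divide_eq)
  then have tl: "\<theta> * lam \<le> \<eta> / 2" using \<theta> by (simp add: algebra_simps)
  define c where "c = \<theta> * \<eta> / 2"
  have c: "0 < c" using \<theta> assms by (simp add: c_def)
  have "measure_pmf.prob (Poisson (real n * lam)) {T. \<eta> * real n \<le> \<bar>real T - real n * lam\<bar>} \<le> 2 * exp (- c * real n)" for n
  proof -
    let ?mu = "real n * lam" and ?s = "\<theta> * (\<eta> * real n)"
    have mu: "0 \<le> ?mu" using assms by simp
    have e: "?mu * \<theta>\<^sup>2 - ?s \<le> - c * real n"
    proof -
      have "(\<theta> * real n) * (\<theta> * lam) \<le> (\<theta> * real n) * (\<eta> / 2)" using tl \<theta> by (intro mult_left_mono) auto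
      then show ?thesis by (simp add: c_def power2_eq_square algebra_simps)
    qed
    have "measure_pmf.prob (Poisson ?mu) {T. \<eta> * real n \<le> \<bar>real T - ?mu\<bar>} \<le>
        measure_pmf.prob (Poisson ?mu) {T. ?s \<le> \<theta> * (real T - ?mu) \<or> ?s \<le> (- \<theta>) * (real T - ?mu)}"
    proof (rule prob_imp_le)
      fix T assume "\<eta> * real n \<le> \<bar>real T - ?mu\<bar>"
      then have "\<theta> * (\<eta> * real n) \<le> \<theta> * \<bar>real T - ?mu\<bar>" using \<theta> by (intro mult_left_mono) auto
      then show "?s \<le> \<theta> * (real T - ?mu) \<or> ?s \<le> (- \<theta>) * (real T - ?mu)"
        by (cases "0 \<le> real T - ?mu") (auto simp: abs_if algebra_simps split: if_splits)
    qed
    also have "\<dots> \<le> measure_pmf.prob (Poisson ?mu) {T. ?s \<le> \<theta> * (real T - ?mu)} +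
        measure_pmf.prob (Poisson ?mu) {T. ?s \<le> (- \<theta>) * (real T - ?mu)}" by (rule prob_disj_le)
    also have "\<dots> \<le> exp (?mu * \<theta>\<^sup>2 - ?s) + exp (?mu * (- \<theta>)\<^sup>2 - ?s)"
      using \<theta> by (intro add_mono Poisson_tail mu) auto
    also have "\<dots> \<le> 2 * exp (- c * real n)" using e by simp
    finally show ?thesis .
  qed
  then show ?thesis using c by blast
qed

text \<open>\<open>Poisson_tail\<close> with \<open>\<tau> = - 1 / 4\<close>: below half of the mean
  the linear term is at least \<open>mu / 8\<close>, the quadratic term is
  \<open>mu / 16\<close>.\<close>

lemma Poisson_half:
  assumes "0 \<le> mu" "x \<le> mu / 2"
  shows "measure_pmf.prob (Poisson mu) {T. real T < x} \<le> exp (- (mu / 16))"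
proof -
  have "measure_pmf.prob (Poisson mu) {T. real T < x} \<le> measure_pmf.prob (Poisson mu) {T. mu / 8 \<le> - (1 / 4) * (real T - mu)}"
  proof (rule prob_imp_le)
    fix T assume "real T < x"
    moreover have "- (1 / 4) * (real T - mu) = mu / 4 - real T / 4" by (simp add: diff_divide_distrib)
    ultimately show "mu / 8 \<le> - (1 / 4) * (real T - mu)" using assms by linarith
  qed
  also have "\<dots> \<le> exp (mu * (- (1 / 4))\<^sup>2 - mu / 8)" by (rule Poisson_tail) (use assms in auto)
  finally show ?thesis by (simp add: power2_eq_square)
qed

lemma prob_pair_marginals:
  "measure_pmf.prob (pair_pmf M N) {(x, y). Q x \<or> R y} \<le> measure_pmf.prob M {x. Q x} + measure_pmf.prob N {y. R y}"
proof -
  have "measure_pmf.prob (pair_pmf M N) {z. Q (fst z) \<or> R (snd z)} \<le>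
      measure_pmf.prob (pair_pmf M N) {z. Q (fst z)} + measure_pmf.prob (pair_pmf M N) {z. R (snd z)}"
    by (rule prob_disj_le)
  also have "measure_pmf.prob (pair_pmf M N) {z. Q (fst z)} = measure_pmf.prob (map_pmf fst (pair_pmf M N)) {x. Q x}"
    by (simp only: measure_map_pmf vimage_def mem_Collect_eq)
  also have "measure_pmf.prob (pair_pmf M N) {z. R (snd z)} = measure_pmf.prob (map_pmf snd (pair_pmf M N)) {x. R x}"
    by (simp only: measure_map_pmf vimage_def mem_Collect_eq)
  finally show ?thesis by (simp add: map_fst_pair_pmf map_snd_pair_pmf case_prod_unfold)
qed

lemma Poisson_rates_nonneg: "Poisson_rates lam r \<Longrightarrow> 0 \<le> r n"
  by (auto simp: Poisson_rates_def split: if_splits)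

lemma eventually_rate:
  assumes "filterlim r at_top sequentially"
  shows "\<forall>\<^sub>F n in sequentially. (a::real) \<le> r n \<and> 0 < n"
  using assms eventually_gt_at_top[of 0] by (auto simp: filterlim_at_top intro: eventually_conj)

lemma greedy_cc_DD_undirected:
  assumes "DD_Poisson_undirected lam law"
  shows "greedy_cc law (greedy_limit lam)"
proof -
  obtain r where r: "Poisson_rates lam r" and lawr: "\<And>n. law n = DD_undirected (Poisson (r n)) n"
    using assms by (auto simp: DD_Poisson_undirected_def)
  let ?N = "\<lambda>n. Poisson (real n * r n)" and ?m = "\<lambda>T::nat. T div 2"
  let ?f = "\<lambda>n T. bind_pmf (pmf_of_set (pairings {..<T})) (\<lambda>Q. map_pmf (\<lambda>h. arcs_of ((\<lambda>e. h ` e) ` Q)) (labels n T))"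
  have law: "law n = bind_pmf (?N n) (?f n)" if "0 < n" for n
    unfolding lawr by (rule DD_undirected_eq[OF that Poisson_rates_nonneg[OF r]])
  have dom: "measure_pmf.prob (?f n T) B \<le> exp 1 * (real (?m T) + 1) *
      measure_pmf.prob (bit_net n bit_und (1 - exp (- (2 * real (?m T) / (real n)\<^sup>2))) (1 - exp (- (real (?m T) / (real n)\<^sup>2)))) B"
    if "0 < n" for n T B
  proof (rule prob_bind_le_support)
    fix Q assume "Q \<in> set_pmf (pmf_of_set (pairings {..<T}))"
    then have "Q \<in> pairings {..<T}" by (simp add: set_pmf_of_set pairings_nonempty finite_pairings)
    then show "measure_pmf.prob (map_pmf (\<lambda>h. arcs_of ((\<lambda>e. h ` e) ` Q)) (labels n T)) B \<le> exp 1 * (real (?m T) + 1) *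
      measure_pmf.prob (bit_net n bit_und (1 - exp (- (2 * real (?m T) / (real n)\<^sup>2))) (1 - exp (- (real (?m T) / (real n)\<^sup>2)))) B"
      by (rule undirected_le_bit_net[OF that])
  qed simp
  \<comment> \<open>One half-edge may stay unpaired, so twice the number of pairs can fall short of
    \<open>T\<close> by one.\<close>
  have half: "2 * real (T div 2) \<le> real T" "real T - 1 \<le> 2 * real (T div 2)" for T by linarith+
  show ?thesis
  proof (cases "lam = \<infinity>")
    case True
    have rinf: "filterlim r at_top sequentially" using r True by (simp add: Poisson_rates_def)
    have "greedy_cc law 1"
    proof (rule greedy_cc_mixture_infinite[OF _ bit_ok_und law dom])
      fix K :: real
      have "\<forall>\<^sub>F n in sequentially. max 32 (4 * K + 4) \<le> r n \<and> 0 < n" by (rule eventually_rate[OF rinf])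
      then show "\<forall>\<^sub>F n in sequentially. measure_pmf.prob (?N n) {T. real (?m T) < K * real n} \<le> 2 * exp (- 2 * real n)"
      proof eventually_elim
        case (elim n)
        have rn: "32 * real n \<le> real n * r n" "real n * (4 * K + 4) \<le> real n * r n"
          using elim mult_left_mono[of "32" "r n" "real n"] mult_left_mono[of "4 * K + 4" "r n" "real n"] by (auto simp: mult.commute)
        have "measure_pmf.prob (?N n) {T. real (?m T) < K * real n} \<le> measure_pmf.prob (?N n) {T. real T < 2 * K * real n + 2}"
        proof (rule prob_imp_le)
          fix T assume "real (?m T) < K * real n"
          then show "real T < 2 * K * real n + 2" using half(2)[of T] by linarith
        qed
        also have "\<dots> \<le> exp (- (real n * r n / 16))"
        proof (rule Poisson_half)
          show "2 * K * real n + 2 \<le> real n * r n / 2" using rn(2) elim by (simp add: algebra_simps)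
        qed (use rn(1) in simp)
        also have "\<dots> \<le> exp (- 2 * real n)" using rn(1) by simp
        finally show ?case using exp_ge_zero[of "- 2 * real n"] by linarith
      qed
    qed simp_all
    then show ?thesis using True by (simp add: greedy_limit_def)
  next
    case False
    define l where "l = enn2real lam"
    have rl: "r n = l" for n using r False by (simp add: Poisson_rates_def l_def)
    have l0: "0 \<le> l" by (simp add: l_def)
    have "greedy_cc law (1 - free_limit l)"
    proof (rule greedy_cc_mixture_finite[OF l0 _ bit_ok_und law dom])
      fix \<eta> :: real assume \<eta>: "0 < \<eta>"
      then obtain c where c: "0 < c" "\<And>n. measure_pmf.prob (Poisson (real n * l)) {T. \<eta> / 2 * real n \<le> \<bar>real T - real n * l\<bar>} \<le> 2 * exp (- c * real n)"
        using Poisson_window[OF l0, of "\<eta> / 2"] by auto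
      have "\<forall>\<^sub>F n in sequentially. measure_pmf.prob (?N n) {T. \<eta> < \<bar>2 * real (?m T) / real n - l\<bar>} \<le> 2 * exp (- c * real n)"
        using eventually_ge_at_top[of "nat \<lceil>2 / \<eta>\<rceil> + 1"]
      proof eventually_elim
        case (elim n)
        have n: "0 < real n" "2 / \<eta> \<le> real n" using elim by linarith+
        \<comment> \<open>The unpaired half-edge is charged to one half of the window, hence the use
          of \<open>\<eta> / 2\<close> in the tail bound.\<close>
        have n2: "1 \<le> \<eta> / 2 * real n" using n(2) \<eta> by (simp add: field_simps)
        have "measure_pmf.prob (?N n) {T. \<eta> < \<bar>2 * real (?m T) / real n - l\<bar>} \<le>
            measure_pmf.prob (?N n) {T. \<eta> / 2 * real n \<le> \<bar>real T - real n * l\<bar>}"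
        proof (rule prob_imp_le)
          fix T assume "\<eta> < \<bar>2 * real (?m T) / real n - l\<bar>"
          then have "\<eta> * real n < \<bar>2 * real (?m T) / real n - l\<bar> * real n" using n by (intro mult_strict_right_mono)
          also have "\<dots> = \<bar>2 * real (?m T) - real n * l\<bar>"
          proof -
            have "2 * real (?m T) - real n * l = (2 * real (?m T) / real n - l) * real n" using n by (simp add: field_simps)
            then show ?thesis by (simp only: abs_mult abs_of_nat)
          qed
          finally show "\<eta> / 2 * real n \<le> \<bar>real T - real n * l\<bar>" using half[of T] n2 by (simp add: abs_if split: if_splits)
        qed
        then show ?case using c(2)[of n] by (simp add: rl)
      qed
      then show "\<exists>c>0. \<exists>K\<ge>0. \<forall>\<^sub>F n in sequentially.
          measure_pmf.prob (?N n) {T. \<eta> < \<bar>2 * real (?m T) / real n - l\<bar>} \<le> K * exp (- c * real n)"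
        using c(1) by (intro exI[of _ c] conjI exI[of _ 2]) auto
    qed simp_all
    then show ?thesis using False by (simp add: greedy_limit_def l_def)
  qed
qed

lemma greedy_cc_DD_directed:
  assumes "DD_Poisson_directed lam law"
  shows "greedy_cc law (greedy_limit lam)"
proof -
  obtain r where r: "Poisson_rates lam r" and lawr: "\<And>n. law n = DD_directed (Poisson (r n)) (Poisson (r n)) n"
    using assms by (auto simp: DD_Poisson_directed_def)
  let ?P = "\<lambda>n. Poisson (real n * r n)" and ?m = "\<lambda>(T::nat, T'). min T T'"
  let ?N = "\<lambda>n. pair_pmf (?P n) (?P n)"
  let ?f = "\<lambda>n (T, T'). bind_pmf (pmf_of_set (directed_pairings {..<T'} {..<T})) (\<lambda>Q.
      map_pmf (\<lambda>(f, g). (\<lambda>(x, y). (f x, g y)) ` Q) (pair_pmf (labels n T') (labels n T)))"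
  have law: "law n = bind_pmf (?N n) (?f n)" if "0 < n" for n
    unfolding lawr by (rule DD_directed_eq[OF that Poisson_rates_nonneg[OF r]])
  have dom: "measure_pmf.prob (?f n t) B \<le> exp 1 * (real (?m t) + 1) *
      measure_pmf.prob (bit_net n bit_dir (1 - exp (- (1 * real (?m t) / (real n)\<^sup>2))) (1 - exp (- (real (?m t) / (real n)\<^sup>2)))) B"
    if "0 < n" for n t B
  proof -
    obtain T T' where t: "t = (T, T')" by (cases t)
    have "measure_pmf.prob (map_pmf (\<lambda>(f, g). (\<lambda>(x, y). (f x, g y)) ` Q) (pair_pmf (labels n T') (labels n T))) B \<le>
        exp 1 * (real (min T T') + 1) * measure_pmf.prob (bit_net n bit_dir (1 - exp (- (real (min T T') / (real n)\<^sup>2)))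
          (1 - exp (- (real (min T T') / (real n)\<^sup>2)))) B"
      if "Q \<in> set_pmf (pmf_of_set (directed_pairings {..<T'} {..<T}))" for Q
    proof -
      have "Q \<in> directed_pairings {..<T'} {..<T}"
        using that by (simp add: set_pmf_of_set directed_pairings_nonempty finite_directed_pairings)
      then show ?thesis by (rule directed_le_bit_net[OF \<open>0 < n\<close>])
    qed
    then have "measure_pmf.prob (?f n (T, T')) B \<le> exp 1 * (real (min T T') + 1) *
        measure_pmf.prob (bit_net n bit_dir (1 - exp (- (real (min T T') / (real n)\<^sup>2)))
          (1 - exp (- (real (min T T') / (real n)\<^sup>2)))) B"
      unfolding prod.case by (rule prob_bind_le_support) simp_all
    then show ?thesis by (simp only: t prod.case mult_1)
  qed
  show ?thesis
  proof (cases "lam = \<infinity>")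
    case True
    have rinf: "filterlim r at_top sequentially" using r True by (simp add: Poisson_rates_def)
    have "greedy_cc law 1"
    proof (rule greedy_cc_mixture_infinite[OF _ bit_ok_dir law dom])
      fix K :: real
      have "\<forall>\<^sub>F n in sequentially. max 32 (2 * K) \<le> r n \<and> 0 < n" by (rule eventually_rate[OF rinf])
      then show "\<forall>\<^sub>F n in sequentially. measure_pmf.prob (?N n) {t. real (?m t) < K * real n} \<le> 2 * exp (- 2 * real n)"
      proof eventually_elim
        case (elim n)
        have rn: "32 * real n \<le> real n * r n" "real n * (2 * K) \<le> real n * r n"
          using elim mult_left_mono[of "32" "r n" "real n"] mult_left_mono[of "2 * K" "r n" "real n"] by (auto simp: mult.commute)
        have "measure_pmf.prob (?P n) {T. real T < K * real n} \<le> exp (- (real n * r n / 16))"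
          by (rule Poisson_half) (use rn in \<open>auto simp: algebra_simps\<close>)
        also have "\<dots> \<le> exp (- 2 * real n)" using rn(1) by simp
        finally have one: "measure_pmf.prob (?P n) {T. real T < K * real n} \<le> exp (- 2 * real n)" .
        have "{t. real (?m t) < K * real n} = {(T, T'). real T < K * real n \<or> real T' < K * real n}"
          by (auto simp: min_def split: if_splits)
        then show ?case
          using prob_pair_marginals[of "?P n" "?P n" "\<lambda>T. real T < K * real n" "\<lambda>T. real T < K * real n"] one by simp
      qed
    qed simp_all
    then show ?thesis using True by (simp add: greedy_limit_def)
  next
    case False
    define l where "l = enn2real lam"
    have rl: "r n = l" for n using r False by (simp add: Poisson_rates_def l_def)
    have l0: "0 \<le> l" by (simp add: l_def)
    have "greedy_cc law (1 - free_limit l)"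
    proof (rule greedy_cc_mixture_finite[OF l0 _ bit_ok_dir law dom])
      fix \<eta> :: real assume \<eta>: "0 < \<eta>"
      then obtain c where c: "0 < c" "\<And>n. measure_pmf.prob (Poisson (real n * l)) {T. \<eta> * real n \<le> \<bar>real T - real n * l\<bar>} \<le> 2 * exp (- c * real n)"
        using Poisson_window[OF l0, of \<eta>] by auto
      have "\<forall>\<^sub>F n in sequentially. measure_pmf.prob (?N n) {t. \<eta> < \<bar>1 * real (?m t) / real n - l\<bar>} \<le> 4 * exp (- c * real n)"
        using eventually_gt_at_top[of 0]
      proof eventually_elim
        case (elim n)
        let ?Q = "\<lambda>T. \<eta> * real n \<le> \<bar>real T - real n * l\<bar>"
        have "measure_pmf.prob (?N n) {t. \<eta> < \<bar>1 * real (?m t) / real n - l\<bar>} \<le>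
            measure_pmf.prob (?N n) {t. ?Q (fst t) \<or> ?Q (snd t)}"
        proof (rule prob_imp_le)
          fix t assume a: "\<eta> < \<bar>1 * real (?m t) / real n - l\<bar>"
          obtain T T' where t: "t = (T, T')" by (cases t)
          have "?Q (min T T')"
          proof -
            have "\<eta> * real n \<le> \<bar>real (min T T') / real n - l\<bar> * real n" using a elim t by (intro mult_right_mono) auto
            also have "\<dots> = \<bar>real (min T T') - real n * l\<bar>"
            proof -
              have "real (min T T') - real n * l = (real (min T T') / real n - l) * real n" using elim by (simp add: field_simps)
              then show ?thesis by (simp only: abs_mult abs_of_nat)
            qed
            finally show ?thesis .
          qed
          \<comment> \<open>The minimum is one of the two totals, so a deviation of the minimum is a
            deviation of one of them.\<close>
          then show "?Q (fst t) \<or> ?Q (snd t)" by (cases "T \<le> T'") (simp_all add: t min_def)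
        qed
        also have "\<dots> \<le> measure_pmf.prob (?P n) {T. ?Q T} + measure_pmf.prob (?P n) {T. ?Q T}"
          using prob_pair_marginals[of "?P n" "?P n" ?Q ?Q] by (simp add: case_prod_unfold)
        also have "\<dots> \<le> 4 * exp (- c * real n)" using c(2)[of n] by (simp add: rl)
        finally show ?case .
      qed
      then show "\<exists>c>0. \<exists>K\<ge>0. \<forall>\<^sub>F n in sequentially.
          measure_pmf.prob (?N n) {t. \<eta> < \<bar>1 * real (?m t) / real n - l\<bar>} \<le> K * exp (- c * real n)"
        using c(1) by (intro exI[of _ c] conjI exI[of _ 4]) auto
    qed simp_all
    then show ?thesis using False by (simp add: greedy_limit_def l_def)
  qed
qed

lemma arcs_of_subset: "(\<And>e. e \<in> F \<Longrightarrow> e \<subseteq> V n) \<Longrightarrow> arcs_of F \<subseteq> V n \<times> V n"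
  by (auto simp: arcs_of_def)

lemma arcs_of_possible: "F \<subseteq> possible_edges n \<Longrightarrow> arcs_of F \<subseteq> V n \<times> V n"
  by (rule arcs_of_subset) (auto simp: possible_edges_def)

lemma set_pmf_uniform_subsets:
  assumes "finite A" "k \<le> card A"
  shows "set_pmf (pmf_of_set {X. X \<subseteq> A \<and> card X = k}) = {X. X \<subseteq> A \<and> card X = k}"
proof (rule set_pmf_of_set)
  show "{X. X \<subseteq> A \<and> card X = k} \<noteq> {}" using obtain_subset_with_card_n[OF assms(2)] by auto
qed (use assms in simp)

text \<open>Although the degrees are unbounded, the networks live on \<open>V n\<close>. The laws
  therefore have finite support, which the passage to random rules relies on.\<close>

lemma model_support:
  assumes "ER_directed lam law \<or> ER_undirected lam law \<or> UFS_directed lam law \<or> UFS_undirected lam law \<or>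
      DD_Poisson_undirected lam law \<or> DD_Poisson_directed lam law"
  shows "set_pmf (law n) \<subseteq> Pow (V n \<times> V n)"
  using assms
proof (elim disjE)
  assume "ER_directed lam law"
  then show ?thesis
    using random_subset_subset[OF finite_possible(1)] by (fastforce simp: ER_directed_def possible_arcs_def)
next
  assume "ER_undirected lam law"
  then obtain p where "law n = map_pmf arcs_of (random_subset (possible_edges n) p)" by (auto simp: ER_undirected_def)
  then show ?thesis
    using arcs_of_possible[OF random_subset_subset[OF finite_possible(2)]] by auto
next
  assume "UFS_directed lam law"
  then show ?thesis
    using set_pmf_uniform_subsets[OF finite_possible(1)] by (auto simp: UFS_directed_def possible_arcs_def)
next
  assume "UFS_undirected lam law"
  then obtain k where k: "k \<le> card (possible_edges n)"
    "law n = map_pmf arcs_of (pmf_of_set {F. F \<subseteq> possible_edges n \<and> card F = k})" by (auto simp: UFS_undirected_def)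
  show ?thesis unfolding k(2) set_map_pmf set_pmf_uniform_subsets[OF finite_possible(2) k(1)]
    using arcs_of_possible by blast
next
  assume "DD_Poisson_undirected lam law"
  then obtain r where r: "law n = DD_undirected (Poisson r) n" by (auto simp: DD_Poisson_undirected_def)
  have "arcs_of ((\<lambda>e. fst ` e) ` P) \<subseteq> V n \<times> V n" if "P \<in> pairings (half_edges n D)" for P D
    by (rule arcs_of_subset) (use that in \<open>fastforce simp: pairings_def half_edges_def\<close>)
  then show ?thesis
    unfolding r DD_undirected_def by (auto simp: set_pmf_of_set pairings_nonempty finite_pairings finite_half_edges)
next
  assume "DD_Poisson_directed lam law"
  then obtain r where r: "law n = DD_directed (Poisson r) (Poisson r) n" by (auto simp: DD_Poisson_directed_def)
  have sub: "(\<lambda>(h, h'). (fst h, fst h')) ` P \<subseteq> V n \<times> V n"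
    if "P \<in> directed_pairings (half_edges n D) (half_edges n D')" for P D D'
    using that by (fastforce simp: directed_pairings_def half_edges_def)
  show ?thesis
  proof
    fix g assume "g \<in> set_pmf (law n)"
    then obtain D D' P where "P \<in> directed_pairings (half_edges n D) (half_edges n D')"
      "g = (\<lambda>(h, h'). (fst h, fst h')) ` P"
      unfolding r DD_directed_def
      by (auto simp: set_pmf_of_set directed_pairings_nonempty finite_directed_pairings finite_half_edges)
    then show "g \<in> Pow (V n \<times> V n)" using sub by simp
  qed
qed

theorem mainTheorem5:
  fixes Om :: "'a measure"
    and lam :: ennreal
    and law :: "nat \<Rightarrow> network pmf"
    and G :: "nat \<Rightarrow> 'a \<Rightarrow> network"
    and S :: "nat \<Rightarrow> 'a \<Rightarrow> rule"
  assumes "prob_space Om"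
    and model: "ER_directed lam law \<or> ER_undirected lam law \<or>
      UFS_directed lam law \<or> UFS_undirected lam law \<or>
      DD_Poisson_undirected lam law \<or> DD_Poisson_directed lam law"
    and network: "\<And>n. G n \<in> measurable Om (count_space UNIV)"
      "\<And>n. distr Om (count_space UNIV) (G n) = measure_pmf (law n)"
    and rule: "\<And>n \<omega>. \<omega> \<in> space Om \<Longrightarrow> valid_rule (S n \<omega>)"
      "\<And>n. prob_space.indep_set Om (range (\<lambda>A. S n -` A \<inter> space Om))
                                  (range (\<lambda>B. G n -` B \<inter> space Om))"
  shows "(lam = 0 \<longrightarrow>
           (AE \<omega> in Om. (\<lambda>n. real (card (greedy_matching (S n \<omega>) n (G n \<omega>))) / real n)
              \<longlonglongrightarrow> 0)) \<and>
         (lam = \<infinity> \<longrightarrow>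
           (AE \<omega> in Om. (\<lambda>n. real (card (greedy_matching (S n \<omega>) n (G n \<omega>))) / real n)
              \<longlonglongrightarrow> 1)) \<and>
         (0 < lam \<and> lam < \<infinity> \<longrightarrow>
           (AE \<omega> in Om. (\<lambda>n. real (card (greedy_matching (S n \<omega>) n (G n \<omega>))) / real n)
              \<longlonglongrightarrow> 1 - ln (2 - exp (- enn2real lam)) / enn2real lam))"
proof -
  have cc: "greedy_cc law (greedy_limit lam)"
    using model greedy_cc_ER_directed greedy_cc_ER_undirected greedy_cc_UFS_directed
      greedy_cc_UFS_undirected greedy_cc_DD_undirected greedy_cc_DD_directed by blast
  have fin: "finite (set_pmf (law n))" for n
    by (rule finite_subset[OF model_support[OF model]]) simp
  have AE: "AE \<omega> in Om. (\<lambda>n. real (card (greedy_matching (S n \<omega>) n (G n \<omega>))) / real n) \<longlonglongrightarrow> greedy_limit lam"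
    by (rule AE_greedy[OF assms(1) network rule fin cc])
  have "greedy_limit 0 = 0" by (simp add: greedy_limit_def free_limit_def)
  moreover have "greedy_limit \<infinity> = 1" by (simp add: greedy_limit_def)
  moreover have "greedy_limit lam = 1 - ln (2 - exp (- enn2real lam)) / enn2real lam" if "0 < lam" "lam < \<infinity>"
  proof -
    have "enn2real lam \<noteq> 0" using that by (auto simp: enn2real_eq_0_iff)
    then show ?thesis using that by (simp add: greedy_limit_def free_limit_def)
  qed
  ultimately show ?thesis using AE by auto
qed

end
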